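(* Let $q>1$, $\nu\in(0,1]$, $0<T\le\infty$, and let $\Omega$ be any domain of $\mathbb{R}^N$. Let $u$ be any nonnegative weak solution of $$u_t-\nu\Delta u+|\nabla u|^q=0\quad\text{in }Q_{\Omega,T}=\Omega\times(0,T),$$ and let $B(x_0,2\eta)\subset\subset\Omega$ be such that $u$ has a trace $u_0\in L^R_{loc}(\Omega)$, $R\ge 1$, and $u\in C([0,T);L^R_{loc}(\Omega))$. Then for any $0<t\le\tau<T$, $$\sup_{x\in B(x_0,\eta/2)}u(x,t)\le C\,t^{-\frac{N}{2R}}\bigl(t+\|u_0\|_{L^R(B(x_0,\eta))}\bigr),\qquad C=C(N,q,\nu,R,\eta,\tau).$$ If $R=1$, the estimate remains true when $u$ has a trace $u_0\in\mathcal{M}^+(\Omega)$ (with $\|u_0\|_{L^1(B(x_0,\eta))}$ replaced by $\int_{B(x_0,\eta)}du_0$).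
   Context: $\mathcal{M}^+(\Omega)$ is the set of nonnegative Radon measures on $\Omega$; $B(x_0,r)$ is the ball of center $x_0$ and radius $r$. $C=C(\dots)$ means that the constant depends only on the listed quantities. A nonnegative function $u$ is a weak solution of $u_t-\nu\Delta u+|\nabla u|^q=0$ in $Q_{\Omega,T}$ if $u\in C((0,T);L^1_{loc}(\Omega))\cap L^1_{loc}((0,T);W^{1,1}_{loc}(\Omega))$, $|\nabla u|^q\in L^1_{loc}(Q_{\Omega,T})$, and $$\int_0^T\int_\Omega(-u\varphi_t-\nu u\Delta\varphi+|\nabla u|^q\varphi)\,dx\,dt=0\qquad\forall\varphi\in\mathcal{D}(Q_{\Omega,T}).$$ $u$ has a trace $u_0\in\mathcal{M}^+(\Omega)$ if $\lim_{t\to0}\int_\Omega u(\cdot,t)\psi\,dx=\int_\Omega\psi\,du_0$ for all $\psi\in C_c(\Omega)$. A nonnegative function in $L^1_{loc}(\Omega)$ is identified with the measure of which it is the density; when $u\in C([0,T);L^R_{loc}(\Omega))$, $u(\cdot,0)=u_0$. *)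

theory Defs
  imports "HOL-Analysis.Analysis" "HOL-Probability.Essential_Supremum"
begin

text \<open>Elements of Lebesgue and Sobolev spaces are represented by functions, and everything below
  is insensitive to changes on null sets, so measurability and integrals refer to
  \<^const>\<open>lebesgue\<close> rather than \<^const>\<open>lborel\<close>. A function on space-time is written
  \<open>u t x\<close>, so that \<open>u t\<close> is the slice \<open>u(\<cdot>,t)\<close>; points of space-time are pairs \<open>(x, t)\<close>.\<close>

definition compactly_contained :: "'a::topological_space set \<Rightarrow> 'a set \<Rightarrow> bool" where
  "compactly_contained A \<Omega> \<longleftrightarrow> compact (closure A) \<and> closure A \<subseteq> \<Omega>"


subsection \<open>Test functions\<close>

definition dir_deriv :: "'a::euclidean_space \<Rightarrow> ('a \<Rightarrow> real) \<Rightarrow> 'a \<Rightarrow> real" where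
  "dir_deriv v f = (\<lambda>z. frechet_derivative f (at z) v)"

primrec Ck :: "nat \<Rightarrow> ('a::euclidean_space \<Rightarrow> real) \<Rightarrow> bool" where
  "Ck 0 f \<longleftrightarrow> continuous_on UNIV f"
| "Ck (Suc k) f \<longleftrightarrow> (\<forall>z. f differentiable (at z)) \<and> (\<forall>b\<in>Basis. Ck k (dir_deriv b f))"

text \<open>Functions in \<open>C\<^sub>c(U)\<close> and \<open>\<D>(U)\<close>, for open \<open>U\<close>, are represented by
  their extensions by zero to the whole space.\<close>

definition Cc :: "'a::euclidean_space set \<Rightarrow> ('a \<Rightarrow> real) set" where
  "Cc U = {\<psi>. continuous_on UNIV \<psi> \<and> compactly_contained {z. \<psi> z \<noteq> 0} U}"

definition test_functions :: "'a::euclidean_space set \<Rightarrow> ('a \<Rightarrow> real) set" where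
  "test_functions U = {\<phi>. (\<forall>k. Ck k \<phi>) \<and> compactly_contained {z. \<phi> z \<noteq> 0} U}"

definition time_deriv :: "('a::euclidean_space \<times> real \<Rightarrow> real) \<Rightarrow> 'a \<times> real \<Rightarrow> real" where
  "time_deriv \<phi> = dir_deriv (0, 1) \<phi>"

definition space_laplacian :: "('a::euclidean_space \<times> real \<Rightarrow> real) \<Rightarrow> 'a \<times> real \<Rightarrow> real" where
  "space_laplacian \<phi> = (\<lambda>z. \<Sum>b\<in>Basis. dir_deriv (b, 0) (dir_deriv (b, 0) \<phi>) z)"


subsection \<open>Function spaces\<close>

definition Lp_loc :: "real \<Rightarrow> 'a::euclidean_space set \<Rightarrow> ('a \<Rightarrow> 'b::euclidean_space) \<Rightarrow> bool" where
  "Lp_loc p \<Omega> f \<longleftrightarrow> set_borel_measurable lebesgue \<Omega> f \<and>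
     (\<forall>K. compact K \<and> K \<subseteq> \<Omega> \<longrightarrow> set_integrable lebesgue K (\<lambda>x. norm (f x) powr p))"

definition Lp_norm :: "real \<Rightarrow> 'a::euclidean_space set \<Rightarrow> ('a \<Rightarrow> 'b::euclidean_space) \<Rightarrow> real" where
  "Lp_norm p A f = (LINT x:A|lebesgue. norm (f x) powr p) powr (1 / p)"

text \<open>\<open>u \<in> C(J; L\<^sup>p\<^sub>l\<^sub>o\<^sub>c(\<Omega>))\<close>\<close>
definition C_Lp_loc ::
  "real set \<Rightarrow> real \<Rightarrow> 'a::euclidean_space set \<Rightarrow> (real \<Rightarrow> 'a \<Rightarrow> real) \<Rightarrow> bool" where
  "C_Lp_loc J p \<Omega> u \<longleftrightarrow> (\<forall>t\<in>J. Lp_loc p \<Omega> (u t)) \<and>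
     (\<forall>K. compact K \<and> K \<subseteq> \<Omega> \<longrightarrow>
        (\<forall>s\<in>J. ((\<lambda>t. Lp_norm p K (\<lambda>x. u t x - u s x)) \<longlongrightarrow> 0) (at s within J)))"

text \<open>\<open>f \<in> W\<^sup>1\<^sup>,\<^sup>1\<^sub>l\<^sub>o\<^sub>c(\<Omega>)\<close> with weak gradient \<open>g\<close>\<close>
definition W11_loc ::
  "'a::euclidean_space set \<Rightarrow> ('a \<Rightarrow> real) \<Rightarrow> ('a \<Rightarrow> 'a) \<Rightarrow> bool" where
  "W11_loc \<Omega> f g \<longleftrightarrow> Lp_loc 1 \<Omega> f \<and> Lp_loc 1 \<Omega> g \<and>
     (\<forall>\<psi>\<in>test_functions \<Omega>. \<forall>b\<in>Basis.
        (LINT x:\<Omega>|lebesgue. f x * dir_deriv b \<psi> x) = - (LINT x:\<Omega>|lebesgue. (g x \<bullet> b) * \<psi> x))"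

text \<open>\<open>u \<in> L\<^sup>1\<^sub>l\<^sub>o\<^sub>c(J; W\<^sup>1\<^sup>,\<^sup>1\<^sub>l\<^sub>o\<^sub>c(\<Omega>))\<close> with spatial weak
  gradient \<open>Du\<close>. The spaces \<open>W\<^sup>1\<^sup>,\<^sup>1(K)\<close> being separable, strong measurability in time is
  joint measurability of \<open>u\<close> and \<open>Du\<close>.\<close>
definition L1_loc_W11_loc ::
  "real set \<Rightarrow> 'a::euclidean_space set \<Rightarrow> (real \<Rightarrow> 'a \<Rightarrow> real) \<Rightarrow> (real \<Rightarrow> 'a \<Rightarrow> 'a) \<Rightarrow> bool" where
  "L1_loc_W11_loc J \<Omega> u Du \<longleftrightarrow>
     set_borel_measurable lebesgue (\<Omega> \<times> J) (\<lambda>(x, t). u t x) \<and>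
     set_borel_measurable lebesgue (\<Omega> \<times> J) (\<lambda>(x, t). Du t x) \<and>
     (AE t in lebesgue. t \<in> J \<longrightarrow> W11_loc \<Omega> (u t) (Du t)) \<and>
     (\<forall>I K. compact I \<and> I \<subseteq> J \<and> compact K \<and> K \<subseteq> \<Omega> \<longrightarrow>
        set_integrable lebesgue I (\<lambda>t. Lp_norm 1 K (u t) + Lp_norm 1 K (Du t)))"


subsection \<open>Weak solutions and initial traces\<close>

definition open_time :: "ereal \<Rightarrow> real set" where
  "open_time T = {t. 0 < t \<and> ereal t < T}"

definition half_open_time :: "ereal \<Rightarrow> real set" where
  "half_open_time T = {t. 0 \<le> t \<and> ereal t < T}"

definition Q :: "'a set \<Rightarrow> ereal \<Rightarrow> ('a \<times> real) set" where
  "Q \<Omega> T = \<Omega> \<times> open_time T"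

definition nonneg_weak_solution ::
  "real \<Rightarrow> real \<Rightarrow> 'a::euclidean_space set \<Rightarrow> ereal \<Rightarrow> (real \<Rightarrow> 'a \<Rightarrow> real) \<Rightarrow> bool" where
  "nonneg_weak_solution \<nu> q \<Omega> T u \<longleftrightarrow>
     (AE (x, t) in lebesgue. (x, t) \<in> Q \<Omega> T \<longrightarrow> 0 \<le> u t x) \<and>
     C_Lp_loc (open_time T) 1 \<Omega> u \<and>
     (\<exists>Du. L1_loc_W11_loc (open_time T) \<Omega> u Du \<and>
           Lp_loc 1 (Q \<Omega> T) (\<lambda>(x, t). norm (Du t x) powr q) \<and>
           (\<forall>\<phi>\<in>test_functions (Q \<Omega> T).
              (LINT t:open_time T|lebesgue. LINT x:\<Omega>|lebesgue.
                 - u t x * time_deriv \<phi> (x, t) - \<nu> * u t x * space_laplacian \<phi> (x, t)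
                 + norm (Du t x) powr q * \<phi> (x, t)) = 0))"

text \<open>On an open subset of a Euclidean space, a Borel measure that is finite on compact sets is
  automatically regular.\<close>
definition nonneg_radon_measure :: "'a::euclidean_space set \<Rightarrow> 'a measure \<Rightarrow> bool" where
  "nonneg_radon_measure \<Omega> \<mu> \<longleftrightarrow> sets \<mu> = sets (restrict_space borel \<Omega>) \<and>
     (\<forall>K. compact K \<and> K \<subseteq> \<Omega> \<longrightarrow> emeasure \<mu> K < \<infinity>)"

definition has_trace ::
  "'a::euclidean_space set \<Rightarrow> (real \<Rightarrow> 'a \<Rightarrow> real) \<Rightarrow> 'a measure \<Rightarrow> bool" where
  "has_trace \<Omega> u \<mu> \<longleftrightarrow> (\<forall>\<psi>\<in>Cc \<Omega>.
     ((\<lambda>t. LINT x:\<Omega>|lebesgue. u t x * \<psi> x) \<longlongrightarrow> (LINT x:\<Omega>|\<mu>. \<psi> x)) (at_right 0))"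

text \<open>The measure with which a nonnegative function in \<open>L\<^sup>1\<^sub>l\<^sub>o\<^sub>c(\<Omega>)\<close> is
  identified; its \<open>\<sigma>\<close>-algebra is the Lebesgue one, which contains the Borel sets.\<close>
definition measure_of_density :: "'a::euclidean_space set \<Rightarrow> ('a \<Rightarrow> real) \<Rightarrow> 'a measure" where
  "measure_of_density \<Omega> f = density (lebesgue_on \<Omega>) (\<lambda>x. ennreal (f x))"

text \<open>Slices of a weak solution are defined up to null sets, so the supremum is the essential one.\<close>
definition sup_on :: "'a::euclidean_space set \<Rightarrow> ('a \<Rightarrow> real) \<Rightarrow> ereal" where
  "sup_on A f = esssup (lebesgue_on A) (\<lambda>x. ereal (f x))"

end

theory Submission
  imports Defs "HOL-Probability.Distributions"
begin

text \<open>The estimate rests on two facts about a nonnegative weak solution \<open>u\<close>.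

\<^bold>\<open>Mass cannot flow into a ball faster than a fixed rate.\<close> Testing with a cutoff \<open>\<xi>\<close>, the only term
that can increase \<open>\<integral>u \<xi>\<close> is the flux \<open>-\<nu> \<integral>\<nabla>u \<bullet> \<nabla>\<xi>\<close>. If \<open>\<xi>\<close> is a high power of a cutoff then
\<open>\<bar>\<nabla>\<xi>\<bar> \<le> L \<xi>\<^bsup>1/q\<^esup>\<close> (\<open>cutoff_gradient_absorption\<close>), and Young's inequality bounds the flux by the
absorption \<open>\<integral>\<bar>\<nabla>u\<bar>\<^sup>q \<xi>\<close> plus a constant. Hence \<open>\<integral>u(t) \<xi> \<le> \<integral>\<xi> du\<^sub>0 + C t\<close> (\<open>local_mass_bound\<close>). This is
where the local estimate differs from the heat equation, for which mass far away cannot be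
ignored.

\<^bold>\<open>A subsolution of the heat equation with bounded local mass is bounded by the heat flow of its
initial trace.\<close> Dropping the absorption term, one tests with \<open>\<phi>\<close> times the backward heat kernel with
pole \<open>(x, t + \<delta>)\<close>. The kernel solves the backward heat equation, so the only remaining terms contain
derivatives of the cutoff \<open>\<phi>\<close>; they live at a positive distance from \<open>x\<close>, where the kernel and its
gradient are bounded uniformly in time (\<open>heat_kernel_flux_bound\<close>). They are therefore controlled by
the local mass. The outcome (\<open>kernel_bound\<close>) is
\<open>\<integral>u(t) \<phi> G\<^sub>\<delta>(\<cdot> - x) \<le> \<integral>\<phi> G\<^sub>t\<^sub>+\<^sub>\<delta>(\<cdot> - x) du\<^sub>0 + C (mass + t) t\<close>.

As \<open>\<delta>\<close> tends to \<open>0\<close> the left-hand side dominates a multiple of the average of \<open>u(t)\<close> over a small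
cube at \<open>x\<close>, hence a multiple of \<open>u(t, x)\<close> at Lebesgue points (\<open>pointwise_bound\<close>). On the right-hand
side \<open>G\<^sub>r\<close> has supremum of order \<open>r\<^bsup>-N/2\<^esup>\<close> and constant integral, so Hoelder's inequality gives the
factor \<open>t\<^bsup>-N/(2R)\<^esup>\<close> in front of the \<open>L\<^sup>R\<close> norm (\<open>weighted_integral_le_Lp_norm\<close>); for a measure the
supremum alone gives \<open>t\<^bsup>-N/2\<^esup>\<close>. The remaining terms are absorbed into \<open>t\<^bsup>-N/(2R)\<^esup>\<close> because \<open>t \<le> \<tau>\<close>.

All test functions are products of smooth functions built by hand, and an inequality for all
nonnegative test functions of time becomes a pointwise inequality between two times by
\<open>weak_derivative_le_imp_increment_le\<close>. The trace enters only through the limits of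
\<open>\<integral>u(t) \<psi>\<close>, which treats densities and measures alike (\<open>local_regularizing_effect\<close>).\<close>

section \<open>Smooth functions\<close>

text \<open>Smoothness on an open set rather than on the whole space is the right notion here: the
  backward heat kernel is smooth only before the time of its pole.\<close>
primrec Ck_on :: "nat \<Rightarrow> 'a::euclidean_space set \<Rightarrow> ('a \<Rightarrow> real) \<Rightarrow> bool" where
  "Ck_on 0 U f \<longleftrightarrow> continuous_on U f"
| "Ck_on (Suc k) U f \<longleftrightarrow> (\<forall>z\<in>U. f differentiable (at z)) \<and> (\<forall>b\<in>Basis. Ck_on k U (dir_deriv b f))"

definition smooth_on :: "'a::euclidean_space set \<Rightarrow> ('a \<Rightarrow> real) \<Rightarrow> bool" where
  "smooth_on U f \<longleftrightarrow> (\<forall>k. Ck_on k U f)"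

lemma Ck_iff_Ck_on: "Ck k f \<longleftrightarrow> Ck_on k UNIV f"
  by (induction k arbitrary: f) auto

lemma test_functions_iff:
  "\<phi> \<in> test_functions U \<longleftrightarrow> smooth_on UNIV \<phi> \<and> compactly_contained {z. \<phi> z \<noteq> 0} U"
  by (simp add: test_functions_def smooth_on_def Ck_iff_Ck_on)

lemma dir_derivI: "(f has_derivative f') (at z) \<Longrightarrow> dir_deriv b f z = f' b"
  unfolding dir_deriv_def using frechet_derivative_at by metis

lemma differentiable_imp_has_derivative:
  "f differentiable (at z) \<Longrightarrow> (f has_derivative (\<lambda>b. dir_deriv b f z)) (at z)"
  unfolding dir_deriv_def by (simp add: frechet_derivative_works)

lemma dir_deriv_real: "(f has_real_derivative D) (at z) \<Longrightarrow> dir_deriv 1 f z = D"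
  by (subst dir_derivI[of f "(*) D"]) (auto simp: has_field_derivative_def)

lemma real_derivative_dir_deriv:
  "f differentiable (at z) \<Longrightarrow> (f has_real_derivative dir_deriv 1 f z) (at (z::real))"
  by (metis dir_deriv_real real_differentiableE)

lemma dir_deriv_linear:
  assumes "f differentiable (at z)"
  shows "dir_deriv v f z = (\<Sum>b\<in>Basis. (v \<bullet> b) * dir_deriv b f z)"
proof -
  have lin: "linear (\<lambda>b. dir_deriv b f z)"
    using differentiable_imp_has_derivative[OF assms] has_derivative_linear by blast
  have "dir_deriv (\<Sum>b\<in>Basis. (v \<bullet> b) *\<^sub>R b) f z = (\<Sum>b\<in>Basis. (v \<bullet> b) * dir_deriv b f z)"
    using linear_sum[OF lin, of "\<lambda>b. (v \<bullet> b) *\<^sub>R b" Basis] linear_scale[OF lin] by simp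
  then show ?thesis
    by (simp add: euclidean_representation)
qed

text \<open>Once differentiability is known, directional derivatives can be computed by one-variable calculus.\<close>
lemma dir_deriv_line:
  assumes "f differentiable (at z)" "((\<lambda>s. f (z + s *\<^sub>R w)) has_real_derivative D) (at 0)"
  shows "dir_deriv w f z = D"
proof -
  have "((\<lambda>s. z + s *\<^sub>R w) has_derivative (\<lambda>s. s *\<^sub>R w)) (at 0)"
    by (auto intro!: derivative_eq_intros)
  moreover have "(f has_derivative (\<lambda>b. dir_deriv b f z)) (at (z + 0 *\<^sub>R w))"
    using differentiable_imp_has_derivative[OF assms(1)] by simp
  ultimately have "((\<lambda>s. f (z + s *\<^sub>R w)) has_derivative (\<lambda>s. dir_deriv (s *\<^sub>R w) f z)) (at 0)"
    by (rule has_derivative_compose)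
  with assms(2) have "(*) D = (\<lambda>s. dir_deriv (s *\<^sub>R w) f z)"
    unfolding has_field_derivative_def by (rule has_derivative_unique)
  from fun_cong[OF this, of 1] show ?thesis by simp
qed

lemma dir_deriv_cong:
  assumes "open U" "\<And>z. z \<in> U \<Longrightarrow> f z = g z" "z \<in> U"
  shows "f differentiable (at z) \<longleftrightarrow> g differentiable (at z)" "dir_deriv b f z = dir_deriv b g z"
proof -
  have e: "(f has_derivative D) (at z) \<longleftrightarrow> (g has_derivative D) (at z)" for D
    using assms has_derivative_transform_within_open[of f D z UNIV U g]
      has_derivative_transform_within_open[of g D z UNIV U f] by auto
  then show "f differentiable (at z) \<longleftrightarrow> g differentiable (at z)"
    by (simp add: differentiable_def)
  show "dir_deriv b f z = dir_deriv b g z"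
    unfolding dir_deriv_def frechet_derivative_def by (simp add: e)
qed

lemma Ck_on_cong:
  assumes "open U" "\<And>z. z \<in> U \<Longrightarrow> f z = g z"
  shows "Ck_on k U f \<longleftrightarrow> Ck_on k U g"
  using assms(2)
proof (induction k arbitrary: f g)
  case 0
  then show ?case using continuous_on_cong[OF refl, of U f g] by auto
next
  case (Suc k)
  have "Ck_on k U (dir_deriv b f) \<longleftrightarrow> Ck_on k U (dir_deriv b g)" for b
    by (rule Suc.IH) (rule dir_deriv_cong(2)[OF assms(1) Suc.prems])
  then show ?case
    using dir_deriv_cong(1)[OF assms(1) Suc.prems] by auto
qed

lemma Ck_on_SucD: "Ck_on (Suc k) U f \<Longrightarrow> Ck_on k U f"
  by (induction k arbitrary: f) (auto intro!: continuous_at_imp_continuous_on differentiable_imp_continuous_within)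

lemma Ck_on_subset: "Ck_on k U f \<Longrightarrow> V \<subseteq> U \<Longrightarrow> Ck_on k V f"
  by (induction k arbitrary: f) (auto intro: continuous_on_subset)

lemma Ck_on_Un: "open U \<Longrightarrow> open V \<Longrightarrow> Ck_on k U f \<Longrightarrow> Ck_on k V f \<Longrightarrow> Ck_on k (U \<union> V) f"
  by (induction k arbitrary: f) (auto intro: continuous_on_open_Un)

lemma dir_deriv_const [simp]: "dir_deriv b (\<lambda>z. c) = (\<lambda>z. 0)"
  by (rule ext, rule dir_derivI[of "\<lambda>z. c" "\<lambda>z. 0", simplified])

lemma Ck_on_const: "Ck_on k U (\<lambda>z. c)"
  by (induction k arbitrary: c) auto

lemma dir_deriv_inner [simp]: "dir_deriv b (\<lambda>z. z \<bullet> c) = (\<lambda>z. b \<bullet> c)"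
  by (rule ext, rule dir_derivI) (auto intro!: derivative_eq_intros)

lemma Ck_on_inner: "Ck_on k U (\<lambda>z. z \<bullet> c)"
  by (cases k) (auto intro!: Ck_on_const continuous_intros)

lemma dir_deriv_add:
  "f differentiable (at z) \<Longrightarrow> g differentiable (at z) \<Longrightarrow>
    dir_deriv b (\<lambda>z. f z + g z) z = dir_deriv b f z + dir_deriv b g z"
  by (rule dir_derivI, rule has_derivative_add; rule differentiable_imp_has_derivative)

lemma dir_deriv_diff:
  "f differentiable (at z) \<Longrightarrow> g differentiable (at z) \<Longrightarrow>
    dir_deriv b (\<lambda>z. f z - g z) z = dir_deriv b f z - dir_deriv b g z"
  by (rule dir_derivI, rule has_derivative_diff; rule differentiable_imp_has_derivative)

lemma dir_deriv_mult:
  "f differentiable (at z) \<Longrightarrow> g differentiable (at z) \<Longrightarrow>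
    dir_deriv b (\<lambda>z. f z * g z) z = f z * dir_deriv b g z + dir_deriv b f z * g z"
  by (rule dir_derivI, rule has_derivative_mult; rule differentiable_imp_has_derivative)

lemma Ck_on_add:
  assumes "open U" shows "Ck_on k U f \<Longrightarrow> Ck_on k U g \<Longrightarrow> Ck_on k U (\<lambda>z. f z + g z)"
proof (induction k arbitrary: f g)
  case (Suc k)
  have "Ck_on k U (dir_deriv b (\<lambda>z. f z + g z))" if "b \<in> Basis" for b
    using Ck_on_cong[OF assms, of "dir_deriv b (\<lambda>z. f z + g z)" "\<lambda>z. dir_deriv b f z + dir_deriv b g z" k]
      Suc that by (auto simp: dir_deriv_add)
  with Suc.prems show ?case by (auto intro: differentiable_add)
qed (auto intro: continuous_intros)

lemma Ck_on_mult:
  assumes "open U" shows "Ck_on k U f \<Longrightarrow> Ck_on k U g \<Longrightarrow> Ck_on k U (\<lambda>z. f z * g z)"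
proof (induction k arbitrary: f g)
  case (Suc k)
  have "Ck_on k U (dir_deriv b (\<lambda>z. f z * g z))" if b: "b \<in> Basis" for b
  proof -
    have "Ck_on k U (\<lambda>z. f z * dir_deriv b g z + dir_deriv b f z * g z)"
      using Suc.prems b Ck_on_SucD[OF Suc.prems(1)] Ck_on_SucD[OF Suc.prems(2)]
      by (intro Ck_on_add[OF assms] Suc.IH) (simp_all only: Ck_on.simps)
    then show ?thesis
      using Ck_on_cong[OF assms, of "dir_deriv b (\<lambda>z. f z * g z)" "\<lambda>z. f z * dir_deriv b g z + dir_deriv b f z * g z" k]
        Suc.prems by (auto simp: dir_deriv_mult)
  qed
  with Suc.prems show ?case by (auto intro: differentiable_mult)
qed (auto intro: continuous_intros)

lemma Ck_on_sum:
  assumes "open U" shows "(\<And>i. i \<in> I \<Longrightarrow> Ck_on k U (f i)) \<Longrightarrow> Ck_on k U (\<lambda>z. \<Sum>i\<in>I. f i z)"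
  by (induction I rule: infinite_finite_induct) (auto intro: Ck_on_add[OF assms] Ck_on_const)

lemma dir_deriv_compose:
  fixes h :: "real \<Rightarrow> real"
  assumes "f differentiable (at z)" "h differentiable (at (f z))"
  shows "(\<lambda>z. h (f z)) differentiable (at z)"
    "dir_deriv b (\<lambda>z. h (f z)) z = dir_deriv 1 h (f z) * dir_deriv b f z"
proof -
  have "((\<lambda>z. h (f z)) has_derivative (\<lambda>b. dir_deriv 1 h (f z) * dir_deriv b f z)) (at z)"
    using has_derivative_compose[OF differentiable_imp_has_derivative[OF assms(1)],
        of h "(*) (dir_deriv 1 h (f z))"] real_derivative_dir_deriv[OF assms(2)]
    by (simp add: has_field_derivative_def)
  then show "(\<lambda>z. h (f z)) differentiable (at z)"
    "dir_deriv b (\<lambda>z. h (f z)) z = dir_deriv 1 h (f z) * dir_deriv b f z"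
    by (auto simp: differentiable_def intro: dir_derivI)
qed

lemma Ck_on_compose:
  fixes h :: "real \<Rightarrow> real"
  assumes "open U" shows "Ck_on k U f \<Longrightarrow> Ck_on k W h \<Longrightarrow> f ` U \<subseteq> W \<Longrightarrow> Ck_on k U (\<lambda>z. h (f z))"
proof (induction k arbitrary: h)
  case 0
  then show ?case using continuous_on_compose2[of W h U f] by auto
next
  case (Suc k)
  have "Ck_on k U (dir_deriv b (\<lambda>z. h (f z)))" if b: "b \<in> Basis" for b
  proof -
    have "Ck_on k U (\<lambda>z. dir_deriv 1 h (f z) * dir_deriv b f z)"
    proof (rule Ck_on_mult[OF assms])
      show "Ck_on k U (\<lambda>z. dir_deriv 1 h (f z))"
        using Suc.IH[OF Ck_on_SucD[OF Suc.prems(1)], of "dir_deriv 1 h"] Suc.prems by simp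
    qed (use Suc.prems b in simp)
    then show ?thesis
      using Ck_on_cong[OF assms, of "dir_deriv b (\<lambda>z. h (f z))" "\<lambda>z. dir_deriv 1 h (f z) * dir_deriv b f z" k]
        Suc.prems by (auto simp: dir_deriv_compose image_subset_iff)
  qed
  with Suc.prems show ?case by (simp add: dir_deriv_compose(1) image_subset_iff)
qed

lemma dir_deriv_affine:
  fixes A :: "'a::euclidean_space \<Rightarrow> 'b::euclidean_space"
  assumes "bounded_linear A" "f differentiable (at (A z + c))"
  shows "(\<lambda>z. f (A z + c)) differentiable (at z)"
    "dir_deriv b (\<lambda>z. f (A z + c)) z = dir_deriv (A b) f (A z + c)"
proof -
  have "((\<lambda>z. A z + c) has_derivative A) (at z)"
    using bounded_linear_imp_has_derivative[OF assms(1)] by (auto intro!: derivative_eq_intros)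
  from has_derivative_compose[OF this differentiable_imp_has_derivative[OF assms(2)]]
  show "(\<lambda>z. f (A z + c)) differentiable (at z)"
    "dir_deriv b (\<lambda>z. f (A z + c)) z = dir_deriv (A b) f (A z + c)"
    by (auto simp: differentiable_def intro: dir_derivI)
qed

lemma Ck_on_affine:
  fixes A :: "'a::euclidean_space \<Rightarrow> 'b::euclidean_space"
  assumes A: "bounded_linear A"
  shows "Ck_on k UNIV f \<Longrightarrow> Ck_on k UNIV (\<lambda>z. f (A z + c))"
proof (induction k arbitrary: f)
  case 0
  then show ?case
    by (auto intro!: continuous_on_compose2[of UNIV f] continuous_on_add linear_continuous_on[OF A])
next
  case (Suc k)
  have "Ck_on k UNIV (dir_deriv b (\<lambda>z. f (A z + c)))" if b: "b \<in> Basis" for b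
  proof -
    have "dir_deriv b (\<lambda>z. f (A z + c)) = (\<lambda>z. \<Sum>i\<in>Basis. (A b \<bullet> i) * dir_deriv i f (A z + c))"
      using Suc.prems by (auto simp: dir_deriv_affine[OF A] dir_deriv_linear[of f _ "A b"])
    moreover have "Ck_on k UNIV (\<lambda>z. \<Sum>i\<in>Basis. (A b \<bullet> i) * dir_deriv i f (A z + c))"
      using Suc by (intro Ck_on_sum Ck_on_mult Ck_on_const) auto
    ultimately show ?thesis by simp
  qed
  with Suc.prems show ?case by (simp add: dir_deriv_affine(1)[OF A])
qed

lemma smooth_on_const: "smooth_on U (\<lambda>z. a)"
  and smooth_on_inner: "smooth_on U (\<lambda>z. z \<bullet> c)"
  and smooth_on_add: "open U \<Longrightarrow> smooth_on U f \<Longrightarrow> smooth_on U g \<Longrightarrow> smooth_on U (\<lambda>z. f z + g z)"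
  and smooth_on_mult: "open U \<Longrightarrow> smooth_on U f \<Longrightarrow> smooth_on U g \<Longrightarrow> smooth_on U (\<lambda>z. f z * g z)"
  and smooth_on_sum: "open U \<Longrightarrow> (\<And>i. i \<in> I \<Longrightarrow> smooth_on U (F i)) \<Longrightarrow> smooth_on U (\<lambda>z. \<Sum>i\<in>I. F i z)"
  and smooth_on_Un: "open U \<Longrightarrow> open V \<Longrightarrow> smooth_on U f \<Longrightarrow> smooth_on V f \<Longrightarrow> smooth_on (U \<union> V) f"
  and smooth_on_subset: "smooth_on U f \<Longrightarrow> V \<subseteq> U \<Longrightarrow> smooth_on V f"
  unfolding smooth_on_def
  by (simp_all add: Ck_on_const Ck_on_inner Ck_on_add Ck_on_mult Ck_on_sum Ck_on_Un)
    (blast intro: Ck_on_subset)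

lemma smooth_on_cong: "open U \<Longrightarrow> (\<And>z. z \<in> U \<Longrightarrow> f z = g z) \<Longrightarrow> smooth_on U f \<longleftrightarrow> smooth_on U g"
  unfolding smooth_on_def using Ck_on_cong by blast

lemma smooth_on_compose:
  fixes h :: "real \<Rightarrow> real"
  shows "open U \<Longrightarrow> smooth_on U f \<Longrightarrow> smooth_on W h \<Longrightarrow> f ` U \<subseteq> W \<Longrightarrow> smooth_on U (\<lambda>z. h (f z))"
  unfolding smooth_on_def using Ck_on_compose by blast

lemma smooth_on_affine:
  "bounded_linear A \<Longrightarrow> smooth_on UNIV f \<Longrightarrow> smooth_on UNIV (\<lambda>z. f (A z + c))"
  unfolding smooth_on_def using Ck_on_affine by blast

lemma smooth_on_power: "open U \<Longrightarrow> smooth_on U f \<Longrightarrow> smooth_on U (\<lambda>z. f z ^ n)"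
  by (induction n) (simp_all add: smooth_on_const smooth_on_mult)

lemma smooth_on_differentiable: "smooth_on U f \<Longrightarrow> z \<in> U \<Longrightarrow> f differentiable (at z)"
  unfolding smooth_on_def using Ck_on.simps(2) by blast

lemma smooth_on_continuous: "smooth_on U f \<Longrightarrow> continuous_on U f"
  unfolding smooth_on_def using Ck_on.simps(1) by blast

lemma smooth_on_dir_deriv:
  assumes "open U" "smooth_on U f" shows "smooth_on U (dir_deriv v f)"
proof -
  have "smooth_on U (\<lambda>z. \<Sum>b\<in>Basis. (v \<bullet> b) * dir_deriv b f z)"
    using assms(2) unfolding smooth_on_def
    by (intro allI Ck_on_sum Ck_on_mult Ck_on_const assms(1)) (metis Ck_on.simps(2))
  then show ?thesis
    using smooth_on_cong[OF assms(1), of "dir_deriv v f" "\<lambda>z. \<Sum>b\<in>Basis. (v \<bullet> b) * dir_deriv b f z"]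
      dir_deriv_linear[OF smooth_on_differentiable[OF assms(2)]] by simp
qed

lemma smooth_on_fst: "smooth_on UNIV f \<Longrightarrow> smooth_on UNIV (\<lambda>z. f (fst z))"
  using smooth_on_affine[OF bounded_linear_fst, of f 0] by simp

lemma smooth_on_snd: "smooth_on UNIV f \<Longrightarrow> smooth_on UNIV (\<lambda>z. f (snd z))"
  using smooth_on_affine[OF bounded_linear_snd, of f 0] by simp

lemma dir_deriv_fst:
  fixes z w :: "'a::euclidean_space \<times> 'b::euclidean_space"
  shows "smooth_on UNIV f \<Longrightarrow> dir_deriv w (\<lambda>z. f (fst z)) z = dir_deriv (fst w) f (fst z)"
  using dir_deriv_affine(2)[OF bounded_linear_fst smooth_on_differentiable[OF _ UNIV_I], where f = f and z = z and c = 0 and b = w] by simp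

lemma dir_deriv_snd:
  fixes z w :: "'a::euclidean_space \<times> 'b::euclidean_space"
  shows "smooth_on UNIV f \<Longrightarrow> dir_deriv w (\<lambda>z. f (snd z)) z = dir_deriv (snd w) f (snd z)"
  using dir_deriv_affine(2)[OF bounded_linear_snd smooth_on_differentiable[OF _ UNIV_I], where f = f and z = z and c = 0 and b = w] by simp

lemma dir_deriv_direction_0: "f differentiable (at z) \<Longrightarrow> dir_deriv 0 f z = 0"
  by (simp add: dir_deriv_linear[of f z 0])

text \<open>A family of functions of one variable is smooth if the derivative of each member has, at every
  stage, the regularity already known for all members: the induction on the order of
  differentiability has to treat the whole family at once.\<close>
lemma smooth_on_real:
  fixes f :: "real \<Rightarrow> real"
  assumes "open U" "\<And>n z. z \<in> U \<Longrightarrow> (F n has_real_derivative G n z) (at z)"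
    "\<And>n k. (\<And>m. Ck_on k U (F m)) \<Longrightarrow> Ck_on k U (G n)"
  shows "smooth_on U (F n)"
proof -
  have "\<forall>n. Ck_on k U (F n)" for k
  proof (induction k)
    case 0
    then show ?case
      using assms(2) by (auto intro!: continuous_at_imp_continuous_on dest!: DERIV_isCont)
  next
    case (Suc k)
    have "Ck_on k U (dir_deriv 1 (F n))" for n
      using Ck_on_cong[OF assms(1), of "dir_deriv 1 (F n)" "G n" k] assms(3)[of k n] Suc
        dir_deriv_real[OF assms(2)] by auto
    then show ?case
      using assms(2) by (auto simp: differentiable_def has_field_derivative_def)
  qed
  then show ?thesis unfolding smooth_on_def by auto
qed

lemma smooth_on_exp: "smooth_on UNIV (exp :: real \<Rightarrow> real)"
  by (rule smooth_on_real[of UNIV "\<lambda>_::unit. exp" "\<lambda>_. exp"]) (auto intro!: derivative_eq_intros)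

lemma smooth_on_powr: "smooth_on {0<..} (\<lambda>r::real. r powr a)"
  by (rule smooth_on_real[of "{0<..}" "\<lambda>a r. r powr a" "\<lambda>a r. a * r powr (a - 1)"])
    (auto intro!: derivative_eq_intros Ck_on_mult Ck_on_const)

text \<open>The functions below are closed under differentiation up to linear combinations,
  which is why the parameter \<open>n\<close> is carried along; \<open>n = 0\<close> is the standard
  flat function.\<close>
definition flat :: "nat \<Rightarrow> real \<Rightarrow> real" where
  "flat n r = (if r > 0 then inverse r ^ n * exp (- inverse r) else 0)"

lemma tendsto_inverse_power_exp:
  "((\<lambda>r::real. inverse r ^ n * exp (- inverse r)) \<longlongrightarrow> 0) (at_right 0)"
proof -
  have "((\<lambda>r::real. inverse r ^ n / exp (inverse r)) \<longlongrightarrow> 0) (at_right 0)"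
    using filterlim_compose[OF tendsto_power_div_exp_0 filterlim_inverse_at_top_right] .
  then show ?thesis by (simp add: exp_minus field_simps)
qed

lemma flat_has_derivative:
  "(flat n has_real_derivative flat (n + 2) r - real n * flat (n + 1) r) (at r)"
proof -
  consider "r > 0" | "r < 0" | "r = 0" by linarith
  then show ?thesis
  proof cases
    case 1
    have "((\<lambda>r. inverse r ^ n * exp (- inverse r)) has_real_derivative
        flat (n + 2) r - real n * flat (n + 1) r) (at r)"
      using 1 by (auto intro!: derivative_eq_intros simp: flat_def power2_eq_square algebra_simps)
        (cases n; auto simp: algebra_simps)
    then show ?thesis
      by (rule has_field_derivative_transform_within_open[where S="{0<..}"]) (use 1 in \<open>auto simp: flat_def\<close>)
  next
    case 2
    have "((\<lambda>r. 0) has_real_derivative flat (n + 2) r - real n * flat (n + 1) r) (at r)"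
      using 2 by (auto simp: flat_def)
    then show ?thesis
      by (rule has_field_derivative_transform_within_open[where S="{..<0}"]) (use 2 in \<open>auto simp: flat_def\<close>)
  next
    case 3
    have right: "((\<lambda>h. (flat n (0 + h) - flat n 0) / h) \<longlongrightarrow> 0) (at_right 0)"
      by (rule Lim_transform_eventually[OF tendsto_inverse_power_exp[of "Suc n"]])
        (auto simp: flat_def eventually_at_right_less divide_inverse intro!: eventually_at_rightI[of 0 1])
    have left: "((\<lambda>h. (flat n (0 + h) - flat n 0) / h) \<longlongrightarrow> 0) (at_left 0)"
      by (rule Lim_transform_eventually[of "\<lambda>_. 0"])
        (auto simp: flat_def intro!: eventually_at_leftI[of "-1" 0])
    have "((\<lambda>h. (flat n (0 + h) - flat n 0) / h) \<longlongrightarrow> 0) (at 0)"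
      using left right by (rule filterlim_split_at)
    then show ?thesis
      using 3 by (simp add: DERIV_def flat_def)
  qed
qed

lemma smooth_on_flat: "smooth_on UNIV (flat n)"
proof (rule smooth_on_real[of UNIV flat "\<lambda>n r. flat (n + 2) r + (- real n) * flat (n + 1) r"])
  show "(flat n has_real_derivative flat (n + 2) r + (- real n) * flat (n + 1) r) (at r)" for n r
    using flat_has_derivative[of n r] by simp
  show "Ck_on k UNIV (\<lambda>r. flat (n + 2) r + (- real n) * flat (n + 1) r)"
    if "\<And>m. Ck_on k UNIV (flat m)" for n k
    by (intro Ck_on_add Ck_on_mult Ck_on_const that open_UNIV)
qed simp

text \<open>With \<open>f = flat 0\<close>, the quotient \<open>f(r) / (f(r) + f(1 - r))\<close> works: the denominator is positive
  everywhere since one of \<open>r\<close> and \<open>1 - r\<close> is positive, and \<open>f\<close> is nondecreasing.\<close>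
lemma smooth_step_exists:
  "\<exists>P :: real \<Rightarrow> real. smooth_on UNIV P \<and> (\<forall>r\<le>0. P r = 0) \<and> (\<forall>r\<ge>1. P r = 1) \<and>
    (\<forall>r. 0 \<le> P r \<and> P r \<le> 1 \<and> 0 \<le> dir_deriv 1 P r)"
proof -
  define f where "f = flat 0"
  define D where "D r = f r + f (1 + (- 1) * r)" for r
  define P where "P r = f r * D r powr (- 1)" for r
  have f0: "f r \<ge> 0" "r > 0 \<Longrightarrow> f r > 0" "r \<le> 0 \<Longrightarrow> f r = 0" for r
    by (auto simp: f_def flat_def)
  have Dpos: "D r > 0" for r
    using f0(1)[of r] f0(1)[of "1-r"] f0(2)[of r] f0(2)[of "1-r"] unfolding D_def
    by (cases "r > 0") auto
  have P_eq: "P r = f r / D r" for r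
    using Dpos[of r] by (simp add: P_def powr_minus divide_inverse)
  have sf: "smooth_on UNIV f" unfolding f_def by (rule smooth_on_flat)
  have sl: "smooth_on UNIV (\<lambda>r::real. 1 + (- 1) * r)"
    using smooth_on_inner[of UNIV "1::real"]
    by (intro smooth_on_add smooth_on_mult smooth_on_const) auto
  have sD: "smooth_on UNIV D"
    unfolding D_def by (intro smooth_on_add sf open_UNIV smooth_on_compose[where h=f, OF open_UNIV sl sf]) auto
  have sP: "smooth_on UNIV P"
    unfolding P_def
    by (intro smooth_on_mult sf open_UNIV smooth_on_compose[OF _ sD smooth_on_powr]) (use Dpos in auto)
  have f': "(f has_real_derivative flat 2 r) (at r)" for r
    using flat_has_derivative[of 0 r] by (simp add: f_def numeral_2_eq_2)
  have P': "(P has_real_derivative (flat 2 r * f (1 - r) + f r * flat 2 (1 - r)) / (D r)\<^sup>2) (at r)" for r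
  proof -
    have "((\<lambda>r. 1 - r) has_real_derivative -1) (at r)"
      by (auto intro!: derivative_eq_intros)
    then have "((\<lambda>r. f (1 - r)) has_real_derivative - flat 2 (1 - r)) (at r)"
      using DERIV_chain2[where f=f and g="\<lambda>r. 1 - r" and x=r and Db="-1" and s=UNIV, OF f'[of "1 - r"]]
      by simp
    then have "((\<lambda>r. f r / (f r + f (1 - r))) has_real_derivative
       (flat 2 r * (f r + f (1 - r)) - f r * (flat 2 r + - flat 2 (1 - r))) / ((f r + f (1 - r)) * (f r + f (1 - r)))) (at r)"
      using Dpos[of r] by (intro DERIV_divide DERIV_add f') (auto simp: D_def)
    then show ?thesis
      unfolding P_eq[abs_def] D_def by (simp add: algebra_simps power2_eq_square)
  qed
  have "0 \<le> dir_deriv 1 P r" for r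
    unfolding dir_deriv_real[OF P'] using f0 by (auto simp: flat_def)
  moreover have "P r = 1" if "1 \<le> r" for r
    using that f0(3)[of "1 - r"] f0(2)[of r] by (simp add: P_eq D_def)
  moreover have "P r \<le> 1" for r
    using Dpos[of r] f0(1)[of "1 - r"] by (simp add: P_eq D_def)
  moreover have "0 \<le> P r" "r \<le> 0 \<Longrightarrow> P r = 0" for r
    using f0 Dpos[of r] by (auto simp: P_eq)
  ultimately show ?thesis using sP by blast
qed

section \<open>Cutoff functions\<close>

lemma dir_deriv_zero_on_open:
  assumes "open U" "\<And>z. z \<in> U \<Longrightarrow> f z = 0" "z \<in> U"
  shows "dir_deriv v f z = 0"
  using dir_deriv_cong(2)[of U f "\<lambda>_. 0" z v] assms by simp

lemma continuous_compact_support_bounded: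
  fixes f :: "'a::heine_borel \<Rightarrow> real"
  assumes "continuous_on UNIV f" "compact K" "\<And>z. z \<notin> K \<Longrightarrow> f z = 0"
  obtains D where "0 \<le> D" "\<And>z. \<bar>f z\<bar> \<le> D"
proof -
  have "bounded (f ` K)"
    using assms(1,2) compact_continuous_image compact_imp_bounded continuous_on_subset subset_UNIV by metis
  then obtain D where D: "\<And>z. z \<in> K \<Longrightarrow> \<bar>f z\<bar> \<le> D" unfolding bounded_iff by auto
  show thesis
  proof (rule that[of "max D 0"])
    show "\<bar>f z\<bar> \<le> max D 0" for z
      using D[of z] assms(3)[of z] by (cases "z \<in> K") auto
  qed simp
qed

lemma smooth_compact_support_gradient_bound:
  fixes f :: "'a::euclidean_space \<Rightarrow> real"
  assumes f: "smooth_on UNIV f" and K: "compact K" "\<And>z. z \<notin> K \<Longrightarrow> f z = 0"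
  obtains S where "0 \<le> S" "\<And>v y. \<bar>dir_deriv v f y\<bar> \<le> S * norm v"
proof -
  have "\<exists>D\<ge>0. \<forall>z. \<bar>dir_deriv b f z\<bar> \<le> D" for b
  proof -
    have "dir_deriv b f z = 0" if "z \<notin> K" for z
      by (rule dir_deriv_zero_on_open[of "- K"]) (use that K in \<open>auto simp: compact_imp_closed open_Compl\<close>)
    then obtain D where "0 \<le> D" "\<And>z. \<bar>dir_deriv b f z\<bar> \<le> D"
      using continuous_compact_support_bounded[OF
          smooth_on_continuous[OF smooth_on_dir_deriv[OF open_UNIV f]] K(1)]
      by metis
    then show ?thesis by auto
  qed
  then obtain D where D: "\<And>b. 0 \<le> D b" "\<And>b z. \<bar>dir_deriv b f z\<bar> \<le> D b" by metis
  show thesis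
  proof (rule that[of "\<Sum>b\<in>Basis. D b"])
    show "\<bar>dir_deriv v f y\<bar> \<le> (\<Sum>b\<in>Basis. D b) * norm v" for v y
    proof -
      have "\<bar>dir_deriv v f y\<bar> \<le> (\<Sum>b\<in>Basis. \<bar>v \<bullet> b\<bar> * \<bar>dir_deriv b f y\<bar>)"
        unfolding dir_deriv_linear[OF smooth_on_differentiable[OF f UNIV_I], of v]
        by (rule order_trans[OF sum_abs]) (simp add: abs_mult)
      also have "\<dots> \<le> (\<Sum>b\<in>Basis. norm v * D b)"
        by (intro sum_mono mult_mono Basis_le_norm D) auto
      finally show ?thesis by (simp add: sum_distrib_left mult.commute)
    qed
  qed (simp add: D(1) sum_nonneg)
qed

lemma smooth_cutoff_exists:
  assumes "0 < r1" "r1 < r2"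
  shows "\<exists>\<zeta> :: 'a::euclidean_space \<Rightarrow> real. smooth_on UNIV \<zeta> \<and> (\<forall>y. 0 \<le> \<zeta> y \<and> \<zeta> y \<le> 1) \<and>
    (\<forall>y. norm y \<le> r1 \<longrightarrow> \<zeta> y = 1) \<and> (\<forall>y. r2 \<le> norm y \<longrightarrow> \<zeta> y = 0)"
proof -
  obtain P :: "real \<Rightarrow> real" where P0: "smooth_on UNIV P \<and> (\<forall>r\<le>0. P r = 0) \<and> (\<forall>r\<ge>1. P r = 1) \<and>
    (\<forall>r. 0 \<le> P r \<and> P r \<le> 1 \<and> 0 \<le> dir_deriv 1 P r)"
    using smooth_step_exists ..
  then have P: "smooth_on UNIV P" "\<And>r. r \<le> 0 \<Longrightarrow> P r = 0" "\<And>r. 1 \<le> r \<Longrightarrow> P r = 1"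
    "\<And>r. 0 \<le> P r" "\<And>r. P r \<le> 1" by auto
  define c where "c = r2\<^sup>2 - r1\<^sup>2"
  have c: "c > 0" using assms by (simp add: c_def power_strict_mono)
  define w where "w y = r2\<^sup>2 / c + (- (1 / c)) * (\<Sum>b\<in>Basis. (y \<bullet> b)^2)" for y :: 'a
  have w: "w y = (r2\<^sup>2 - (norm y)\<^sup>2) / c" for y
    using c by (simp add: w_def power2_norm_eq_inner euclidean_inner[of y y] power2_eq_square[of "_ \<bullet> _"] diff_divide_distrib)
  have sw: "smooth_on UNIV w"
    unfolding w_def
    by (intro smooth_on_add smooth_on_mult smooth_on_const smooth_on_sum smooth_on_power smooth_on_inner open_UNIV)
  show ?thesis
  proof (intro exI[of _ "\<lambda>y. P (w y)"] conjI allI impI)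
    show "smooth_on UNIV (\<lambda>y. P (w y))" by (rule smooth_on_compose[OF open_UNIV sw P(1)]) auto
    show "P (w y) = 1" if "norm y \<le> r1" for y
    proof -
      have "(norm y)\<^sup>2 \<le> r1\<^sup>2" using that by (simp add: power_mono)
      then show ?thesis using c by (intro P(3)) (simp add: w c_def field_simps)
    qed
    show "P (w y) = 0" if "r2 \<le> norm y" for y
    proof -
      have "r2\<^sup>2 \<le> (norm y)\<^sup>2" using that assms by (simp add: power_mono)
      then show ?thesis using c by (intro P(2)) (simp add: w field_simps)
    qed
  qed (use P in auto)
qed

lemma smooth_on_translate:
  "smooth_on UNIV f \<Longrightarrow> smooth_on UNIV (\<lambda>y. f (y - a))"
  using smooth_on_affine[of "\<lambda>z. z" f "- a"] by (simp add: bounded_linear_ident)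

lemma dir_deriv_translate:
  "smooth_on UNIV f \<Longrightarrow> dir_deriv v (\<lambda>y. f (y - a)) z = dir_deriv v f (z - a)"
  using dir_deriv_affine(2)[of "\<lambda>z. z" f z "- a" v] smooth_on_differentiable[of UNIV f "z - a"]
  by (simp add: bounded_linear_ident)

lemma dir_deriv_power:
  assumes "f differentiable (at z)"
  shows "dir_deriv v (\<lambda>z. f z ^ m) z = real m * f z ^ (m - 1) * dir_deriv v f z"
  by (rule dir_derivI[THEN trans, OF has_derivative_power[OF differentiable_imp_has_derivative[OF assms]]])
    (simp add: mult.commute mult.left_commute)

text \<open>A power \<open>\<zeta>\<^sup>m\<close> of a cutoff satisfies \<open>\<bar>\<nabla>\<zeta>\<^sup>m\<bar> \<le> C \<zeta>\<^bsup>m-1\<^esup>\<close>, and this is at most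
  \<open>C (\<zeta>\<^sup>m)\<^bsup>1/q\<^esup>\<close> as soon as \<open>m - 1 \<ge> m/q\<close>. The exponent \<open>1/q\<close> is the one for which the flux
  \<open>\<nabla>u \<bullet> \<nabla>\<phi>\<close> can be absorbed by \<open>\<bar>\<nabla>u\<bar>\<^sup>q \<phi>\<close>.\<close>
lemma cutoff_gradient_absorption:
  fixes q :: real
  assumes "1 < q" "0 < r1" "r1 < r2"
  shows "\<exists>(\<phi> :: 'a::euclidean_space \<Rightarrow> real) L. smooth_on UNIV \<phi> \<and> (\<forall>y. 0 \<le> \<phi> y \<and> \<phi> y \<le> 1) \<and>
    (\<forall>y. norm y \<le> r1 \<longrightarrow> \<phi> y = 1) \<and> (\<forall>y. r2 \<le> norm y \<longrightarrow> \<phi> y = 0) \<and>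
    0 \<le> L \<and> (\<forall>y v. \<bar>dir_deriv v \<phi> y\<bar> \<le> L * norm v * \<phi> y powr (1 / q))"
proof -
  obtain \<zeta> :: "'a \<Rightarrow> real" where "smooth_on UNIV \<zeta> \<and> (\<forall>y. 0 \<le> \<zeta> y \<and> \<zeta> y \<le> 1) \<and>
    (\<forall>y. norm y \<le> r1 \<longrightarrow> \<zeta> y = 1) \<and> (\<forall>y. r2 \<le> norm y \<longrightarrow> \<zeta> y = 0)"
    using smooth_cutoff_exists[OF assms(2,3)] ..
  then have \<zeta>: "smooth_on UNIV \<zeta>" "\<And>y. 0 \<le> \<zeta> y" "\<And>y. \<zeta> y \<le> 1"
    "\<And>y. norm y \<le> r1 \<Longrightarrow> \<zeta> y = 1" "\<And>y. r2 \<le> norm y \<Longrightarrow> \<zeta> y = 0" by auto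
  define m where "m = nat \<lceil>q / (q - 1)\<rceil>"
  have m: "q / (q - 1) \<le> real m" unfolding m_def by linarith
  moreover have "1 < q / (q - 1)" using assms(1) by simp
  ultimately have m2: "2 \<le> m" by linarith
  have mq: "real m / q \<le> real m - 1"
    using m assms(1) by (simp add: field_simps)
  have supp: "\<zeta> z = 0" if "z \<notin> cball 0 r2" for z using that by (intro \<zeta>(5)) simp
  obtain S where S0: "0 \<le> S" and S: "\<And>v y. \<bar>dir_deriv v \<zeta> y\<bar> \<le> S * norm v"
    using smooth_compact_support_gradient_bound[OF \<zeta>(1) compact_cball supp] by blast
  have pow: "\<zeta> y ^ (m - 1) \<le> (\<zeta> y ^ m) powr (1 / q)" for y
  proof (cases "\<zeta> y = 0")
    case True
    then show ?thesis using m2 by (simp add: zero_power)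
  next
    case False
    then have p: "\<zeta> y > 0" using \<zeta>(2)[of y] by simp
    have "\<zeta> y ^ (m - 1) = \<zeta> y powr (real m - 1)"
      using m2 by (simp add: powr_realpow[OF p, symmetric] of_nat_diff)
    also have "\<dots> \<le> \<zeta> y powr (real m / q)"
      using mq p \<zeta>(3)[of y] by (intro powr_mono') auto
    also have "\<dots> = (\<zeta> y ^ m) powr (1 / q)"
      by (simp add: powr_realpow[OF p, symmetric] powr_powr)
    finally show ?thesis .
  qed
  show ?thesis
  proof (intro exI[of _ "\<lambda>y. \<zeta> y ^ m"] exI[of _ "real m * S"] conjI allI impI)
    show "\<bar>dir_deriv v (\<lambda>y. \<zeta> y ^ m) y\<bar> \<le> real m * S * norm v * (\<zeta> y ^ m) powr (1 / q)" for v y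
    proof -
      have "\<bar>dir_deriv v (\<lambda>y. \<zeta> y ^ m) y\<bar> = real m * (\<bar>dir_deriv v \<zeta> y\<bar> * \<zeta> y ^ (m - 1))"
        using \<zeta>(2)[of y] by (simp add: dir_deriv_power[OF smooth_on_differentiable[OF \<zeta>(1) UNIV_I]] abs_mult)
      also have "\<dots> \<le> real m * ((S * norm v) * (\<zeta> y ^ m) powr (1 / q))"
        using \<zeta>(2)[of y] S[of v y] by (intro mult_left_mono mult_mono pow) auto
      finally show ?thesis by (simp add: mult.assoc)
    qed
    show "0 \<le> real m * S" using S0 by simp
  qed (use \<zeta> m2 in \<open>auto intro: smooth_on_power power_le_one\<close>)
qed

lemma test_functionsI:
  assumes "smooth_on UNIV \<phi>" "compact C" "C \<subseteq> U" "\<And>z. z \<notin> C \<Longrightarrow> \<phi> z = 0"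
  shows "\<phi> \<in> test_functions U"
proof -
  have "closure {z. \<phi> z \<noteq> 0} \<subseteq> C"
    using assms(2,4) by (intro closure_minimal compact_imp_closed) auto
  then show ?thesis
    using assms(1-3) compact_Int_closed[OF assms(2) closed_closure, of "{z. \<phi> z \<noteq> 0}"]
    by (auto simp: test_functions_iff compactly_contained_def Int_absorb1)
qed

lemma test_functions_mono: "\<phi> \<in> test_functions A \<Longrightarrow> A \<subseteq> B \<Longrightarrow> \<phi> \<in> test_functions B"
  by (auto simp: test_functions_iff compactly_contained_def)

lemma CcI:
  assumes "continuous_on UNIV \<psi>" "compact C" "C \<subseteq> U" "\<And>z. z \<notin> C \<Longrightarrow> \<psi> z = 0"
  shows "\<psi> \<in> Cc U"
proof -
  have "closure {z. \<psi> z \<noteq> 0} \<subseteq> C"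
    using assms(2,4) by (intro closure_minimal compact_imp_closed) auto
  then show ?thesis
    using assms(1-3) compact_Int_closed[OF assms(2) closed_closure, of "{z. \<psi> z \<noteq> 0}"]
    by (auto simp: Cc_def compactly_contained_def Int_absorb1)
qed

section \<open>Integration\<close>

text \<open>Lebesgue measure on a product is the completion of the product measure, so Fubini-type statements
  are obtained from a Borel null set or a Borel representative. Here and below time, the second
  component, is the outer variable.\<close>
lemma AE_lebesgue_prod_swap:
  fixes P :: "'a::euclidean_space \<times> real \<Rightarrow> bool"
  assumes "AE z in lebesgue. P z"
  shows "AE t in lebesgue. AE x in lebesgue. P (x, t)"
proof -
  have "AE z in lborel. P z" using assms by (simp add: AE_completion_iff)
  then obtain N where N: "{z. \<not> P z} \<subseteq> N" "N \<in> sets lborel" "emeasure lborel N = 0"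
    by (auto elim!: AE_E)
  have N': "{z \<in> space (lborel \<Otimes>\<^sub>M lborel). (fst z, snd z) \<notin> N} \<in> sets (lborel \<Otimes>\<^sub>M (lborel :: real measure))"
    using N(2) unfolding lborel_prod by (simp add: Collect_neg_eq[symmetric, of "\<lambda>z. z \<in> N", simplified])
  have "AE z in lborel \<Otimes>\<^sub>M lborel. z \<notin> N"
    unfolding lborel_prod using N by (auto intro!: AE_I'[of N] null_setsI)
  then have "AE x in lborel. AE t in lborel. (x, t) \<notin> N" by (rule lborel_pair.AE_pair)
  then have "AE t in lborel. AE x in lborel. (x, t) \<notin> N"
    using lborel_pair.AE_commute[of "\<lambda>x t. (x, t) \<notin> N"] N' by simp
  then show ?thesis
    unfolding AE_completion_iff using N(1) by (auto elim!: eventually_mono)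
qed

text \<open>Completeness of Lebesgue measure makes the modified function measurable.\<close>
lemma integrable_lebesgue_cong_AE:
  fixes h h' :: "'a::euclidean_space \<Rightarrow> real"
  assumes h: "integrable lebesgue h" and ae: "AE x in lebesgue. h' x = h x"
  shows "integrable lebesgue h'" "(LINT x|lebesgue. h' x) = (LINT x|lebesgue. h x)"
proof -
  have neg: "negligible {x. h' x \<noteq> h x}"
    using ae by (simp add: negligible_iff_null_sets completion.AE_iff_null_sets)
  have "h absolutely_integrable_on UNIV" using h by (simp add: set_integrable_def)
  from absolutely_integrable_spike[OF this neg, of h'] have "h' absolutely_integrable_on UNIV" by simp
  then show i: "integrable lebesgue h'" by (simp add: set_integrable_def)
  show "(LINT x|lebesgue. h' x) = (LINT x|lebesgue. h x)"
    using i h ae by (intro integral_cong_AE) auto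
qed

lemma integrable_lebesgue_prod_swap:
  fixes f :: "'a::euclidean_space \<times> real \<Rightarrow> real"
  assumes "integrable lebesgue f"
  shows "AE t in lebesgue. integrable lebesgue (\<lambda>x. f (x, t))"
    and "integrable lebesgue (\<lambda>t. LINT x|lebesgue. f (x, t))"
proof -
  obtain g where g: "g \<in> borel_measurable lborel" "AE z in lborel. f z = g z"
    using completion_ex_borel_measurable_real[of f lborel] assms by auto
  then have fg: "AE z in lebesgue. f z = g z" by (simp add: AE_completion_iff)
  have "integrable lebesgue g"
    by (rule integrable_cong_AE_imp[OF assms]) (use g fg in \<open>auto simp: measurable_completion\<close>)
  then have "integrable lborel g" using integrable_completion[of g lborel] g(1) by simp
  then have "integrable (lborel \<Otimes>\<^sub>M lborel) g" by (simp only: lborel_prod)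
  then have gs: "integrable (lborel \<Otimes>\<^sub>M lborel) (\<lambda>(t, x). g (x, t))"
    by (rule lborel_pair.integrable_product_swap)
  have m: "(\<lambda>x. g (x, t)) \<in> borel_measurable lborel" for t
    using g(1) by simp
  have ae: "AE t in lebesgue. AE x in lebesgue. f (x, t) = g (x, t)"
    using AE_lebesgue_prod_swap[OF fg] by simp
  have "AE t in lborel. integrable lborel (\<lambda>x. g (x, t))"
    using lborel_pair.AE_integrable_fst'[OF gs] by simp
  then have gi: "AE t in lebesgue. integrable lebesgue (\<lambda>x. g (x, t))"
    unfolding AE_completion_iff using integrable_completion[OF m] by simp
  show "AE t in lebesgue. integrable lebesgue (\<lambda>x. f (x, t))"
    using gi ae by eventually_elim (rule integrable_lebesgue_cong_AE(1))
  have "integrable lborel (\<lambda>t. LINT x|lborel. g (x, t))"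
    using lborel_pair.integrable_fst'[OF gs] by simp
  then have "integrable lebesgue (\<lambda>t. LINT x|lborel. g (x, t))"
    using integrable_completion[OF borel_measurable_integrable] by blast
  then have gI: "integrable lebesgue (\<lambda>t. LINT x|lebesgue. g (x, t))"
    by (simp add: integral_completion[OF m])
  have "AE t in lebesgue. (LINT x|lebesgue. f (x, t)) = (LINT x|lebesgue. g (x, t))"
    using gi ae
  proof eventually_elim
    case (elim t)
    then show ?case by (rule integrable_lebesgue_cong_AE(2))
  qed
  then show "integrable lebesgue (\<lambda>t. LINT x|lebesgue. f (x, t))"
    by (rule integrable_lebesgue_cong_AE(1)[OF gI])
qed

lemma Lp_loc_1_imp_set_integrable:
  assumes "Lp_loc 1 \<Omega> f" "compact K" "K \<subseteq> \<Omega>"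
  shows "set_integrable lebesgue K f" "set_integrable lebesgue K (\<lambda>x. norm (f x))"
proof -
  have m: "set_borel_measurable lebesgue K f"
    using assms set_borel_measurable_subset[of lebesgue \<Omega> f K] by (simp add: Lp_loc_def compact_imp_closed borel_closed)
  have i: "set_integrable lebesgue K (\<lambda>x. norm (f x))"
    using assms by (simp add: Lp_loc_def)
  show "set_integrable lebesgue K (\<lambda>x. norm (f x))" by (rule i)
  show "set_integrable lebesgue K f"
    using i m unfolding set_integrable_def set_borel_measurable_def
    by (rule Bochner_Integration.integrable_bound) (auto simp: indicator_def)
qed

lemma set_integrable_mult_continuous:
  fixes f h :: "'a::euclidean_space \<Rightarrow> real"
  assumes "set_integrable lebesgue K f" "compact K" "continuous_on K h"
  shows "set_integrable lebesgue K (\<lambda>x. f x * h x)"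
proof -
  obtain B where B: "\<And>x. x \<in> K \<Longrightarrow> \<bar>h x\<bar> \<le> B"
    using compact_imp_bounded[OF compact_continuous_image[OF assms(3,2)]] unfolding bounded_iff by auto
  have "(\<lambda>x. indicator K x *\<^sub>R h x) \<in> borel_measurable lebesgue"
    using borel_measurable_continuous_on_indicator[OF _ assms(3)] assms(2)
    by (simp add: compact_imp_closed borel_closed measurable_completion)
  moreover have "(\<lambda>x. indicator K x *\<^sub>R f x) \<in> borel_measurable lebesgue"
    using assms(1) unfolding set_integrable_def by auto
  ultimately have "(\<lambda>x. (indicator K x *\<^sub>R f x) * (indicator K x *\<^sub>R h x)) \<in> borel_measurable lebesgue"
    by (rule borel_measurable_times[rotated])
  then have m: "(\<lambda>x. indicator K x *\<^sub>R (f x * h x)) \<in> borel_measurable lebesgue"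
    by (rule measurable_cong[THEN iffD1, rotated]) (auto simp: indicator_def)
  have "integrable lebesgue (\<lambda>x. B * (indicator K x *\<^sub>R f x))"
    using assms(1) unfolding set_integrable_def by simp
  then show ?thesis
    unfolding set_integrable_def
  proof (rule Bochner_Integration.integrable_bound[OF _ m], intro AE_I2)
    fix x show "norm (indicator K x *\<^sub>R (f x * h x)) \<le> norm (B * (indicator K x *\<^sub>R f x))"
      using B[of x] by (auto simp: indicator_def abs_mult mult.commute[of "\<bar>f x\<bar>"] intro!: mult_right_mono)
  qed
qed

lemma set_integral_support:
  fixes f :: "'a \<Rightarrow> real"
  assumes "K \<subseteq> A" "\<And>x. x \<in> A \<Longrightarrow> x \<notin> K \<Longrightarrow> f x = 0"
  shows "(LINT x:A|M. f x) = (LINT x:K|M. f x)" "set_integrable M A f \<longleftrightarrow> set_integrable M K f"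
proof -
  have "(\<lambda>x. indicator A x *\<^sub>R f x) = (\<lambda>x. indicator K x *\<^sub>R f x)"
    using assms by (auto simp: indicator_def fun_eq_iff)
  then show "(LINT x:A|M. f x) = (LINT x:K|M. f x)" "set_integrable M A f \<longleftrightarrow> set_integrable M K f"
    by (simp_all add: set_lebesgue_integral_def set_integrable_def)
qed

lemma set_integral_finite_sum:
  fixes f :: "'i \<Rightarrow> 'a \<Rightarrow> real"
  assumes "\<And>i. i \<in> I \<Longrightarrow> set_integrable M A (f i)"
  shows "(LINT x:A|M. \<Sum>i\<in>I. f i x) = (\<Sum>i\<in>I. LINT x:A|M. f i x)" "set_integrable M A (\<lambda>x. \<Sum>i\<in>I. f i x)"
  using assms unfolding set_lebesgue_integral_def set_integrable_def scaleR_sum_right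
  by (auto intro!: Bochner_Integration.integral_sum)

lemma set_integrable_continuous_compact:
  fixes h :: "'a::euclidean_space \<Rightarrow> real"
  assumes "compact K" "continuous_on K h"
  shows "set_integrable lebesgue K h"
proof -
  have "integrable lebesgue (indicat_real K)"
    by (rule integrable_real_indicator) (use lmeasurable_compact[OF assms(1)] in \<open>auto simp: fmeasurable_def\<close>)
  then have "set_integrable lebesgue K (\<lambda>_. 1 :: real)" by (simp add: set_integrable_def)
  from set_integrable_mult_continuous[OF this assms] show ?thesis by simp
qed

text \<open>The increment of the pairing splits into the increment of \<open>u\<close>, which is small in \<open>L\<^sup>1(K)\<close> and
  tested with bounded functions, and the increment of \<open>\<psi>\<close> against the fixed slice \<open>u s\<close>, which tends
  to zero by dominated convergence.\<close>
lemma pairing_continuous: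
  fixes \<psi> :: "'a::euclidean_space \<times> real \<Rightarrow> real"
  assumes u: "C_Lp_loc J 1 \<Omega> u" and K: "compact K" "K \<subseteq> \<Omega>" and "S \<subseteq> J"
    and \<psi>: "continuous_on (K \<times> S) \<psi>"
  shows "continuous_on S (\<lambda>s. LINT x:K|lebesgue. u s x * \<psi> (x, s))"
proof (rule continuous_on_sequentiallyI)
  fix \<sigma> :: "nat \<Rightarrow> real" and s assume s: "\<forall>n. \<sigma> n \<in> S" "s \<in> S" "\<sigma> \<longlonglongrightarrow> s"
  define S' where "S' = insert s (range \<sigma>)"
  have S': "compact S'" "S' \<subseteq> S" using s compact_sequence_with_limit[of \<sigma> s] by (auto simp: S'_def)
  have c': "continuous_on (K \<times> S') \<psi>" using S' by (auto intro: continuous_on_subset[OF \<psi>])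
  have slice: "continuous_on K (\<lambda>x. \<psi> (x, r))" if "r \<in> S'" for r
    using that by (auto intro!: continuous_on_compose2[OF c'] continuous_intros)
  obtain B where B: "\<And>x r. x \<in> K \<Longrightarrow> r \<in> S' \<Longrightarrow> \<bar>\<psi> (x, r)\<bar> \<le> B"
    using compact_imp_bounded[OF compact_continuous_image[OF c' compact_Times[OF K(1) S'(1)]]]
    unfolding bounded_iff by auto
  have inJ: "r \<in> J" if "r \<in> S'" for r using that S'(2) assms(4) by auto
  have ui: "set_integrable lebesgue K (u r)" if "r \<in> S'" for r
    using Lp_loc_1_imp_set_integrable(1)[OF _ K] u inJ[OF that] unfolding C_Lp_loc_def by blast
  have int: "set_integrable lebesgue K (\<lambda>x. u r x * \<psi> (x, r'))" if "r \<in> S'" "r' \<in> S'" for r r'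
    by (rule set_integrable_mult_continuous[OF ui[OF that(1)] K(1) slice[OF that(2)]])
  have s': "s \<in> S'" "\<And>n. \<sigma> n \<in> S'" by (auto simp: S'_def)
  have Lp: "((\<lambda>t. Lp_norm 1 K (\<lambda>x. u t x - u s x)) \<longlongrightarrow> 0) (at s within J)"
    using u K inJ[OF s'(1)] unfolding C_Lp_loc_def by blast
  have Lpn: "(\<lambda>n. Lp_norm 1 K (\<lambda>x. u (\<sigma> n) x - u s x)) \<longlonglongrightarrow> 0"
  proof (rule tendstoI)
    fix e :: real assume e: "e > 0"
    have "\<forall>\<^sub>F t in nhds s. t \<in> J \<longrightarrow> dist (Lp_norm 1 K (\<lambda>x. u t x - u s x)) 0 < e"
    proof -
      have "dist (Lp_norm 1 K (\<lambda>x. u s x - u s x)) 0 < e" using e by (simp add: Lp_norm_def)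
      then show ?thesis
        using tendstoD[OF Lp e] unfolding eventually_at_filter
        by (auto elim!: eventually_mono)
    qed
    from filterlim_iff[THEN iffD1, OF s(3), rule_format, OF this]
    show "\<forall>\<^sub>F n in sequentially. dist (Lp_norm 1 K (\<lambda>x. u (\<sigma> n) x - u s x)) 0 < e"
      using inJ[OF s'(2)] by simp
  qed
  have d: "set_integrable lebesgue K (\<lambda>x. \<bar>u r x - u s x\<bar>)" if "r \<in> S'" for r
    using ui[OF that] ui[OF s'(1)] by (intro set_integrable_abs set_integral_diff)
  have first: "(\<lambda>n. LINT x:K|lebesgue. (u (\<sigma> n) x - u s x) * \<psi> (x, \<sigma> n)) \<longlonglongrightarrow> 0"
  proof (rule Lim_null_comparison)
    show "(\<lambda>n. B * Lp_norm 1 K (\<lambda>x. u (\<sigma> n) x - u s x)) \<longlonglongrightarrow> 0"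
      using tendsto_mult_right_zero[OF Lpn, of B] by simp
    show "\<forall>\<^sub>F n in sequentially. norm (LINT x:K|lebesgue. (u (\<sigma> n) x - u s x) * \<psi> (x, \<sigma> n))
        \<le> B * Lp_norm 1 K (\<lambda>x. u (\<sigma> n) x - u s x)"
    proof (rule always_eventually, rule allI)
      fix n
      have i1: "set_integrable lebesgue K (\<lambda>x. (u (\<sigma> n) x - u s x) * \<psi> (x, \<sigma> n))"
        by (rule set_integrable_mult_continuous[OF set_integral_diff(1)[OF ui ui] K(1) slice]) (rule s')+
      have "\<bar>LINT x:K|lebesgue. (u (\<sigma> n) x - u s x) * \<psi> (x, \<sigma> n)\<bar>
          \<le> (LINT x:K|lebesgue. \<bar>(u (\<sigma> n) x - u s x) * \<psi> (x, \<sigma> n)\<bar>)"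
        using set_integral_norm_bound[OF i1] by simp
      also have "\<dots> \<le> (LINT x:K|lebesgue. B * \<bar>u (\<sigma> n) x - u s x\<bar>)"
      proof (rule set_integral_mono)
        show "\<bar>(u (\<sigma> n) x - u s x) * \<psi> (x, \<sigma> n)\<bar> \<le> B * \<bar>u (\<sigma> n) x - u s x\<bar>" if "x \<in> K" for x
          using B[OF that s'(2)] by (simp add: abs_mult mult.commute mult_right_mono)
      qed (use i1 d[OF s'(2)] in \<open>auto intro: set_integrable_abs\<close>)
      also have "\<dots> = B * (LINT x:K|lebesgue. \<bar>u (\<sigma> n) x - u s x\<bar>)" by simp
      also have "\<dots> = B * Lp_norm 1 K (\<lambda>x. u (\<sigma> n) x - u s x)"
      proof -
        have "(LINT x:K|lebesgue. \<bar>u (\<sigma> n) x - u s x\<bar>) \<ge> 0"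
          unfolding set_lebesgue_integral_def by (rule Bochner_Integration.integral_nonneg) (simp add: indicator_def)
        then show ?thesis by (simp add: Lp_norm_def)
      qed
      finally show "norm (LINT x:K|lebesgue. (u (\<sigma> n) x - u s x) * \<psi> (x, \<sigma> n))
        \<le> B * Lp_norm 1 K (\<lambda>x. u (\<sigma> n) x - u s x)" by simp
    qed
  qed
  have second: "(\<lambda>n. LINT x:K|lebesgue. u s x * \<psi> (x, \<sigma> n)) \<longlonglongrightarrow> (LINT x:K|lebesgue. u s x * \<psi> (x, s))"
    unfolding set_lebesgue_integral_def
  proof (rule integral_dominated_convergence[where w = "\<lambda>x. B * (indicator K x *\<^sub>R \<bar>u s x\<bar>)"])
    show "integrable lebesgue (\<lambda>x. B * (indicator K x *\<^sub>R \<bar>u s x\<bar>))"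
      using set_integrable_abs[OF ui[OF s'(1)]] unfolding set_integrable_def by simp
    show "AE x in lebesgue. norm (indicat_real K x *\<^sub>R (u s x * \<psi> (x, \<sigma> n))) \<le> B * (indicat_real K x *\<^sub>R \<bar>u s x\<bar>)" for n
      using B[OF _ s'(2)]
      by (intro AE_I2) (auto simp: indicator_def abs_mult mult.commute[of "\<bar>u s _\<bar>"] intro!: mult_right_mono)
    show "AE x in lebesgue. (\<lambda>n. indicat_real K x *\<^sub>R (u s x * \<psi> (x, \<sigma> n))) \<longlonglongrightarrow> indicat_real K x *\<^sub>R (u s x * \<psi> (x, s))"
    proof (rule AE_I2)
      fix x
      show "(\<lambda>n. indicat_real K x *\<^sub>R (u s x * \<psi> (x, \<sigma> n))) \<longlonglongrightarrow> indicat_real K x *\<^sub>R (u s x * \<psi> (x, s))"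
      proof (cases "x \<in> K")
        case True
        have "(\<lambda>n. \<psi> (x, \<sigma> n)) \<longlonglongrightarrow> \<psi> (x, s)"
          by (rule continuous_on_tendsto_compose[OF \<psi>]) (use True s in \<open>auto intro!: tendsto_intros\<close>)
        then show ?thesis by (intro tendsto_intros)
      qed simp
    qed
  qed (use int[OF s'(1)] s' in \<open>auto simp: set_integrable_def\<close>)
  have "(LINT x:K|lebesgue. u (\<sigma> n) x * \<psi> (x, \<sigma> n)) =
      (LINT x:K|lebesgue. (u (\<sigma> n) x - u s x) * \<psi> (x, \<sigma> n)) + (LINT x:K|lebesgue. u s x * \<psi> (x, \<sigma> n))" for n
    using set_integral_diff(2)[OF int int, of "\<sigma> n" "\<sigma> n" s "\<sigma> n"] s' by (simp add: left_diff_distrib)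
  with tendsto_add[OF first second]
  show "(\<lambda>n. LINT x:K|lebesgue. u (\<sigma> n) x * \<psi> (x, \<sigma> n)) \<longlonglongrightarrow> (LINT x:K|lebesgue. u s x * \<psi> (x, s))"
    by simp
qed

section \<open>One-sided weak derivatives in time\<close>

text \<open>The hypothesis says that \<open>g' \<le> K\<close> in the sense of distributions. Test with a smooth approximation
  of the indicator of \<open>[s1, s2]\<close>: its derivative is the difference of two bumps of mass one located just
  after \<open>s1\<close> and just after \<open>s2\<close>, against which the continuous function \<open>g\<close> integrates to
  almost \<open>g s1\<close> and \<open>g s2\<close>.\<close>
lemma weak_derivative_le_imp_increment_le:
  fixes g :: "real \<Rightarrow> real"
  assumes g: "continuous_on {\<alpha><..<\<beta>} g" and K: "0 \<le> K" and J: "{\<alpha><..<\<beta>} \<subseteq> J"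
    and H: "\<And>\<theta>. \<theta> \<in> test_functions {\<alpha><..<\<beta>} \<Longrightarrow> (\<And>s. 0 \<le> \<theta> s) \<Longrightarrow>
      0 \<le> (LINT s:J|lebesgue. dir_deriv 1 \<theta> s * g s + K * \<theta> s)"
    and s: "\<alpha> < s1" "s1 < s2" "s2 < \<beta>"
  shows "g s2 \<le> g s1 + K * (s2 - s1)"
proof -
  obtain P :: "real \<Rightarrow> real" where P0: "smooth_on UNIV P \<and> (\<forall>r\<le>0. P r = 0) \<and> (\<forall>r\<ge>1. P r = 1) \<and>
    (\<forall>r. 0 \<le> P r \<and> P r \<le> 1 \<and> 0 \<le> dir_deriv 1 P r)"
    using smooth_step_exists ..
  then have P: "smooth_on UNIV P" "\<And>r. r \<le> 0 \<Longrightarrow> P r = 0" "\<And>r. 1 \<le> r \<Longrightarrow> P r = 1"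
    "\<And>r. 0 \<le> P r" "\<And>r. P r \<le> 1" "\<And>r. 0 \<le> dir_deriv 1 P r" by auto
  have main: "g s2 - g s1 - K * (s2 - s1) \<le> (2 + K) * e" if e: "e > 0" for e
  proof -
    have cg: "\<exists>d>0. \<forall>r. \<bar>r - c\<bar> < d \<longrightarrow> \<bar>g r - g c\<bar> < e" if "c \<in> {\<alpha><..<\<beta>}" for c
      using g that e unfolding continuous_on_eq_continuous_at[OF open_greaterThanLessThan]
      by (force simp: continuous_at_eps_delta dist_real_def)
    have "s1 \<in> {\<alpha><..<\<beta>}" "s2 \<in> {\<alpha><..<\<beta>}" using s by auto
    from cg[OF this(1)] cg[OF this(2)]
    obtain d1 d2 where d: "d1 > 0" "d2 > 0" "\<And>r. \<bar>r - s1\<bar> < d1 \<Longrightarrow> \<bar>g r - g s1\<bar> < e"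
      "\<And>r. \<bar>r - s2\<bar> < d2 \<Longrightarrow> \<bar>g r - g s2\<bar> < e" by auto
    define \<epsilon> where "\<epsilon> = Min {d1 / 2, d2 / 2, e, s2 - s1, (\<beta> - s2) / 2}"
    have \<epsilon>: "\<epsilon> > 0" "\<epsilon> < d1" "\<epsilon> < d2" "\<epsilon> \<le> e" "s1 + \<epsilon> \<le> s2" "s2 + \<epsilon> < \<beta>"
    proof -
      have le: "\<epsilon> \<le> x" if "x \<in> {d1 / 2, d2 / 2, e, s2 - s1, (\<beta> - s2) / 2}" for x
        unfolding \<epsilon>_def by (rule Min_le[OF _ that]) simp
      show "\<epsilon> > 0" unfolding \<epsilon>_def using d e s by (subst Min_gr_iff) auto
      show "\<epsilon> < d1" "\<epsilon> < d2" "\<epsilon> \<le> e" "s1 + \<epsilon> \<le> s2" "s2 + \<epsilon> < \<beta>"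
        using le[of "d1 / 2"] le[of "d2 / 2"] le[of e] le[of "s2 - s1"] le[of "(\<beta> - s2) / 2"] d s by auto
    qed
    define S where "S c = (\<lambda>r. P (r / \<epsilon> + (- c / \<epsilon>)))" for c
    have arg: "r / \<epsilon> + (- c / \<epsilon>) = (r - c) / \<epsilon>" for r c by (simp add: diff_divide_distrib)
    have S0: "S c r = 0" if "r \<le> c" for c r
      unfolding S_def arg using that \<epsilon> by (intro P(2)) (simp add: divide_nonpos_pos)
    have S1: "S c r = 1" if "c + \<epsilon> \<le> r" for c r
      unfolding S_def arg using that \<epsilon> by (intro P(3)) (simp add: le_divide_eq)
    have bl: "bounded_linear (\<lambda>r::real. r / \<epsilon>)" by (rule bounded_linear_divide)
    have Ss: "smooth_on UNIV (S c)" for c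
      unfolding S_def by (rule smooth_on_affine[OF bl P(1)])
    have Sd: "dir_deriv 1 (S c) r = dir_deriv 1 P ((r - c) / \<epsilon>) / \<epsilon>" for c r
    proof -
      have "dir_deriv 1 (S c) r = dir_deriv (1 / \<epsilon>) P ((r - c) / \<epsilon>)"
        using dir_deriv_affine(2)[OF bl smooth_on_differentiable[OF P(1) UNIV_I], where b = 1 and c = "- c / \<epsilon>" and z = r]
        unfolding S_def arg .
      also have "\<dots> = dir_deriv 1 P ((r - c) / \<epsilon>) / \<epsilon>"
        using dir_deriv_linear[OF smooth_on_differentiable[OF P(1) UNIV_I], of "1 / \<epsilon>" "(r - c) / \<epsilon>"]
        by simp
      finally show ?thesis .
    qed
    have S'0: "0 \<le> dir_deriv 1 (S c) r" for c r
      unfolding Sd using P(6) \<epsilon>(1) by simp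
    have S'z: "dir_deriv 1 (S c) r = 0" if "r < c \<or> c + \<epsilon> < r" for c r
      using that
    proof
      assume "r < c"
      then show ?thesis by (intro dir_deriv_zero_on_open[of "{..<c}"]) (auto simp: S0)
    next
      assume r: "c + \<epsilon> < r"
      then have "dir_deriv 1 (S c) r = dir_deriv 1 (\<lambda>_. 1) r"
        by (intro dir_deriv_cong(2)[of "{c + \<epsilon><..}"]) (auto simp: S1)
      then show ?thesis by simp
    qed
    have mono: "S s2 r \<le> S s1 r" for r
      using S0[of r s2] S1[of s1 r] P(4,5) \<epsilon>(5) unfolding S_def by (cases "r \<le> s2") auto
    \<comment> \<open>The test function rises from 0 to 1 on \<open>[s1, s1 + \<epsilon>]\<close> and falls back on \<open>[s2, s2 + \<epsilon>]\<close>.\<close>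
    define \<theta> where "\<theta> r = S s1 r + (- 1) * S s2 r" for r
    define I where "I = {s1..s2 + \<epsilon>}"
    have IJ: "I \<subseteq> {\<alpha><..<\<beta>}" using s \<epsilon> by (auto simp: I_def)
    have \<theta>s: "smooth_on UNIV \<theta>"
      unfolding \<theta>_def by (intro smooth_on_add smooth_on_mult smooth_on_const Ss open_UNIV)
    have \<theta>z: "\<theta> r = 0" if "r \<notin> I" for r
      using that s \<epsilon> S0[of r s1] S0[of r s2] S1[of s1 r] S1[of s2 r] by (auto simp: \<theta>_def I_def)
    have \<theta>t: "\<theta> \<in> test_functions {\<alpha><..<\<beta>}"
      by (rule test_functionsI[OF \<theta>s _ IJ \<theta>z]) (auto simp: I_def)
    have \<theta>0: "0 \<le> \<theta> r" for r using mono[of r] by (simp add: \<theta>_def)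
    have \<theta>1: "\<theta> r \<le> 1" for r using P(4,5) by (simp add: \<theta>_def S_def add_increasing2 diff_le_eq)
    have \<theta>d: "dir_deriv 1 \<theta> r = dir_deriv 1 (S s1) r - dir_deriv 1 (S s2) r" for r
      unfolding \<theta>_def
      using dir_deriv_diff[OF smooth_on_differentiable[OF Ss UNIV_I] smooth_on_differentiable[OF Ss UNIV_I]]
      by simp
    have cS: "continuous_on X (dir_deriv 1 (S c))" for X c
      using smooth_on_continuous[OF smooth_on_dir_deriv[OF open_UNIV Ss]] continuous_on_subset by blast
    have gI: "continuous_on I g" using g IJ by (rule continuous_on_subset)
    have cI: "continuous_on I (\<lambda>r. dir_deriv 1 \<theta> r * g r + K * \<theta> r)"
      unfolding \<theta>d by (intro continuous_intros cS gI continuous_on_subset[OF smooth_on_continuous[OF \<theta>s] subset_UNIV])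
    have "0 \<le> (LINT r:J|lebesgue. dir_deriv 1 \<theta> r * g r + K * \<theta> r)"
      by (rule H[OF \<theta>t \<theta>0])
    also have "\<dots> = (LINT r:I|lebesgue. dir_deriv 1 \<theta> r * g r + K * \<theta> r)"
    proof -
      have "dir_deriv 1 \<theta> r = 0" if "r \<notin> I" for r
        using that \<epsilon> s by (auto simp: \<theta>d I_def S'z)
      then show ?thesis
        unfolding set_lebesgue_integral_def using IJ J \<theta>z
        by (intro Bochner_Integration.integral_cong) (auto simp: indicator_def)
    qed
    also have "\<dots> = integral I (\<lambda>r. dir_deriv 1 \<theta> r * g r + K * \<theta> r)"
      using absolutely_integrable_continuous_real[of s1 "s2 + \<epsilon>"] cI
      by (intro set_lebesgue_integral_eq_integral) (simp add: I_def)
    also have "\<dots> \<le> integral I (\<lambda>r. (g s1 + e) * dir_deriv 1 (S s1) r - (g s2 - e) * dir_deriv 1 (S s2) r + K)"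
    proof (rule integral_le)
      fix r assume "r \<in> I"
      have a: "dir_deriv 1 (S s1) r * g r \<le> dir_deriv 1 (S s1) r * (g s1 + e)"
      proof (cases "r < s1 \<or> s1 + \<epsilon> < r")
        case False
        then have "\<bar>g r - g s1\<bar> < e" using \<epsilon> by (intro d(3)) auto
        then show ?thesis using S'0 by (intro mult_left_mono) auto
      qed (simp add: S'z)
      have b: "dir_deriv 1 (S s2) r * g r \<ge> dir_deriv 1 (S s2) r * (g s2 - e)"
      proof (cases "r < s2 \<or> s2 + \<epsilon> < r")
        case False
        then have "\<bar>g r - g s2\<bar> < e" using \<epsilon> by (intro d(4)) auto
        then show ?thesis using S'0 by (intro mult_left_mono) auto
      qed (simp add: S'z)
      have "K * \<theta> r \<le> K" using \<theta>1[of r] K mult_left_mono[of "\<theta> r" 1 K] by simp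
      with a b show "dir_deriv 1 \<theta> r * g r + K * \<theta> r
          \<le> (g s1 + e) * dir_deriv 1 (S s1) r - (g s2 - e) * dir_deriv 1 (S s2) r + K"
        by (simp add: \<theta>d algebra_simps)
    next
      show "(\<lambda>r. dir_deriv 1 \<theta> r * g r + K * \<theta> r) integrable_on I"
        using cI unfolding I_def by (rule integrable_continuous_interval)
      show "(\<lambda>r. (g s1 + e) * dir_deriv 1 (S s1) r - (g s2 - e) * dir_deriv 1 (S s2) r + K) integrable_on I"
        unfolding I_def by (intro integrable_continuous_interval continuous_intros cS)
    qed
    also have "\<dots> = (g s1 + e) - (g s2 - e) + K * (s2 + \<epsilon> - s1)"
    proof (rule integral_unique)
      have ftc: "(dir_deriv 1 (S c) has_integral S c (s2 + \<epsilon>) - S c s1) I" for c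
        unfolding I_def
        using real_derivative_dir_deriv[OF smooth_on_differentiable[OF Ss UNIV_I]] s \<epsilon>
        by (intro fundamental_theorem_of_calculus)
          (auto simp: has_real_derivative_iff_has_vector_derivative intro: has_vector_derivative_at_within)
      have "(dir_deriv 1 (S s1) has_integral 1) I" "(dir_deriv 1 (S s2) has_integral 1) I"
        using ftc[of s1] ftc[of s2] s \<epsilon> by (simp_all add: S0 S1)
      moreover have "((\<lambda>r. K) has_integral K * (s2 + \<epsilon> - s1)) I"
        using has_integral_const_real[of K s1 "s2 + \<epsilon>"] s \<epsilon> by (simp add: I_def mult.commute)
      ultimately show "((\<lambda>r. (g s1 + e) * dir_deriv 1 (S s1) r - (g s2 - e) * dir_deriv 1 (S s2) r + K)
          has_integral (g s1 + e) - (g s2 - e) + K * (s2 + \<epsilon> - s1)) I"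
        using has_integral_mult_right[of "dir_deriv 1 (S s1)" 1 I "g s1 + e"]
          has_integral_mult_right[of "dir_deriv 1 (S s2)" 1 I "g s2 - e"]
        by (intro has_integral_add has_integral_diff) auto
    qed
    finally have "g s2 - g s1 - K * (s2 - s1) \<le> 2 * e + K * \<epsilon>" by (simp add: algebra_simps)
    also have "\<dots> \<le> (2 + K) * e" using mult_left_mono[OF \<epsilon>(4) K] by (simp add: algebra_simps)
    finally show ?thesis .
  qed
  have "g s2 - g s1 - K * (s2 - s1) \<le> 0"
  proof (rule field_le_epsilon)
    fix e :: real assume "e > 0"
    then show "g s2 - g s1 - K * (s2 - s1) \<le> 0 + e"
      using main[of "e / (2 + K)"] K by simp
  qed
  then show ?thesis by simp
qed

section \<open>Testing the weak equation\<close>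

text \<open>The backward heat operator \<open>\<partial>\<^sub>t + \<nu>\<Delta>\<close>: the weak equation pairs \<open>u\<close> with minus its value on the
  test function.\<close>
definition heat_op :: "real \<Rightarrow> ('a::euclidean_space \<times> real \<Rightarrow> real) \<Rightarrow> 'a \<times> real \<Rightarrow> real" where
  "heat_op \<nu> \<phi> z = time_deriv \<phi> z + \<nu> * space_laplacian \<phi> z"

lemma smooth_on_heat_op: "open U \<Longrightarrow> smooth_on U \<phi> \<Longrightarrow> smooth_on U (heat_op \<nu> \<phi>)"
  unfolding heat_op_def[abs_def] time_deriv_def space_laplacian_def
  by (intro smooth_on_add smooth_on_mult smooth_on_const smooth_on_sum smooth_on_dir_deriv) auto

lemma heat_op_zero_on_open:
  assumes "open U" "\<And>z. z \<in> U \<Longrightarrow> \<phi> z = 0" "z \<in> U"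
  shows "heat_op \<nu> \<phi> z = 0"
proof -
  have "dir_deriv v \<phi> z = 0" if "z \<in> U" for z v
    using dir_deriv_zero_on_open[OF assms(1,2) that] .
  then have "dir_deriv w (dir_deriv v \<phi>) z = 0" for w v
    using dir_deriv_zero_on_open[of U "dir_deriv v \<phi>" z w] assms by simp
  with \<open>\<And>z v. z \<in> U \<Longrightarrow> dir_deriv v \<phi> z = 0\<close>[OF assms(3)] show ?thesis
    by (simp add: heat_op_def time_deriv_def space_laplacian_def)
qed

lemma open_open_time: "open (open_time T)"
proof -
  have "open_time T = {0<..} \<inter> ereal -` {..<T}" by (auto simp: open_time_def)
  then show ?thesis by (simp add: open_Int open_ereal_vimage)
qed

lemma open_time_extend:
  assumes "t \<in> open_time T" "t < m"
  obtains \<beta> where "t < \<beta>" "\<beta> \<le> m" "{0<..<\<beta>} \<subseteq> open_time T"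
proof -
  obtain d where d: "d > 0" "cball t d \<subseteq> open_time T"
    using open_open_time assms(1) open_contains_cball by blast
  have "t + d \<in> open_time T" using d by (auto simp: dist_real_def subset_iff)
  then have "{0<..<min m (t + d)} \<subseteq> open_time T"
    by (auto simp: open_time_def elim: le_less_trans[rotated])
  then show thesis using that[of "min m (t + d)"] d(1) assms(2) by simp
qed

text \<open>A weak solution together with a fixed choice of its spatial weak gradient.\<close>
locale weak_solution =
  fixes \<nu> q :: real and \<Omega> :: "'a::euclidean_space set" and T :: ereal
    and u :: "real \<Rightarrow> 'a \<Rightarrow> real" and Du :: "real \<Rightarrow> 'a \<Rightarrow> 'a"
  assumes u_cont: "C_Lp_loc (open_time T) 1 \<Omega> u"
    and u_nonneg: "AE (x, t) in lebesgue. (x, t) \<in> Q \<Omega> T \<longrightarrow> 0 \<le> u t x"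
    and weak_grad: "AE t in lebesgue. t \<in> open_time T \<longrightarrow> W11_loc \<Omega> (u t) (Du t)"
    and grad_q: "Lp_loc 1 (Q \<Omega> T) (\<lambda>(x, t). norm (Du t x) powr q)"
    and weak_eq: "\<And>\<phi>. \<phi> \<in> test_functions (Q \<Omega> T) \<Longrightarrow>
      (LINT t:open_time T|lebesgue. LINT x:\<Omega>|lebesgue.
                 - u t x * time_deriv \<phi> (x, t) - \<nu> * u t x * space_laplacian \<phi> (x, t)
                 + norm (Du t x) powr q * \<phi> (x, t)) = 0"
begin

lemma u_integrable:
  assumes "t \<in> open_time T" "compact K" "K \<subseteq> \<Omega>"
  shows "set_integrable lebesgue K (u t)"
  using Lp_loc_1_imp_set_integrable(1)[OF _ assms(2,3)] u_cont assms(1) unfolding C_Lp_loc_def by blast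

text \<open>The weak equation is a statement about an iterated integral of a sum. To drop or estimate
  single terms one has to split it, which needs integrability of each part: for the terms with \<open>u\<close> it
  follows from continuity in time, for the gradient term from Fubini's theorem.\<close>
lemma weak_form_split:
  assumes \<phi>: "\<phi> \<in> test_functions (Q \<Omega> T)"
  shows "set_integrable lebesgue (open_time T) (\<lambda>t. LINT x:\<Omega>|lebesgue. u t x * heat_op \<nu> \<phi> (x, t))"
    and "set_integrable lebesgue (open_time T) (\<lambda>t. LINT x:\<Omega>|lebesgue. norm (Du t x) powr q * \<phi> (x, t))"
    and "(LINT t:open_time T|lebesgue. LINT x:\<Omega>|lebesgue. u t x * heat_op \<nu> \<phi> (x, t))
      = (LINT t:open_time T|lebesgue. LINT x:\<Omega>|lebesgue. norm (Du t x) powr q * \<phi> (x, t))"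
    and "AE t in lebesgue. t \<in> open_time T \<longrightarrow> set_integrable lebesgue \<Omega> (\<lambda>x. norm (Du t x) powr q * \<phi> (x, t))"
proof -
  define C where "C = closure {z. \<phi> z \<noteq> 0}"
  have C: "compact C" "C \<subseteq> Q \<Omega> T" and s\<phi>: "smooth_on UNIV \<phi>"
    using \<phi> by (auto simp: C_def test_functions_iff compactly_contained_def)
  define K where "K = fst ` C"
  define I where "I = snd ` C"
  have K: "compact K" "K \<subseteq> \<Omega>" and I: "compact I" "I \<subseteq> open_time T"
    using C by (auto simp: K_def I_def Q_def intro!: compact_continuous_image continuous_intros)
  have KI: "compact (K \<times> I)" "K \<times> I \<subseteq> Q \<Omega> T" using K I by (auto simp: Q_def compact_Times)
  have z: "\<phi> z = 0" if "z \<notin> K \<times> I" for z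
  proof -
    have "z \<notin> C" using that by (cases z) (force simp: K_def I_def)
    then show ?thesis using closure_subset[of "{z. \<phi> z \<noteq> 0}"] by (auto simp: C_def)
  qed
  have hz: "heat_op \<nu> \<phi> z = 0" if "z \<notin> K \<times> I" for z
    by (rule heat_op_zero_on_open[of "- (K \<times> I)"]) (use that z KI in \<open>auto simp: compact_imp_closed open_Compl\<close>)
  have hc: "continuous_on X (heat_op \<nu> \<phi>)" for X
    using smooth_on_continuous[OF smooth_on_heat_op[OF open_UNIV s\<phi>]] continuous_on_subset by blast
  have \<phi>c: "continuous_on X \<phi>" for X
    using smooth_on_continuous[OF s\<phi>] continuous_on_subset by blast
  let ?I1 = "\<lambda>t. LINT x:\<Omega>|lebesgue. u t x * heat_op \<nu> \<phi> (x, t)"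
  let ?I2 = "\<lambda>t. LINT x:\<Omega>|lebesgue. norm (Du t x) powr q * \<phi> (x, t)"
  have I1: "?I1 t = (LINT x:K|lebesgue. u t x * heat_op \<nu> \<phi> (x, t))" for t
    by (rule set_integral_support(1)[OF K(2)]) (simp add: hz)
  have "continuous_on (open_time T) ?I1"
    unfolding I1 by (rule pairing_continuous[OF u_cont K order_refl hc])
  then have "set_integrable lebesgue I ?I1"
    by (intro set_integrable_continuous_compact[OF I(1)] continuous_on_subset[OF _ I(2)])
  then show i1: "set_integrable lebesgue (open_time T) ?I1"
    using set_integral_support(2)[OF I(2), of ?I1 lebesgue] by (simp add: hz set_lebesgue_integral_def)
  have u1: "set_integrable lebesgue \<Omega> (\<lambda>x. u t x * heat_op \<nu> \<phi> (x, t))" if "t \<in> open_time T" for t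
  proof -
    have "set_integrable lebesgue K (\<lambda>x. u t x * heat_op \<nu> \<phi> (x, t))"
      by (intro set_integrable_mult_continuous[OF u_integrable[OF that K] K(1)]
          continuous_on_compose2[OF hc[of UNIV]] continuous_intros) auto
    then show ?thesis
      using set_integral_support(2)[OF K(2), of "\<lambda>x. u t x * heat_op \<nu> \<phi> (x, t)" lebesgue] by (simp add: hz)
  qed
  define F where "F z = indicator (K \<times> I) z *\<^sub>R ((case z of (x, t) \<Rightarrow> norm (Du t x) powr q) * \<phi> z)" for z
  have "set_integrable lebesgue (K \<times> I) (\<lambda>(x, t). norm (Du t x) powr q)"
    by (rule Lp_loc_1_imp_set_integrable(1)[OF grad_q KI])
  from set_integrable_mult_continuous[OF this KI(1) \<phi>c]
  have "integrable lebesgue F" by (simp add: F_def[abs_def] set_integrable_def)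
  note Fi = integrable_lebesgue_prod_swap[OF this]
  have F: "F (x, t) = indicator \<Omega> x *\<^sub>R (norm (Du t x) powr q * \<phi> (x, t))" for x t
    using z[of "(x, t)"] K(2) by (cases "(x, t) \<in> K \<times> I") (auto simp: F_def indicator_def)
  show i3: "AE t in lebesgue. t \<in> open_time T \<longrightarrow> set_integrable lebesgue \<Omega> (\<lambda>x. norm (Du t x) powr q * \<phi> (x, t))"
    using Fi(1) unfolding F set_integrable_def by (auto elim: eventually_mono)
  have "integrable lebesgue ?I2"
    using Fi(2) unfolding F set_lebesgue_integral_def .
  moreover have "?I2 t = 0" if "t \<notin> I" for t
    using that by (simp add: z set_lebesgue_integral_def)
  ultimately show i2: "set_integrable lebesgue (open_time T) ?I2"
    using set_integral_support(2)[of "open_time T" UNIV ?I2 lebesgue] I(2) by (auto simp: set_integrable_def)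
  let ?J = "\<lambda>t. LINT x:\<Omega>|lebesgue. - u t x * time_deriv \<phi> (x, t) - \<nu> * u t x * space_laplacian \<phi> (x, t)
                 + norm (Du t x) powr q * \<phi> (x, t)"
  have J: "AE t in lebesgue. indicator (open_time T) t *\<^sub>R ?J t = indicator (open_time T) t *\<^sub>R (?I2 t - ?I1 t)"
    using i3
  proof eventually_elim
    case (elim t)
    show ?case
    proof (cases "t \<in> open_time T")
      case True
      have "- u t x * time_deriv \<phi> (x, t) - \<nu> * u t x * space_laplacian \<phi> (x, t) + norm (Du t x) powr q * \<phi> (x, t)
          = norm (Du t x) powr q * \<phi> (x, t) - u t x * heat_op \<nu> \<phi> (x, t)" for x
        by (simp add: heat_op_def algebra_simps)
      then show ?thesis
        using set_integral_diff(2)[OF elim[rule_format, OF True] u1[OF True]] by simp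
    qed simp
  qed
  have i21: "integrable lebesgue (\<lambda>t. indicator (open_time T) t *\<^sub>R (?I2 t - ?I1 t))"
    using set_integral_diff(1)[OF i2 i1] by (simp add: set_integrable_def)
  have "0 = (LINT t:open_time T|lebesgue. ?I2 t - ?I1 t)"
    using integrable_lebesgue_cong_AE(2)[OF i21 J] weak_eq[OF \<phi>] by (simp add: set_lebesgue_integral_def)
  also have "\<dots> = (LINT t:open_time T|lebesgue. ?I2 t) - (LINT t:open_time T|lebesgue. ?I1 t)"
    by (rule set_integral_diff(2)[OF i2 i1])
  finally show "(LINT t:open_time T|lebesgue. ?I1 t) = (LINT t:open_time T|lebesgue. ?I2 t)" by simp
qed

text \<open>Since the absorption term is nonnegative, \<open>u\<close> is a subsolution of the heat equation.\<close>
lemma subsolution_test: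
  assumes "\<phi> \<in> test_functions (Q \<Omega> T)" "\<And>z. 0 \<le> \<phi> z"
  shows "0 \<le> (LINT t:open_time T|lebesgue. LINT x:\<Omega>|lebesgue. u t x * heat_op \<nu> \<phi> (x, t))"
  unfolding weak_form_split(3)[OF assms(1)] unfolding set_lebesgue_integral_def
  by (intro Bochner_Integration.integral_nonneg scaleR_nonneg_nonneg mult_nonneg_nonneg) (auto simp: assms(2))

text \<open>The sign is given almost everywhere in space-time, hence on almost every slice. Every other slice is
  an \<open>L\<^sup>1\<close> limit of such slices, so the integral of its negative part vanishes.\<close>
lemma u_nonneg_slice:
  assumes t: "t \<in> open_time T" and K: "compact K" "K \<subseteq> \<Omega>"
  shows "AE x in lebesgue. x \<in> K \<longrightarrow> 0 \<le> u t x"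
proof -
  define X where "X = {s. AE x in lebesgue. (x, s) \<in> Q \<Omega> T \<longrightarrow> 0 \<le> u s x}"
  have "AE s in lebesgue. s \<in> X"
    using AE_lebesgue_prod_swap[OF u_nonneg] by (simp add: X_def)
  then have neg: "negligible (- X)"
    by (simp add: negligible_iff_null_sets completion.AE_iff_null_sets Compl_eq)
  note ot = open_open_time[of T]
  have int: "set_integrable lebesgue K (u s)" if "s \<in> open_time T" for s by (rule u_integrable[OF that K])
  define m where "m x = max 0 (- u t x)" for x
  have mi: "set_integrable lebesgue K m"
  proof -
    have "integrable lebesgue (\<lambda>x. max 0 (- (indicator K x *\<^sub>R u t x)))"
      using int[OF t] unfolding set_integrable_def by (intro integrable_max integrable_minus) auto
    moreover have "max 0 (- (indicator K x *\<^sub>R u t x)) = indicator K x *\<^sub>R m x" for x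
      by (simp add: m_def indicator_def)
    ultimately show ?thesis by (simp add: set_integrable_def)
  qed
  have le: "(LINT x:K|lebesgue. m x) \<le> e" if e: "e > 0" for e
  proof -
    have "((\<lambda>s. Lp_norm 1 K (\<lambda>x. u s x - u t x)) \<longlongrightarrow> 0) (at t within open_time T)"
      using u_cont t K unfolding C_Lp_loc_def by blast
    then have "((\<lambda>s. Lp_norm 1 K (\<lambda>x. u s x - u t x)) \<longlongrightarrow> 0) (at t)"
      using at_within_open[OF t ot] by simp
    from tendstoD[OF this e] obtain d where d: "d > 0"
      "\<And>s. s \<noteq> t \<Longrightarrow> dist s t < d \<Longrightarrow> \<bar>Lp_norm 1 K (\<lambda>x. u s x - u t x)\<bar> < e"
      unfolding eventually_at by auto
    obtain d' where d': "d' > 0" "ball t d' \<subseteq> open_time T" using ot t open_contains_ball by blast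
    have "\<exists>s\<in>{t<..<t + min d d'}. s \<in> X"
    proof (rule ccontr)
      assume "\<not> ?thesis"
      then have "{t<..<t + min d d'} \<subseteq> - X" by auto
      then have "negligible {t<..<t + min d d'}" using neg negligible_subset by blast
      then show False using d d' open_not_negligible[of "{t<..<t + min d d'}"] by auto
    qed
    then obtain s where s: "t < s" "s < t + d" "s < t + d'" "s \<in> X" by auto
    have sJ: "s \<in> open_time T" using s d'(2) by (auto simp: dist_real_def subset_iff)
    have di: "set_integrable lebesgue K (\<lambda>x. \<bar>u s x - u t x\<bar>)"
      using int[OF sJ] int[OF t] by (intro set_integrable_abs set_integral_diff)
    have "(LINT x:K|lebesgue. m x) \<le> (LINT x:K|lebesgue. \<bar>u s x - u t x\<bar>)"
      unfolding set_lebesgue_integral_def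
    proof (rule integral_mono_AE)
      have "AE x in lebesgue. (x, s) \<in> Q \<Omega> T \<longrightarrow> 0 \<le> u s x" using s(4) by (simp add: X_def)
      then show "AE x in lebesgue. indicator K x *\<^sub>R m x \<le> indicat_real K x *\<^sub>R \<bar>u s x - u t x\<bar>"
      proof eventually_elim
        case (elim x)
        then show ?case using K(2) sJ by (cases "x \<in> K") (auto simp: Q_def m_def)
      qed
    qed (use mi di in \<open>auto simp: set_integrable_def\<close>)
    also have "\<dots> = Lp_norm 1 K (\<lambda>x. u s x - u t x)"
    proof -
      have "(LINT x:K|lebesgue. \<bar>u s x - u t x\<bar>) \<ge> 0"
        unfolding set_lebesgue_integral_def by (rule Bochner_Integration.integral_nonneg) (simp add: indicator_def)
      then show ?thesis by (simp add: Lp_norm_def)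
    qed
    also have "\<dots> \<le> e" using d(2)[of s] s by (auto simp: dist_real_def)
    finally show ?thesis .
  qed
  have "(LINT x:K|lebesgue. m x) \<le> 0" by (rule field_le_epsilon) (simp add: le)
  then have "(LINT x:K|lebesgue. m x) = 0"
    by (intro antisym) (auto simp: set_lebesgue_integral_def m_def intro!: Bochner_Integration.integral_nonneg)
  then have "AE x in lebesgue. indicator K x *\<^sub>R m x = 0"
    using integral_nonneg_eq_0_iff_AE[of lebesgue "\<lambda>x. indicator K x *\<^sub>R m x"] mi
    by (simp add: set_lebesgue_integral_def set_integrable_def m_def)
  then show ?thesis
    by eventually_elim (auto simp: m_def indicator_def max_def split: if_splits)
qed

text \<open>Up to a constant, the gradient term absorbs the flux through the cutoff, so the distributional
  derivative of \<open>\<integral>u \<xi>\<close> is bounded above. On almost every slice the weak gradient turns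
  \<open>\<integral>u \<Delta>\<xi>\<close> into \<open>-\<integral>\<nabla>u \<bullet> \<nabla>\<xi>\<close>, which is where it enters the proof.\<close>
lemma local_mass_test:
  assumes q: "1 < q" and \<nu>: "0 < \<nu>"
    and \<xi>: "smooth_on UNIV \<xi>" "\<And>y. 0 \<le> \<xi> y" and L: "0 \<le> L" "\<And>y v. \<bar>dir_deriv v \<xi> y\<bar> \<le> L * norm v * \<xi> y powr (1 / q)"
    and K: "compact K" "K \<subseteq> \<Omega>" "\<And>y. y \<notin> K \<Longrightarrow> \<xi> y = 0"
    and \<theta>: "\<theta> \<in> test_functions (open_time T)" "\<And>s. 0 \<le> \<theta> s"
  shows "0 \<le> (LINT t:open_time T|lebesgue. dir_deriv 1 \<theta> t * (LINT x:K|lebesgue. u t x * \<xi> x)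
      + (\<nu> * L) powr (q / (q - 1)) * measure lebesgue K * \<theta> t)"
proof -
  define M where "M = (\<nu> * L) powr (q / (q - 1))"
  define I where "I = closure {s. \<theta> s \<noteq> 0}"
  have I: "compact I" "I \<subseteq> open_time T" and s\<theta>: "smooth_on UNIV \<theta>"
    using \<theta>(1) by (auto simp: I_def test_functions_iff compactly_contained_def)
  have \<theta>z: "\<theta> s = 0" if "s \<notin> I" for s
    using that closure_subset[of "{s. \<theta> s \<noteq> 0}"] by (auto simp: I_def)
  have d\<theta>z: "dir_deriv 1 \<theta> s = 0" if "s \<notin> I" for s
    by (rule dir_deriv_zero_on_open[of "- I"]) (use that \<theta>z I in \<open>auto simp: compact_imp_closed open_Compl\<close>)
  define \<phi> where "\<phi> z = \<xi> (fst z) * \<theta> (snd z)" for z :: "'a \<times> real"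
  have \<phi>: "\<phi> \<in> test_functions (Q \<Omega> T)"
  proof (rule test_functionsI)
    show "smooth_on UNIV \<phi>"
      unfolding \<phi>_def by (intro smooth_on_mult smooth_on_fst smooth_on_snd \<xi> s\<theta> open_UNIV)
    show "compact (K \<times> I)" "K \<times> I \<subseteq> Q \<Omega> T" using K I by (auto simp: compact_Times Q_def)
    show "\<phi> z = 0" if "z \<notin> K \<times> I" for z
      using that K(3)[of "fst z"] \<theta>z[of "snd z"] by (cases z) (auto simp: \<phi>_def)
  qed
  have dprod: "dir_deriv w (\<lambda>z. f (fst z) * \<theta> (snd z)) z
      = f (fst z) * dir_deriv (snd w) \<theta> (snd z) + dir_deriv (fst w) f (fst z) * \<theta> (snd z)"
    if "smooth_on UNIV f" for f :: "'a \<Rightarrow> real" and w z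
    using dir_deriv_mult[OF smooth_on_differentiable[OF smooth_on_fst[OF that] UNIV_I]
        smooth_on_differentiable[OF smooth_on_snd[OF s\<theta>] UNIV_I], of w z]
    by (simp add: dir_deriv_fst[OF that] dir_deriv_snd[OF s\<theta>])
  have d0: "dir_deriv 0 f z = 0" if "smooth_on UNIV f" for f :: "'b::euclidean_space \<Rightarrow> real" and z
    by (rule dir_deriv_direction_0[OF smooth_on_differentiable[OF that UNIV_I]])
  have s\<xi>': "smooth_on UNIV (dir_deriv b \<xi>)" for b by (rule smooth_on_dir_deriv[OF open_UNIV \<xi>(1)])
  define lap where "lap y = (\<Sum>b\<in>Basis. dir_deriv b (dir_deriv b \<xi>) y)" for y
  have heat: "heat_op \<nu> \<phi> (x, t) = dir_deriv 1 \<theta> t * \<xi> x + \<nu> * \<theta> t * lap x" for x t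
  proof -
    have "dir_deriv (b, 0) \<phi> = (\<lambda>z. dir_deriv b \<xi> (fst z) * \<theta> (snd z))" for b
      unfolding \<phi>_def dprod[OF \<xi>(1)] by (simp add: d0[OF s\<theta>])
    moreover have "dir_deriv (0, 1) \<phi> (x, t) = \<xi> x * dir_deriv 1 \<theta> t"
      unfolding \<phi>_def dprod[OF \<xi>(1)] by (simp add: d0[OF \<xi>(1)])
    moreover have "dir_deriv (b, 0) (\<lambda>z. dir_deriv b \<xi> (fst z) * \<theta> (snd z)) (x, t)
        = \<theta> t * dir_deriv b (dir_deriv b \<xi>) x" for b
      unfolding dprod[OF s\<xi>'] by (simp add: d0[OF s\<theta>])
    ultimately show ?thesis
      by (simp add: heat_op_def time_deriv_def space_laplacian_def lap_def sum_distrib_left mult.commute mult.left_commute mult.assoc)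
  qed
  have \<xi>'z: "dir_deriv v \<xi> y = 0" if "y \<notin> K" for y v
    using L(2)[of v y] K(3)[OF that] by simp
  have cont: "continuous_on X f" if "smooth_on UNIV f" for f :: "'a \<Rightarrow> real" and X
    using smooth_on_continuous[OF that] continuous_on_subset by blast
  have slap: "smooth_on UNIV lap"
    unfolding lap_def by (intro smooth_on_sum smooth_on_dir_deriv[OF open_UNIV s\<xi>'] open_UNIV)
  have lapz: "lap y = 0" if "y \<notin> K" for y
  proof -
    have "dir_deriv b (dir_deriv b \<xi>) y = 0" for b
      by (rule dir_deriv_zero_on_open[of "- K"]) (use that \<xi>'z K in \<open>auto simp: compact_imp_closed open_Compl\<close>)
    then show ?thesis by (simp add: lap_def)
  qed
  \<comment> \<open>Young's inequality: the diffusion flux through the cutoff is absorbed by the gradient term.\<close>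
  have young: "- \<nu> * dir_deriv v \<xi> y - norm v powr q * \<xi> y \<le> M" for v y
  proof -
    define w where "w = norm v * \<xi> y powr (1 / q)"
    have w: "w \<ge> 0" by (simp add: w_def)
    have wq: "w powr q = norm v powr q * \<xi> y"
      using q \<xi>(2)[of y] by (simp add: w_def powr_mult powr_powr)
    have "- \<nu> * dir_deriv v \<xi> y \<le> \<nu> * \<bar>dir_deriv v \<xi> y\<bar>"
      using \<nu> by (simp add: abs_if)
    also have "\<dots> \<le> \<nu> * L * w" using mult_left_mono[OF L(2)[of v y], of \<nu>] \<nu> by (simp add: w_def mult.assoc)
    also have "\<dots> \<le> w powr q + M"
    proof (cases "w powr (q - 1) \<ge> \<nu> * L")
      case True
      have "\<nu> * L * w \<le> w powr (q - 1) * w" using True w by (rule mult_right_mono)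
      also have "\<dots> = w powr q" using w q by (cases "w = 0") (auto simp: powr_diff)
      finally show ?thesis by (simp add: M_def add_increasing2)
    next
      case False
      define l where "l = \<nu> * L"
      have l: "l > 0" using False powr_ge_zero[of w "q - 1"] by (auto simp: l_def simp del: powr_ge_zero)
      have "w = (w powr (q - 1)) powr (1 / (q - 1))" using q w by (simp add: powr_powr)
      also have "\<dots> \<le> l powr (1 / (q - 1))" using False q by (intro powr_mono2) (auto simp: l_def)
      finally have "l * w \<le> l * l powr (1 / (q - 1))" using l by simp
      also have "\<dots> = l powr (1 + 1 / (q - 1))" using l by (simp add: powr_add)
      also have "1 + 1 / (q - 1) = q / (q - 1)" using q by (simp add: field_simps)
      finally show ?thesis by (simp add: M_def l_def add_increasing)
    qed
    finally show ?thesis using wq by simp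
  qed
  let ?g = "\<lambda>t. LINT x:K|lebesgue. u t x * \<xi> x"
  let ?I1 = "\<lambda>t. LINT x:\<Omega>|lebesgue. u t x * heat_op \<nu> \<phi> (x, t)"
  let ?I2 = "\<lambda>t. LINT x:\<Omega>|lebesgue. norm (Du t x) powr q * \<phi> (x, t)"
  have ae: "AE t in lebesgue. indicator (open_time T) t *\<^sub>R (?I1 t - ?I2 t)
      \<le> indicator (open_time T) t *\<^sub>R (dir_deriv 1 \<theta> t * ?g t + M * measure lebesgue K * \<theta> t)"
    using weak_grad weak_form_split(4)[OF \<phi>]
  proof eventually_elim
    case (elim t)
    show ?case
    proof (cases "t \<in> open_time T")
      case t: True
      have W: "W11_loc \<Omega> (u t) (Du t)" and i2: "set_integrable lebesgue \<Omega> (\<lambda>x. norm (Du t x) powr q * \<phi> (x, t))"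
        using elim t by auto
      have iK: "set_integrable lebesgue K (\<lambda>x. u t x * f x)" if "continuous_on K f" for f
        by (rule set_integrable_mult_continuous[OF u_integrable[OF t K(1,2)] K(1) that])
      have Dui: "set_integrable lebesgue K (\<lambda>x. (Du t x \<bullet> b) * f x)" if "continuous_on K f" for f b
      proof (rule set_integrable_mult_continuous[OF _ K(1) that])
        have "set_integrable lebesgue K (Du t)"
          using W Lp_loc_1_imp_set_integrable(1)[OF _ K(1,2)] unfolding W11_loc_def by blast
        then have "integrable lebesgue (\<lambda>x. (indicator K x *\<^sub>R Du t x) \<bullet> b)"
          unfolding set_integrable_def by (rule integrable_inner_left)
        then show "set_integrable lebesgue K (\<lambda>x. Du t x \<bullet> b)" by (simp add: set_integrable_def)
      qed
      have ddl: "dir_deriv (Du t x) \<xi> x = (\<Sum>b\<in>Basis. (Du t x \<bullet> b) * dir_deriv b \<xi> x)" for x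
        by (rule dir_deriv_linear[OF smooth_on_differentiable[OF \<xi>(1) UNIV_I]])
      have parts: "(LINT x:K|lebesgue. u t x * dir_deriv b (dir_deriv b \<xi>) x)
          = - (LINT x:K|lebesgue. (Du t x \<bullet> b) * dir_deriv b \<xi> x)" if b: "b \<in> Basis" for b
      proof -
        have tf: "dir_deriv b \<xi> \<in> test_functions \<Omega>"
          by (rule test_functionsI[OF s\<xi>' K(1,2) \<xi>'z])
        have "dir_deriv b (dir_deriv b \<xi>) y = 0" if "y \<notin> K" for y
          by (rule dir_deriv_zero_on_open[of "- K"]) (use that \<xi>'z K in \<open>auto simp: compact_imp_closed open_Compl\<close>)
        then have "(LINT x:\<Omega>|lebesgue. u t x * dir_deriv b (dir_deriv b \<xi>) x)
            = (LINT x:K|lebesgue. u t x * dir_deriv b (dir_deriv b \<xi>) x)"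
          by (intro set_integral_support(1)[OF K(2)]) simp
        moreover have "(LINT x:\<Omega>|lebesgue. (Du t x \<bullet> b) * dir_deriv b \<xi> x)
            = (LINT x:K|lebesgue. (Du t x \<bullet> b) * dir_deriv b \<xi> x)"
          by (intro set_integral_support(1)[OF K(2)]) (simp add: \<xi>'z)
        ultimately show ?thesis
          using W tf b unfolding W11_loc_def by metis
      qed
      have "(LINT x:K|lebesgue. u t x * lap x) = (\<Sum>b\<in>Basis. LINT x:K|lebesgue. u t x * dir_deriv b (dir_deriv b \<xi>) x)"
        unfolding lap_def sum_distrib_left
        by (rule set_integral_finite_sum(1)) (auto intro!: iK cont smooth_on_dir_deriv s\<xi>')
      also have "\<dots> = - (\<Sum>b\<in>Basis. LINT x:K|lebesgue. (Du t x \<bullet> b) * dir_deriv b \<xi> x)"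
        by (simp add: parts sum_negf)
      also have "(\<Sum>b\<in>Basis. LINT x:K|lebesgue. (Du t x \<bullet> b) * dir_deriv b \<xi> x)
          = (LINT x:K|lebesgue. \<Sum>b\<in>Basis. (Du t x \<bullet> b) * dir_deriv b \<xi> x)"
        by (rule set_integral_finite_sum(1)[symmetric]) (auto intro!: Dui cont s\<xi>')
      also have "\<dots> = (LINT x:K|lebesgue. dir_deriv (Du t x) \<xi> x)"
        by (simp only: ddl)
      finally have lapint: "(LINT x:K|lebesgue. u t x * lap x) = - (LINT x:K|lebesgue. dir_deriv (Du t x) \<xi> x)" .
      have ddi: "set_integrable lebesgue K (\<lambda>x. dir_deriv (Du t x) \<xi> x)"
      proof -
        have "set_integrable lebesgue K (\<lambda>x. \<Sum>b\<in>Basis. (Du t x \<bullet> b) * dir_deriv b \<xi> x)"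
          by (rule set_integral_finite_sum(2)) (auto intro!: Dui cont s\<xi>')
        then show ?thesis
          by (simp only: ddl)
      qed
      have i2K: "set_integrable lebesgue K (\<lambda>x. norm (Du t x) powr q * \<phi> (x, t))"
        using i2 set_integral_support(2)[OF K(2), of "\<lambda>x. norm (Du t x) powr q * \<phi> (x, t)" lebesgue]
        by (simp add: \<phi>_def K(3))
      have I2: "?I2 t = (LINT x:K|lebesgue. norm (Du t x) powr q * \<phi> (x, t))"
        by (intro set_integral_support(1)[OF K(2)]) (simp add: \<phi>_def K(3))
      have "?I1 t = (LINT x:K|lebesgue. dir_deriv 1 \<theta> t * (u t x * \<xi> x) + \<nu> * \<theta> t * (u t x * lap x))"
        by (subst set_integral_support(1)[OF K(2)]) (simp_all add: heat lapz K(3) algebra_simps)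
      also have "\<dots> = dir_deriv 1 \<theta> t * ?g t + \<nu> * \<theta> t * (LINT x:K|lebesgue. u t x * lap x)"
        by (subst set_integral_add(2)) (auto intro!: iK cont \<xi> slap)
      finally have I1: "?I1 t = dir_deriv 1 \<theta> t * ?g t - \<nu> * \<theta> t * (LINT x:K|lebesgue. dir_deriv (Du t x) \<xi> x)"
        by (simp add: lapint)
      have "- \<nu> * \<theta> t * (LINT x:K|lebesgue. dir_deriv (Du t x) \<xi> x) - ?I2 t
          = (LINT x:K|lebesgue. (- \<nu> * \<theta> t) * dir_deriv (Du t x) \<xi> x - norm (Du t x) powr q * \<phi> (x, t))"
        unfolding I2 set_integral_diff(2)[OF set_integrable_mult_right[OF ddi] i2K]
        by (simp only: set_integral_mult_right)
      also have "\<dots> \<le> (LINT x:K|lebesgue. M * \<theta> t)"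
      proof (rule set_integral_mono)
        show "set_integrable lebesgue K (\<lambda>x. M * \<theta> t)"
          by (rule set_integrable_continuous_compact[OF K(1)]) simp
        show "set_integrable lebesgue K (\<lambda>x. (- \<nu> * \<theta> t) * dir_deriv (Du t x) \<xi> x - norm (Du t x) powr q * \<phi> (x, t))"
          by (rule set_integral_diff(1)[OF set_integrable_mult_right[OF ddi] i2K])
        show "(- \<nu> * \<theta> t) * dir_deriv (Du t x) \<xi> x - norm (Du t x) powr q * \<phi> (x, t) \<le> M * \<theta> t" for x
          using mult_right_mono[OF young[of "Du t x" x] \<theta>(2)[of t]] by (simp add: \<phi>_def algebra_simps)
      qed
      also have "\<dots> = M * \<theta> t * measure lebesgue K"
        using lmeasurable_compact[OF K(1)] by (simp add: set_lebesgue_integral_def fmeasurable_def)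
      finally show ?thesis using t I1 by (simp add: algebra_simps)
    qed simp
  qed
  have gc: "continuous_on (open_time T) ?g"
  proof -
    have "continuous_on (K \<times> open_time T) (\<lambda>z::'a \<times> real. \<xi> (fst z))"
      by (rule continuous_on_subset[OF smooth_on_continuous[OF smooth_on_fst[OF \<xi>(1)]] subset_UNIV])
    from pairing_continuous[OF u_cont K(1,2) order_refl this] show ?thesis by simp
  qed
  have fin: "set_integrable lebesgue (open_time T) (\<lambda>t. dir_deriv 1 \<theta> t * ?g t + M * measure lebesgue K * \<theta> t)"
  proof -
    have "set_integrable lebesgue I (\<lambda>t. dir_deriv 1 \<theta> t * ?g t + M * measure lebesgue K * \<theta> t)"
      by (intro set_integrable_continuous_compact[OF I(1)] continuous_intros continuous_on_subset[OF gc I(2)]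
          continuous_on_subset[OF smooth_on_continuous[OF s\<theta>]]
          continuous_on_subset[OF smooth_on_continuous[OF smooth_on_dir_deriv[OF open_UNIV s\<theta>]]]) auto
    then show ?thesis
      using set_integral_support(2)[OF I(2), of "\<lambda>t. dir_deriv 1 \<theta> t * ?g t + M * measure lebesgue K * \<theta> t" lebesgue]
      by (simp add: d\<theta>z \<theta>z)
  qed
  have "0 = (LINT t:open_time T|lebesgue. ?I1 t - ?I2 t)"
    using set_integral_diff(2)[OF weak_form_split(1,2)[OF \<phi>]] weak_form_split(3)[OF \<phi>] by simp
  also have "\<dots> \<le> (LINT t:open_time T|lebesgue. dir_deriv 1 \<theta> t * ?g t + M * measure lebesgue K * \<theta> t)"
    unfolding set_lebesgue_integral_def[of _ "open_time T"]
    using set_integral_diff(1)[OF weak_form_split(1,2)[OF \<phi>]] fin ae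
    by (intro integral_mono_AE) (simp_all add: set_integrable_def)
  finally show ?thesis by (simp add: M_def)
qed

end

section \<open>The backward heat kernel\<close>

text \<open>The heat kernel at time \<open>r\<close>, up to the factor \<open>(4 \<pi> \<nu>)\<^bsup>-N/2\<^esup>\<close> that would normalize its integral.\<close>
definition heat_kernel :: "real \<Rightarrow> real \<Rightarrow> 'a::euclidean_space \<Rightarrow> real" where
  "heat_kernel \<nu> r z = r powr (- (real DIM('a) / 2)) * exp (- (norm z)\<^sup>2 / (4 * \<nu> * r))"

lemma heat_kernel_nonneg: "0 \<le> heat_kernel \<nu> r z"
  by (simp add: heat_kernel_def)

lemma open_snd_less: "open {z :: 'a::euclidean_space \<times> real. snd z < \<sigma>}"
  by (intro open_Collect_less continuous_intros)

definition backward_kernel :: "real \<Rightarrow> real \<Rightarrow> 'a::euclidean_space \<Rightarrow> 'a \<times> real \<Rightarrow> real" where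
  "backward_kernel \<nu> \<sigma> x z = heat_kernel \<nu> (\<sigma> - snd z) (fst z - x)"

lemma smooth_on_backward_kernel:
  fixes x :: "'a::euclidean_space"
  shows "smooth_on {z. snd z < \<sigma>} (backward_kernel \<nu> \<sigma> x)"
proof -
  let ?U = "{z :: 'a \<times> real. snd z < \<sigma>}"
  define r where "r z = \<sigma> + (- 1) * (z \<bullet> (0, 1))" for z :: "'a \<times> real"
  define n where "n z = (\<Sum>b\<in>Basis. (z \<bullet> (b, 0) + (- (x \<bullet> b)))^2)" for z :: "'a \<times> real"
  have r: "r z = \<sigma> - snd z" for z by (simp add: r_def inner_prod_def)
  have n: "n z = (norm (fst z - x))\<^sup>2" for z
    unfolding n_def power2_norm_eq_inner euclidean_inner[of "fst z - x" "fst z - x"]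
    by (simp add: inner_prod_def inner_diff_left power2_eq_square)
  note op = open_snd_less[of \<sigma>, where 'a = 'a]
  have sr: "smooth_on ?U r"
    unfolding r_def by (intro smooth_on_add smooth_on_mult smooth_on_const smooth_on_inner op)
  have sn: "smooth_on ?U n"
    unfolding n_def by (intro smooth_on_sum smooth_on_power smooth_on_add smooth_on_const smooth_on_inner op)
  have sp: "smooth_on ?U (\<lambda>z. r z powr a)" for a
    by (rule smooth_on_compose[OF op sr smooth_on_powr]) (auto simp: r)
  have "smooth_on ?U (\<lambda>z. (- (1 / (4 * \<nu>))) * (n z * r z powr (- 1)))"
    by (intro smooth_on_mult smooth_on_const op sn sp)
  then have se: "smooth_on ?U (\<lambda>z. exp ((- (1 / (4 * \<nu>))) * (n z * r z powr (- 1))))"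
    by (rule smooth_on_compose[OF op _ smooth_on_exp]) simp
  have "smooth_on ?U (\<lambda>z. r z powr (- (real DIM('a) / 2)) * exp ((- (1 / (4 * \<nu>))) * (n z * r z powr (- 1))))"
    by (rule smooth_on_mult[OF op sp se])
  moreover have "backward_kernel \<nu> \<sigma> x z = r z powr (- (real DIM('a) / 2)) * exp ((- (1 / (4 * \<nu>))) * (n z * r z powr (- 1)))"
    if "z \<in> ?U" for z
  proof -
    have "r z powr (- 1) = 1 / r z" using that by (simp add: r powr_minus_divide)
    then show ?thesis by (simp add: backward_kernel_def heat_kernel_def r n)
  qed
  ultimately show ?thesis by (rule smooth_on_cong[OF op, THEN iffD2, rotated])
qed

text \<open>Along a spatial line the kernel is a one-dimensional Gaussian.\<close>
lemma backward_kernel_line: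
  fixes x b :: "'a::euclidean_space"
  shows "backward_kernel \<nu> \<sigma> x (z + s *\<^sub>R (b, 0)) = (\<sigma> - snd z) powr (- (real DIM('a) / 2)) *
    exp (- ((norm (fst z - x))\<^sup>2 + 2 * s * ((fst z - x) \<bullet> b) + s\<^sup>2 * (norm b)\<^sup>2) / (4 * \<nu> * (\<sigma> - snd z)))"
proof -
  have "norm (fst z + s *\<^sub>R b - x) ^ 2 = (norm (fst z - x))\<^sup>2 + 2 * s * ((fst z - x) \<bullet> b) + s\<^sup>2 * (norm b)\<^sup>2"
    unfolding power2_norm_eq_inner by (simp add: algebra_simps inner_commute power2_eq_square)
  then show ?thesis by (simp add: backward_kernel_def heat_kernel_def)
qed

lemma backward_kernel_time_deriv:
  fixes x :: "'a::euclidean_space"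
  assumes "0 < \<nu>" "snd z < \<sigma>"
  shows "dir_deriv (0, 1) (backward_kernel \<nu> \<sigma> x) z = backward_kernel \<nu> \<sigma> x z *
    (real DIM('a) / 2 / (\<sigma> - snd z) - (norm (fst z - x))\<^sup>2 / (4 * \<nu> * (\<sigma> - snd z)\<^sup>2))"
proof -
  define r where "r = \<sigma> - snd z"
  define n where "n = (norm (fst z - x))\<^sup>2"
  define a where "a = real DIM('a) / 2"
  have r: "r > 0" using assms by (simp add: r_def)
  have k: "backward_kernel \<nu> \<sigma> x z = r powr (- a) * exp (- n / (4 * \<nu> * r))"
    by (simp add: backward_kernel_def heat_kernel_def r_def n_def a_def)
  have 1: "((\<lambda>s. (r - s) powr (- a)) has_real_derivative r powr (- a) * (a / r)) (at 0)"
    using r by (auto intro!: derivative_eq_intros simp: powr_diff)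
  have 2: "((\<lambda>s. - n / (4 * \<nu> * (r - s))) has_real_derivative - n / (4 * \<nu> * r\<^sup>2)) (at 0)"
    using r assms by (auto intro!: derivative_eq_intros simp: power2_eq_square field_simps)
  have "((\<lambda>s. (r - s) powr (- a) * exp (- n / (4 * \<nu> * (r - s)))) has_real_derivative
      backward_kernel \<nu> \<sigma> x z * (a / r - n / (4 * \<nu> * r\<^sup>2))) (at 0)"
    unfolding k by (rule DERIV_cong[OF DERIV_mult[OF 1 DERIV_fun_exp[OF 2]]]) (simp add: algebra_simps)
  then show ?thesis
    unfolding r_def[symmetric] n_def[symmetric] a_def[symmetric]
    by (intro dir_deriv_line smooth_on_differentiable[OF smooth_on_backward_kernel])
      (use assms in \<open>simp_all add: backward_kernel_def heat_kernel_def r_def n_def a_def algebra_simps\<close>)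
qed

lemma DERIV_gaussian_line:
  fixes c n p m d :: real
  shows "((\<lambda>s. c * exp (- (n + 2 * s * p + s\<^sup>2 * m) / d)) has_real_derivative c * exp (- n / d) * (- (2 * p) / d)) (at 0)"
proof -
  have "((\<lambda>s. - (n + 2 * s * p + s\<^sup>2 * m) / d) has_real_derivative - (2 * p) / d) (at 0)"
    by (rule DERIV_cong[OF DERIV_cdivide]) (auto intro!: derivative_eq_intros)
  then show ?thesis by (intro DERIV_cong[OF DERIV_cmult[OF DERIV_fun_exp]]) (auto simp: mult.assoc)
qed

lemma backward_kernel_line_deriv:
  assumes "0 < \<nu>" "snd z < \<sigma>"
  shows "((\<lambda>s. backward_kernel \<nu> \<sigma> x (z + s *\<^sub>R (b, 0))) has_real_derivative
      backward_kernel \<nu> \<sigma> x z * (- ((fst z - x) \<bullet> b) / (2 * \<nu> * (\<sigma> - snd z)))) (at 0)"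
  unfolding backward_kernel_line
  by (rule DERIV_cong[OF DERIV_gaussian_line]) (simp add: backward_kernel_def heat_kernel_def)

lemma backward_kernel_space_deriv:
  assumes "0 < \<nu>" "snd z < \<sigma>"
  shows "dir_deriv (b, 0) (backward_kernel \<nu> \<sigma> x) z
    = backward_kernel \<nu> \<sigma> x z * (- ((fst z - x) \<bullet> b) / (2 * \<nu> * (\<sigma> - snd z)))"
proof (rule dir_deriv_line)
  show "backward_kernel \<nu> \<sigma> x differentiable at z"
    by (rule smooth_on_differentiable[OF smooth_on_backward_kernel]) (use assms in simp)
  show "((\<lambda>s. backward_kernel \<nu> \<sigma> x (z + s *\<^sub>R (b, 0))) has_real_derivative
      backward_kernel \<nu> \<sigma> x z * (- ((fst z - x) \<bullet> b) / (2 * \<nu> * (\<sigma> - snd z)))) (at 0)"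
    by (rule backward_kernel_line_deriv[OF assms])
qed

lemma backward_kernel_space_deriv2:
  assumes "0 < \<nu>" "snd z < \<sigma>" "norm b = 1"
  shows "dir_deriv (b, 0) (dir_deriv (b, 0) (backward_kernel \<nu> \<sigma> x)) z = backward_kernel \<nu> \<sigma> x z *
    ((((fst z - x) \<bullet> b) / (2 * \<nu> * (\<sigma> - snd z)))\<^sup>2 - 1 / (2 * \<nu> * (\<sigma> - snd z)))"
proof (rule dir_deriv_line)
  show "dir_deriv (b, 0) (backward_kernel \<nu> \<sigma> x) differentiable at z"
    by (rule smooth_on_differentiable[OF smooth_on_dir_deriv[OF open_snd_less smooth_on_backward_kernel]])
      (use assms in simp)
  define r p where "r = \<sigma> - snd z" and "p = (fst z - x) \<bullet> b"
  have r: "r > 0" using assms by (simp add: r_def)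
  have bb: "b \<bullet> b = 1" using assms(3) by (simp add: norm_eq_1)
  have "dir_deriv (b, 0) (backward_kernel \<nu> \<sigma> x) (z + s *\<^sub>R (b, 0))
      = backward_kernel \<nu> \<sigma> x (z + s *\<^sub>R (b, 0)) * (- (p + s) / (2 * \<nu> * r))" for s
    using backward_kernel_space_deriv[of \<nu> "z + s *\<^sub>R (b, 0)" \<sigma> b x] assms bb
    by (simp add: r_def p_def inner_diff_left inner_add_left algebra_simps)
  moreover
  have 1: "((\<lambda>s. backward_kernel \<nu> \<sigma> x (z + s *\<^sub>R (b, 0))) has_real_derivative
      backward_kernel \<nu> \<sigma> x z * (- p / (2 * \<nu> * r))) (at 0)"
    unfolding r_def p_def by (rule backward_kernel_line_deriv[OF assms(1,2)])
  have 2: "((\<lambda>s. - (p + s) / (2 * \<nu> * r)) has_real_derivative - 1 / (2 * \<nu> * r)) (at 0)"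
    using assms r by (auto intro!: derivative_eq_intros simp: field_simps)
  have "((\<lambda>s. backward_kernel \<nu> \<sigma> x (z + s *\<^sub>R (b, 0)) * (- (p + s) / (2 * \<nu> * r))) has_real_derivative
      backward_kernel \<nu> \<sigma> x z * ((p / (2 * \<nu> * r))\<^sup>2 - 1 / (2 * \<nu> * r))) (at 0)"
    by (rule DERIV_cong[OF DERIV_mult[OF 1 2]]) (simp add: algebra_simps power2_eq_square zero_prod_def[symmetric])
  ultimately show "((\<lambda>s. dir_deriv (b, 0) (backward_kernel \<nu> \<sigma> x) (z + s *\<^sub>R (b, 0))) has_real_derivative
      backward_kernel \<nu> \<sigma> x z * ((((fst z - x) \<bullet> b) / (2 * \<nu> * (\<sigma> - snd z)))\<^sup>2 - 1 / (2 * \<nu> * (\<sigma> - snd z)))) (at 0)"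
    by (simp add: r_def p_def)
qed

lemma heat_op_backward_kernel:
  fixes x :: "'a::euclidean_space"
  assumes "0 < \<nu>" "snd z < \<sigma>"
  shows "heat_op \<nu> (backward_kernel \<nu> \<sigma> x) z = 0"
proof -
  define k r where "k = backward_kernel \<nu> \<sigma> x z" and "r = \<sigma> - snd z"
  have r: "r > 0" using assms by (simp add: r_def)
  have "space_laplacian (backward_kernel \<nu> \<sigma> x) z
      = (\<Sum>b\<in>Basis. k * ((((fst z - x) \<bullet> b) / (2 * \<nu> * r))\<^sup>2 - 1 / (2 * \<nu> * r)))"
    unfolding space_laplacian_def k_def r_def
    by (intro sum.cong refl backward_kernel_space_deriv2 assms norm_Basis)
  also have "\<dots> = k * ((\<Sum>b\<in>Basis. ((fst z - x) \<bullet> b)\<^sup>2) / (2 * \<nu> * r)\<^sup>2 - real DIM('a) / (2 * \<nu> * r))"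
    by (simp add: sum_distrib_left[symmetric] sum_subtractf power_divide sum_divide_distrib[symmetric])
  also have "(\<Sum>b\<in>Basis. ((fst z - x) \<bullet> b)\<^sup>2) = (norm (fst z - x))\<^sup>2"
    unfolding power2_norm_eq_inner euclidean_inner[of "fst z - x" "fst z - x"] by (simp add: power2_eq_square)
  finally show ?thesis
    unfolding heat_op_def time_deriv_def backward_kernel_time_deriv[OF assms] k_def[symmetric] r_def[symmetric]
    using assms(1) r by (simp add: field_simps power2_eq_square)
qed

lemma heat_op_mult:
  assumes U: "open U" "z \<in> U" and f: "smooth_on U f" and g: "smooth_on U g"
  shows "heat_op \<nu> (\<lambda>z. f z * g z) z = f z * heat_op \<nu> g z + g z * heat_op \<nu> f z
    + 2 * \<nu> * (\<Sum>b\<in>Basis. dir_deriv (b, 0) f z * dir_deriv (b, 0) g z)"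
proof -
  note df = smooth_on_differentiable[OF f] and dg = smooth_on_differentiable[OF g]
  have d1: "dir_deriv v (\<lambda>z. f z * g z) z = f z * dir_deriv v g z + dir_deriv v f z * g z" if "z \<in> U" for v z
    by (rule dir_deriv_mult[OF df[OF that] dg[OF that]])
  have d2: "dir_deriv v (dir_deriv v (\<lambda>z. f z * g z)) z
      = f z * dir_deriv v (dir_deriv v g) z + g z * dir_deriv v (dir_deriv v f) z + 2 * (dir_deriv v f z * dir_deriv v g z)" for v
  proof -
    note df' = smooth_on_differentiable[OF smooth_on_dir_deriv[OF U(1) f, of v] U(2)]
      and dg' = smooth_on_differentiable[OF smooth_on_dir_deriv[OF U(1) g, of v] U(2)]
    have "dir_deriv v (dir_deriv v (\<lambda>z. f z * g z)) z
        = dir_deriv v (\<lambda>z. f z * dir_deriv v g z + dir_deriv v f z * g z) z"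
      by (rule dir_deriv_cong(2)[OF U(1) d1 U(2)])
    also have "\<dots> = dir_deriv v (\<lambda>z. f z * dir_deriv v g z) z + dir_deriv v (\<lambda>z. dir_deriv v f z * g z) z"
      by (rule dir_deriv_add) (intro differentiable_mult df[OF U(2)] dg[OF U(2)] df' dg')+
    finally show ?thesis
      using dir_deriv_mult[OF df[OF U(2)] dg', of v] dir_deriv_mult[OF df' dg[OF U(2)], of v]
      by (simp add: algebra_simps)
  qed
  show ?thesis
    unfolding heat_op_def time_deriv_def space_laplacian_def d1[OF U(2)] d2 sum.distrib sum_distrib_left[symmetric]
    by (simp add: algebra_simps)
qed

text \<open>By the Leibniz rule, multiplying a solution of the backward heat equation by a cutoff leaves
  only terms with derivatives of the cutoff.\<close>
lemma heat_op_cutoff_kernel: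
  fixes x :: "'a::euclidean_space"
  assumes "0 < \<nu>" "snd z < \<sigma>" and \<phi>: "smooth_on UNIV \<phi>"
  shows "heat_op \<nu> (\<lambda>z. \<phi> (fst z) * backward_kernel \<nu> \<sigma> x z) z = backward_kernel \<nu> \<sigma> x z *
    (\<nu> * (\<Sum>b\<in>Basis. dir_deriv b (dir_deriv b \<phi>) (fst z)) - dir_deriv (fst z - x) \<phi> (fst z) / (\<sigma> - snd z))"
proof -
  let ?k = "backward_kernel \<nu> \<sigma> x" and ?U = "{z :: 'a \<times> real. snd z < \<sigma>}"
  have z: "z \<in> ?U" using assms by simp
  have \<phi>': "smooth_on UNIV (dir_deriv b \<phi>)" for b by (rule smooth_on_dir_deriv[OF open_UNIV \<phi>])
  have df: "dir_deriv w (\<lambda>z. \<phi> (fst z)) = (\<lambda>z. dir_deriv (fst w) \<phi> (fst z))" for w :: "'a \<times> real"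
    by (rule ext) (rule dir_deriv_fst[OF \<phi>])
  have df2: "dir_deriv w (\<lambda>z. dir_deriv b \<phi> (fst z)) = (\<lambda>z. dir_deriv (fst w) (dir_deriv b \<phi>) (fst z))" for w :: "'a \<times> real" and b
    by (rule ext) (rule dir_deriv_fst[OF \<phi>'])
  have t0: "dir_deriv 0 \<phi> y = 0" for y by (rule dir_deriv_direction_0[OF smooth_on_differentiable[OF \<phi> UNIV_I]])
  have "heat_op \<nu> (\<lambda>z. \<phi> (fst z)) z = \<nu> * (\<Sum>b\<in>Basis. dir_deriv b (dir_deriv b \<phi>) (fst z))"
    by (simp add: heat_op_def time_deriv_def space_laplacian_def df df2 t0)
  moreover have "(\<Sum>b\<in>Basis. dir_deriv (b, 0) (\<lambda>z. \<phi> (fst z)) z * dir_deriv (b, 0) ?k z)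
      = - (?k z / (2 * \<nu> * (\<sigma> - snd z))) * dir_deriv (fst z - x) \<phi> (fst z)"
    unfolding df backward_kernel_space_deriv[OF assms(1,2)]
      dir_deriv_linear[OF smooth_on_differentiable[OF \<phi> UNIV_I], of "fst z - x"] sum_distrib_left
    by (intro sum.cong) (simp_all add: field_simps)
  ultimately have "heat_op \<nu> (\<lambda>z. \<phi> (fst z) * ?k z) z = ?k z * (\<nu> * (\<Sum>b\<in>Basis. dir_deriv b (dir_deriv b \<phi>) (fst z)))
      + 2 * \<nu> * (- (?k z / (2 * \<nu> * (\<sigma> - snd z))) * dir_deriv (fst z - x) \<phi> (fst z))"
    using heat_op_mult[OF open_snd_less z smooth_on_subset[OF smooth_on_fst[OF \<phi>] subset_UNIV] smooth_on_backward_kernel, of \<nu> \<nu> x]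
      heat_op_backward_kernel[OF assms(1,2), of x] by simp
  also have "2 * \<nu> * (- (?k z / (2 * \<nu> * (\<sigma> - snd z))) * dir_deriv (fst z - x) \<phi> (fst z))
      = - (?k z * (dir_deriv (fst z - x) \<phi> (fst z) / (\<sigma> - snd z)))"
    using assms(1) by simp
  finally show ?thesis by (simp add: right_diff_distrib)
qed

text \<open>The logarithm \<open>- a ln r - c / r\<close> of the left-hand side is estimated by \<open>ln y \<le> y\<close> with
  \<open>y = c / (a r)\<close>.\<close>
lemma powr_exp_bounded:
  fixes a c :: real
  assumes "0 < a" "0 < c"
  shows "\<exists>C\<ge>0. \<forall>r>0. r powr (- a) * exp (- c / r) \<le> C"
proof (intro exI[of _ "exp (a * ln (a / c))"] conjI allI impI)
  fix r :: real assume r: "0 < r"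
  have "ln (c / (a * r)) \<le> c / (a * r)"
    using ln_le_minus_one[of "c / (a * r)"] assms r by simp
  then have "a * ln (c / (a * r)) \<le> a * (c / (a * r))" using assms by (intro mult_left_mono) auto
  then have "a * ln (c / (a * r)) \<le> c / r" using assms r by simp
  moreover have "ln (c / (a * r)) = - ln (a / c) - ln r"
    using assms r by (simp add: ln_div ln_mult)
  ultimately have "- a * ln r - c / r \<le> a * ln (a / c)" by (simp add: algebra_simps)
  then show "r powr (- a) * exp (- c / r) \<le> exp (a * ln (a / c))"
    using r by (simp add: powr_def exp_add[symmetric])
qed simp

text \<open>The commutator of the cutoff with the heat operator is supported where the cutoff is not
  constant, hence away from the pole of the kernel, where the kernel and its gradient stay
  bounded as time approaches the pole.\<close>
lemma heat_kernel_flux_bound: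
  fixes \<phi> :: "'a::euclidean_space \<Rightarrow> real"
  assumes \<nu>: "0 < \<nu>" and "r0 < r1" "r1 < r2" and \<phi>: "smooth_on UNIV \<phi>"
    and one: "\<And>y. norm y \<le> r1 \<Longrightarrow> \<phi> y = 1" and zero: "\<And>y. r2 \<le> norm y \<Longrightarrow> \<phi> y = 0"
  shows "\<exists>B\<ge>0. \<forall>x y r. norm x \<le> r0 \<longrightarrow> 0 < r \<longrightarrow>
    \<bar>heat_kernel \<nu> r (y - x) * (\<nu> * (\<Sum>b\<in>Basis. dir_deriv b (dir_deriv b \<phi>) y) - dir_deriv (y - x) \<phi> y / r)\<bar> \<le> B"
proof (cases "0 \<le> r0")
  case False
  then show ?thesis by (intro exI[of _ 0]) (auto dest: order_trans[OF norm_ge_zero])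
next
  case r0: True
  define lap where "lap y = (\<Sum>b\<in>Basis. dir_deriv b (dir_deriv b \<phi>) y)" for y
  have \<phi>': "smooth_on UNIV (dir_deriv b \<phi>)" for b by (rule smooth_on_dir_deriv[OF open_UNIV \<phi>])
  have lap: "smooth_on UNIV lap"
    unfolding lap_def by (intro smooth_on_sum smooth_on_dir_deriv[OF open_UNIV \<phi>'] open_UNIV)
  define U where "U = {y :: 'a. norm y < r1} \<union> {y. r2 < norm y}"
  have U: "open U" unfolding U_def by (intro open_Un open_Collect_less continuous_intros)
  have d0: "dir_deriv b \<phi> y = 0" if "y \<in> U" for y b
    using that unfolding U_def
  proof
    assume y: "y \<in> {y. norm y < r1}"
    have "dir_deriv b \<phi> y = dir_deriv b (\<lambda>_. 1) y"
      by (rule dir_deriv_cong(2)[OF _ _ y]) (auto intro!: open_Collect_less continuous_intros simp: one)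
    then show ?thesis by simp
  next
    assume y: "y \<in> {y. r2 < norm y}"
    show ?thesis
      by (rule dir_deriv_zero_on_open[OF _ _ y]) (auto intro!: open_Collect_less continuous_intros simp: zero)
  qed
  have lap0: "lap y = 0" if "y \<in> U" for y
    unfolding lap_def using dir_deriv_zero_on_open[OF U d0 that] by simp
  have out: "y \<in> U" if "y \<notin> cball 0 r2" for y using that by (auto simp: U_def)
  obtain A1 where A1: "0 \<le> A1" "\<And>y. \<bar>lap y\<bar> \<le> A1"
    by (rule continuous_compact_support_bounded[OF smooth_on_continuous[OF lap] compact_cball, of 0 r2])
      (use lap0 out in blast)+
  have supp: "\<phi> y = 0" if "y \<notin> cball 0 r2" for y using that by (intro zero) simp
  obtain A2 where A2: "0 \<le> A2" and grad: "\<And>v y. \<bar>dir_deriv v \<phi> y\<bar> \<le> A2 * norm v"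
    using smooth_compact_support_gradient_bound[OF \<phi> compact_cball supp] by blast
  define d where "d = r1 - r0"
  define a where "a = real DIM('a) / 2"
  have d: "0 < d" and a: "0 < a" using assms by (auto simp: d_def a_def)
  define c where "c = d\<^sup>2 / (4 * \<nu>)"
  have c: "0 < c" using d \<nu> by (simp add: c_def)
  obtain C1 where C1: "0 \<le> C1" "\<And>r. 0 < r \<Longrightarrow> r powr (- a) * exp (- c / r) \<le> C1"
    using powr_exp_bounded[OF a c] by auto
  obtain C2 where C2: "0 \<le> C2" "\<And>r. 0 < r \<Longrightarrow> r powr (- (a + 1)) * exp (- c / r) \<le> C2"
    using powr_exp_bounded[of "a + 1" c] a c by auto
  define B where "B = C1 * (\<nu> * A1) + C2 * (A2 * (r2 + r0))"
  have B0: "0 \<le> B" using A1 A2 C1 C2 \<nu> r0 assms by (simp add: B_def)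
  show ?thesis
    unfolding lap_def[symmetric]
  proof (intro exI[of _ B] conjI B0 allI impI)
    fix x y :: 'a and r :: real assume x: "norm x \<le> r0" and r: "0 < r"
    show "\<bar>heat_kernel \<nu> r (y - x) * (\<nu> * lap y - dir_deriv (y - x) \<phi> y / r)\<bar> \<le> B"
    proof (cases "y \<in> U")
      case True
      then show ?thesis using lap0 d0 B0 by simp
    next
      case False
      then have y: "r1 \<le> norm y" "norm y \<le> r2" by (auto simp: U_def)
      have dist: "d \<le> norm (y - x)" using norm_triangle_ineq2[of y x] x y by (simp add: d_def)
      have dist2: "norm (y - x) \<le> r2 + r0" using norm_triangle_ineq4[of y x] x y by simp
      have "d\<^sup>2 \<le> (norm (y - x))\<^sup>2" using dist d by (simp add: power_mono)
      then have "- (norm (y - x))\<^sup>2 / (4 * \<nu> * r) \<le> - c / r"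
        using \<nu> r by (simp add: c_def divide_right_mono)
      then have k: "heat_kernel \<nu> r (y - x) \<le> r powr (- a) * exp (- c / r)"
        by (simp add: heat_kernel_def a_def mult_left_mono)
      have "\<bar>heat_kernel \<nu> r (y - x) * (\<nu> * lap y - dir_deriv (y - x) \<phi> y / r)\<bar>
          \<le> heat_kernel \<nu> r (y - x) * (\<nu> * A1 + A2 * (r2 + r0) / r)"
      proof -
        have "\<bar>\<nu> * lap y - dir_deriv (y - x) \<phi> y / r\<bar> \<le> \<nu> * \<bar>lap y\<bar> + \<bar>dir_deriv (y - x) \<phi> y\<bar> / r"
          using \<nu> r by (intro order_trans[OF abs_triangle_ineq4]) (simp add: abs_mult)
        also have "\<dots> \<le> \<nu> * A1 + A2 * (r2 + r0) / r"
          using \<nu> r A1(2)[of y] order_trans[OF grad mult_left_mono[OF dist2 A2], of y]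
          by (intro add_mono mult_left_mono divide_right_mono) auto
        finally show ?thesis
          by (simp add: abs_mult heat_kernel_nonneg mult_left_mono)
      qed
      also have "\<dots> \<le> (r powr (- a) * exp (- c / r)) * (\<nu> * A1 + A2 * (r2 + r0) / r)"
        using \<nu> r A1 A2 r0 assms by (intro mult_right_mono k) auto
      also have "\<dots> = (r powr (- a) * exp (- c / r)) * (\<nu> * A1) + (r powr (- (a + 1)) * exp (- c / r)) * (A2 * (r2 + r0))"
      proof -
        have "r powr (- (a + 1)) = r powr (- a) / r" using r by (simp add: powr_diff powr_minus)
        then show ?thesis by (simp add: algebra_simps)
      qed
      also have "\<dots> \<le> B"
        unfolding B_def using \<nu> A1 A2 r0 assms C1(2)[OF r] C2(2)[OF r] by (intro add_mono mult_right_mono) auto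
      finally show ?thesis .
    qed
  qed
qed

text \<open>The trace is described by test functions that do not depend on time. This inequality replaces the
  moving kernel by a fixed one, up to a factor that tends to \<open>1\<close> as \<open>s\<close> tends to \<open>0\<close>.\<close>
lemma heat_kernel_earlier_le:
  assumes "0 < \<nu>" "0 \<le> s" "s < \<sigma>"
  shows "heat_kernel \<nu> (\<sigma> - s) (z :: 'a::euclidean_space)
    \<le> (\<sigma> / (\<sigma> - s)) powr (real DIM('a) / 2) * heat_kernel \<nu> \<sigma> z"
proof -
  have "(norm z)\<^sup>2 / (4 * \<nu> * \<sigma>) \<le> (norm z)\<^sup>2 / (4 * \<nu> * (\<sigma> - s))"
    using assms by (intro divide_left_mono mult_left_mono mult_pos_pos) auto
  then have "heat_kernel \<nu> (\<sigma> - s) z \<le> (\<sigma> - s) powr (- (real DIM('a) / 2)) * exp (- (norm z)\<^sup>2 / (4 * \<nu> * \<sigma>))"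
    by (simp add: heat_kernel_def mult_left_mono)
  also have "(\<sigma> - s) powr (- (real DIM('a) / 2)) = (\<sigma> / (\<sigma> - s)) powr (real DIM('a) / 2) * \<sigma> powr (- (real DIM('a) / 2))"
    using assms by (simp add: powr_divide powr_minus field_simps)
  finally show ?thesis by (simp add: heat_kernel_def mult.assoc)
qed

section \<open>Local estimates\<close>

lemma heat_op_mult_time:
  fixes \<psi> :: "'a::euclidean_space \<times> real \<Rightarrow> real"
  assumes U: "open U" "z \<in> U" and \<theta>: "smooth_on UNIV \<theta>" and \<psi>: "smooth_on U \<psi>"
  shows "heat_op \<nu> (\<lambda>z. \<theta> (snd z) * \<psi> z) z = \<theta> (snd z) * heat_op \<nu> \<psi> z + dir_deriv 1 \<theta> (snd z) * \<psi> z"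
proof -
  have df: "dir_deriv w (\<lambda>z. \<theta> (snd z)) = (\<lambda>z. dir_deriv (snd w) \<theta> (snd z))" for w :: "'a \<times> real"
    by (rule ext) (rule dir_deriv_snd[OF \<theta>])
  have t0: "dir_deriv 0 \<theta> y = 0" for y by (rule dir_deriv_direction_0[OF smooth_on_differentiable[OF \<theta> UNIV_I]])
  have "heat_op \<nu> (\<lambda>z. \<theta> (snd z)) z = dir_deriv 1 \<theta> (snd z)"
    by (simp add: heat_op_def time_deriv_def space_laplacian_def df t0)
  then show ?thesis
    using heat_op_mult[OF U smooth_on_subset[OF smooth_on_snd[OF \<theta>] subset_UNIV] \<psi>, of \<nu>]
    by (simp add: df t0)
qed

context weak_solution
begin

lemma u_nonneg_weighted:
  assumes "t \<in> open_time T" "compact K" "K \<subseteq> \<Omega>" "\<And>x. f x \<le> g x"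
    "set_integrable lebesgue K (\<lambda>x. u t x * f x)" "set_integrable lebesgue K (\<lambda>x. u t x * g x)"
  shows "(LINT x:K|lebesgue. u t x * f x) \<le> (LINT x:K|lebesgue. u t x * g x)"
  unfolding set_lebesgue_integral_def
proof (rule integral_mono_AE)
  show "AE x in lebesgue. indicat_real K x *\<^sub>R (u t x * f x) \<le> indicat_real K x *\<^sub>R (u t x * g x)"
    using u_nonneg_slice[OF assms(1-3)]
    by eventually_elim (auto simp: indicator_def assms(4) mult_left_mono)
qed (use assms(5,6) in \<open>simp_all add: set_integrable_def\<close>)

text \<open>The increment of the mass between \<open>s\<close> and \<open>t\<close> is bounded by a constant times \<open>t - s\<close>; letting \<open>s\<close> tend
  to \<open>0\<close> replaces the earlier mass by that of the trace.\<close>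
lemma local_mass_bound:
  assumes q: "1 < q" and \<nu>: "0 < \<nu>"
    and \<xi>: "smooth_on UNIV \<xi>" "\<And>y. 0 \<le> \<xi> y" and L: "0 \<le> L" "\<And>y v. \<bar>dir_deriv v \<xi> y\<bar> \<le> L * norm v * \<xi> y powr (1 / q)"
    and K: "compact K" "K \<subseteq> \<Omega>" "\<And>y. y \<notin> K \<Longrightarrow> \<xi> y = 0"
    and tr: "((\<lambda>t. LINT x:\<Omega>|lebesgue. u t x * \<xi> x) \<longlongrightarrow> \<Lambda>) (at_right 0)"
    and t: "t \<in> open_time T"
  shows "(LINT x:K|lebesgue. u t x * \<xi> x) \<le> \<Lambda> + (\<nu> * L) powr (q / (q - 1)) * measure lebesgue K * t"
proof -
  define M where "M = (\<nu> * L) powr (q / (q - 1)) * measure lebesgue K"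
  define g where "g s = (LINT x:K|lebesgue. u s x * \<xi> x)" for s
  have M: "0 \<le> M" by (simp add: M_def)
  have t0: "0 < t" using t by (simp add: open_time_def)
  obtain \<beta> where \<beta>: "t < \<beta>" "{0<..<\<beta>} \<subseteq> open_time T" using open_time_extend[OF t, of "t + 1"] by auto
  have gc: "continuous_on {0<..<\<beta>} g"
  proof -
    have "continuous_on (K \<times> {0<..<\<beta>}) (\<lambda>z::'a \<times> real. \<xi> (fst z))"
      by (rule continuous_on_subset[OF smooth_on_continuous[OF smooth_on_fst[OF \<xi>(1)]] subset_UNIV])
    from pairing_continuous[OF u_cont K(1,2) \<beta>(2) this] show ?thesis by (simp add: g_def)
  qed
  have inc: "g t \<le> g s + M * (t - s)" if "0 < s" "s < t" for s
  proof (rule weak_derivative_le_imp_increment_le[OF gc M \<beta>(2) _ that \<beta>(1)])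
    fix \<theta> assume \<theta>: "\<theta> \<in> test_functions {0<..<\<beta>}" "\<And>s. 0 \<le> \<theta> s"
    show "0 \<le> (LINT s:open_time T|lebesgue. dir_deriv 1 \<theta> s * g s + M * \<theta> s)"
      using local_mass_test[OF q \<nu> \<xi> L K test_functions_mono[OF \<theta>(1) \<beta>(2)] \<theta>(2)] by (simp add: g_def M_def)
  qed
  have "(LINT x:\<Omega>|lebesgue. u s x * \<xi> x) = g s" for s
    unfolding g_def by (rule set_integral_support(1)[OF K(2)]) (simp add: K(3))
  then have lim: "((\<lambda>s. g s + M * (t - s)) \<longlongrightarrow> \<Lambda> + M * (t - 0)) (at_right 0)"
    using tr by (intro tendsto_intros) simp_all
  have "g t \<le> \<Lambda> + M * (t - 0)"
    by (rule tendsto_lowerbound[OF lim]) (use t0 inc in \<open>auto intro!: eventually_at_rightI[of 0 t]\<close>)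
  then show ?thesis by (simp add: g_def M_def)
qed

text \<open>The pole of the kernel is put at time \<open>t + \<delta>\<close>, after \<open>t\<close>, so that the test function is smooth up to
  and beyond time \<open>t\<close>. The commutator terms are bounded by \<open>B\<close> times the mass seen by \<open>\<xi>\<close>, which has
  to be known slightly beyond \<open>t\<close>, here up to \<open>2 t\<close>, since the test functions of time extend past
  \<open>t\<close>.\<close>
lemma kernel_bound:
  assumes \<nu>: "0 < \<nu>" and \<delta>: "0 < \<delta>" and t: "t \<in> open_time T"
    and \<phi>: "smooth_on UNIV \<phi>" "\<And>y. 0 \<le> \<phi> y" and K: "compact K" "K \<subseteq> \<Omega>" "\<And>y. y \<notin> K \<Longrightarrow> \<phi> y = 0"
    and B: "0 \<le> B" and \<xi>: "continuous_on UNIV \<xi>"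
    and flux: "\<And>y r. 0 < r \<Longrightarrow> \<bar>heat_kernel \<nu> r (y - x) *
      (\<nu> * (\<Sum>b\<in>Basis. dir_deriv b (dir_deriv b \<phi>) y) - dir_deriv (y - x) \<phi> y / r)\<bar> \<le> B * \<xi> y"
    and mass: "\<And>s. s \<in> open_time T \<Longrightarrow> s < 2 * t \<Longrightarrow> (LINT y:K|lebesgue. u s y * \<xi> y) \<le> m"
    and m: "0 \<le> m"
    and tr: "((\<lambda>s. LINT y:\<Omega>|lebesgue. u s y * (\<phi> y * heat_kernel \<nu> (t + \<delta>) (y - x))) \<longlongrightarrow> \<Lambda>) (at_right 0)"
  shows "(LINT y:K|lebesgue. u t y * (\<phi> y * heat_kernel \<nu> \<delta> (y - x))) \<le> \<Lambda> + B * m * t"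
proof -
  define \<sigma> where "\<sigma> = t + \<delta>"
  define k where "k = backward_kernel \<nu> \<sigma> x"
  define \<psi> where "\<psi> z = \<phi> (fst z) * k z" for z
  define g where "g s = (LINT y:K|lebesgue. u s y * \<psi> (y, s))" for s
  have t0: "0 < t" using t by (simp add: open_time_def)
  have "t < min (2 * t) \<sigma>" using t0 \<delta> by (simp add: \<sigma>_def)
  then obtain \<beta> where \<beta>': "t < \<beta>" "\<beta> \<le> min (2 * t) \<sigma>" "{0<..<\<beta>} \<subseteq> open_time T" using open_time_extend[OF t] by metis
  then have \<beta>: "t < \<beta>" "\<beta> \<le> 2 * t" "\<beta> \<le> \<sigma>" "{0<..<\<beta>} \<subseteq> open_time T" by auto
  define U where "U = {z :: 'a \<times> real. snd z < \<sigma>}"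
  have U: "open U" unfolding U_def by (rule open_snd_less)
  have s\<psi>: "smooth_on U \<psi>"
    unfolding \<psi>_def k_def U_def
    by (intro smooth_on_mult smooth_on_backward_kernel open_snd_less smooth_on_subset[OF smooth_on_fst[OF \<phi>(1)] subset_UNIV])
  have KU: "K \<times> {0<..<\<beta>} \<subseteq> U" using \<beta>(3) by (auto simp: U_def)
  have gc: "continuous_on {0<..<\<beta>} g"
    unfolding g_def
    by (rule pairing_continuous[OF u_cont K(1,2) \<beta>(4) continuous_on_subset[OF smooth_on_continuous[OF s\<psi>] KU]])
  have h\<psi>c: "continuous_on U (heat_op \<nu> \<psi>)" by (rule smooth_on_continuous[OF smooth_on_heat_op[OF U s\<psi>]])
  have h\<psi>: "heat_op \<nu> \<psi> (y, s) \<le> B * \<xi> y" if "s < \<sigma>" for y s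
  proof -
    have "heat_op \<nu> \<psi> (y, s) \<le> \<bar>heat_op \<nu> \<psi> (y, s)\<bar>" by simp
    also have "\<dots> \<le> B * \<xi> y"
      unfolding \<psi>_def k_def using heat_op_cutoff_kernel[OF \<nu> _ \<phi>(1), of "(y, s)" \<sigma> x] flux[of "\<sigma> - s" y] that
      by (simp add: backward_kernel_def)
    finally show ?thesis .
  qed
  have h\<psi>0: "heat_op \<nu> \<psi> (y, s) = 0" if "y \<notin> K" for y s
  proof (rule heat_op_zero_on_open[of "(- K) \<times> UNIV"])
    show "open ((- K) \<times> (UNIV :: real set))" using K(1) by (simp add: compact_imp_closed open_Compl open_Times)
  qed (use that K(3) in \<open>auto simp: \<psi>_def\<close>)
  have slice: "continuous_on K (\<lambda>y. f (y, s))" if "continuous_on U f" "s < \<sigma>" for f :: "'a \<times> real \<Rightarrow> real" and s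
    by (rule continuous_on_compose2[OF that(1)]) (use that(2) in \<open>auto simp: U_def intro!: continuous_intros\<close>)
  have int: "set_integrable lebesgue K (\<lambda>y. u s y * f y)" if "continuous_on K f" "s \<in> open_time T" for f s
    by (rule set_integrable_mult_continuous[OF u_integrable[OF that(2) K(1,2)] K(1) that(1)])
  have \<xi>K: "continuous_on K (\<lambda>y. c * \<xi> y)" for c
    by (intro continuous_intros continuous_on_subset[OF \<xi>]) auto
  have hb: "(LINT y:K|lebesgue. u s y * heat_op \<nu> \<psi> (y, s)) \<le> B * m" if "s \<in> {0<..<\<beta>}" for s
  proof -
    have s: "s \<in> open_time T" "s < \<sigma>" "s < 2 * t" using that \<beta> by auto
    have "(LINT y:K|lebesgue. u s y * heat_op \<nu> \<psi> (y, s)) \<le> (LINT y:K|lebesgue. u s y * (B * \<xi> y))"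
      by (intro u_nonneg_weighted s(1) K(1,2) h\<psi> s(2) int slice h\<psi>c \<xi>K)
    also have "\<dots> = B * (LINT y:K|lebesgue. u s y * \<xi> y)" by (simp add: mult.left_commute)
    also have "\<dots> \<le> B * m" by (rule mult_left_mono[OF mass[OF s(1,3)] B])
    finally show ?thesis .
  qed
  have inc: "g t \<le> g s + B * m * (t - s)" if "0 < s" "s < t" for s
  proof (rule weak_derivative_le_imp_increment_le[OF gc _ \<beta>(4) _ that \<beta>(1)])
    show "0 \<le> B * m" using B m by simp
    fix \<theta> assume \<theta>: "\<theta> \<in> test_functions {0<..<\<beta>}" "\<And>s. 0 \<le> \<theta> s"
    define I where "I = closure {s. \<theta> s \<noteq> 0}"
    have I: "compact I" "I \<subseteq> {0<..<\<beta>}" and s\<theta>: "smooth_on UNIV \<theta>"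
      using \<theta>(1) by (auto simp: I_def test_functions_iff compactly_contained_def)
    have \<theta>z: "\<theta> s = 0" if "s \<notin> I" for s
      using that closure_subset[of "{s. \<theta> s \<noteq> 0}"] by (auto simp: I_def)
    have d\<theta>z: "dir_deriv 1 \<theta> s = 0" if "s \<notin> I" for s
      by (rule dir_deriv_zero_on_open[of "- I"]) (use that \<theta>z I in \<open>auto simp: compact_imp_closed open_Compl\<close>)
    define \<Phi> where "\<Phi> z = \<theta> (snd z) * \<psi> z" for z
    define V where "V = (UNIV :: 'a set) \<times> (- I)"
    have V: "open V" using I(1) by (simp add: V_def compact_imp_closed open_Compl open_Times)
    have \<Phi>V: "\<Phi> z = 0" if "z \<in> V" for z using that \<theta>z by (auto simp: V_def \<Phi>_def)
    have "smooth_on U \<Phi>"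
      unfolding \<Phi>_def by (intro smooth_on_mult U s\<psi> smooth_on_subset[OF smooth_on_snd[OF s\<theta>] subset_UNIV])
    moreover have "smooth_on V \<Phi>"
      using smooth_on_cong[OF V, of \<Phi> "\<lambda>_. 0"] \<Phi>V smooth_on_const by blast
    moreover have "U \<union> V = UNIV" using I(2) \<beta>(3) by (force simp: U_def V_def)
    ultimately have s\<Phi>: "smooth_on UNIV \<Phi>" using smooth_on_Un[OF U V] by metis
    have \<Phi>: "\<Phi> \<in> test_functions (Q \<Omega> T)"
    proof (rule test_functionsI[OF s\<Phi>])
      show "compact (K \<times> I)" "K \<times> I \<subseteq> Q \<Omega> T" using K I \<beta>(4) by (auto simp: Q_def compact_Times)
      show "\<Phi> z = 0" if "z \<notin> K \<times> I" for z
        using that K(3)[of "fst z"] \<theta>z[of "snd z"] by (cases z) (auto simp: \<Phi>_def \<psi>_def)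
    qed
    have \<Phi>0: "0 \<le> \<Phi> z" for z
      using \<theta>(2) \<phi>(2) by (simp add: \<Phi>_def \<psi>_def k_def backward_kernel_def heat_kernel_nonneg)
    have h\<Phi>: "heat_op \<nu> \<Phi> (y, s) = \<theta> s * heat_op \<nu> \<psi> (y, s) + dir_deriv 1 \<theta> s * \<psi> (y, s)" if "s \<in> I" for y s
    proof -
      have "(y, s) \<in> U" using that I(2) \<beta>(3) by (auto simp: U_def)
      from heat_op_mult_time[OF U this s\<theta> s\<psi>] show ?thesis by (simp add: \<Phi>_def[abs_def])
    qed
    let ?I1 = "\<lambda>s. LINT y:\<Omega>|lebesgue. u s y * heat_op \<nu> \<Phi> (y, s)"
    have le: "?I1 s \<le> dir_deriv 1 \<theta> s * g s + B * m * \<theta> s" if "s \<in> open_time T" for s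
    proof (cases "s \<in> I")
      case True
      then have s: "s \<in> {0<..<\<beta>}" "s < \<sigma>" using I(2) \<beta>(3) by auto
      have "?I1 s = (LINT y:K|lebesgue. u s y * heat_op \<nu> \<Phi> (y, s))"
        by (rule set_integral_support(1)[OF K(2)]) (simp add: h\<Phi>[OF True] h\<psi>0 K(3) \<psi>_def)
      also have "\<dots> = (LINT y:K|lebesgue. \<theta> s * (u s y * heat_op \<nu> \<psi> (y, s)) + dir_deriv 1 \<theta> s * (u s y * \<psi> (y, s)))"
        by (simp add: h\<Phi>[OF True] algebra_simps)
      also have "\<dots> = \<theta> s * (LINT y:K|lebesgue. u s y * heat_op \<nu> \<psi> (y, s)) + dir_deriv 1 \<theta> s * g s"
        unfolding g_def
        by (subst set_integral_add(2)) (auto intro!: int slice h\<psi>c smooth_on_continuous[OF s\<psi>] that s)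
      finally show ?thesis using mult_left_mono[OF hb[OF s(1)] \<theta>(2)[of s]] by (simp add: algebra_simps)
    next
      case False
      have "heat_op \<nu> \<Phi> (y, s) = 0" for y
        by (rule heat_op_zero_on_open[OF V \<Phi>V]) (use False in \<open>auto simp: V_def\<close>)
      then show ?thesis using False by (simp add: \<theta>z d\<theta>z set_lebesgue_integral_def)
    qed
    have "0 \<le> (LINT s:open_time T|lebesgue. ?I1 s)" by (rule subsolution_test[OF \<Phi> \<Phi>0])
    also have "\<dots> \<le> (LINT s:open_time T|lebesgue. dir_deriv 1 \<theta> s * g s + B * m * \<theta> s)"
    proof (rule set_integral_mono[OF weak_form_split(1)[OF \<Phi>] _ le])
      have "set_integrable lebesgue I (\<lambda>s. dir_deriv 1 \<theta> s * g s + B * m * \<theta> s)"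
        by (intro set_integrable_continuous_compact[OF I(1)] continuous_intros continuous_on_subset[OF gc I(2)]
            continuous_on_subset[OF smooth_on_continuous[OF s\<theta>]]
            continuous_on_subset[OF smooth_on_continuous[OF smooth_on_dir_deriv[OF open_UNIV s\<theta>]]]) auto
      then show "set_integrable lebesgue (open_time T) (\<lambda>s. dir_deriv 1 \<theta> s * g s + B * m * \<theta> s)"
        using set_integral_support(2)[OF order_trans[OF I(2) \<beta>(4)], of "\<lambda>s. dir_deriv 1 \<theta> s * g s + B * m * \<theta> s" lebesgue]
        by (simp add: d\<theta>z \<theta>z)
    qed
    finally show "0 \<le> (LINT s:open_time T|lebesgue. dir_deriv 1 \<theta> s * g s + B * m * \<theta> s)" .
  qed
  define a where "a = real DIM('a) / 2"
  define G where "G s = (LINT y:\<Omega>|lebesgue. u s y * (\<phi> y * heat_kernel \<nu> \<sigma> (y - x)))" for s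
  have le: "g t \<le> (\<sigma> / (\<sigma> - s)) powr a * G s + B * m * (t - s)" if s: "0 < s" "s < t" for s
  proof -
    have s': "s \<in> open_time T" "s < \<sigma>" using s \<beta> \<delta> by (auto simp: \<sigma>_def)
    have \<sigma>0: "0 < \<sigma>" using t0 \<delta> by (simp add: \<sigma>_def)
    have "g s \<le> (LINT y:K|lebesgue. u s y * ((\<sigma> / (\<sigma> - s)) powr a * (\<phi> y * heat_kernel \<nu> \<sigma> (y - x))))"
      unfolding g_def
    proof (rule u_nonneg_weighted[OF s'(1) K(1,2)])
      show "\<psi> (y, s) \<le> (\<sigma> / (\<sigma> - s)) powr a * (\<phi> y * heat_kernel \<nu> \<sigma> (y - x))" for y
        using mult_left_mono[OF heat_kernel_earlier_le[OF \<nu> _ s'(2), of "y - x"] \<phi>(2)[of y]] s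
        by (simp add: \<psi>_def k_def backward_kernel_def a_def mult.left_commute)
      show "set_integrable lebesgue K (\<lambda>y. u s y * \<psi> (y, s))"
        by (intro int slice smooth_on_continuous[OF s\<psi>] s')
      have "continuous_on K (\<lambda>y. \<psi> (y, 0))"
        by (intro slice smooth_on_continuous[OF s\<psi>] \<sigma>0)
      then show "set_integrable lebesgue K (\<lambda>y. u s y * ((\<sigma> / (\<sigma> - s)) powr a * (\<phi> y * heat_kernel \<nu> \<sigma> (y - x))))"
        by (intro int s' continuous_on_mult_left) (simp add: \<psi>_def k_def backward_kernel_def)
    qed
    also have "\<dots> = (\<sigma> / (\<sigma> - s)) powr a * (LINT y:K|lebesgue. u s y * (\<phi> y * heat_kernel \<nu> \<sigma> (y - x)))"
      unfolding set_integral_mult_right[symmetric] by (simp only: mult.left_commute)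
    also have "(LINT y:K|lebesgue. u s y * (\<phi> y * heat_kernel \<nu> \<sigma> (y - x))) = G s"
      unfolding G_def by (rule set_integral_support(1)[OF K(2), symmetric]) (simp add: K(3))
    finally show ?thesis using inc[OF s] by simp
  qed
  have "((\<lambda>s. (\<sigma> / (\<sigma> - s)) powr a * G s + B * m * (t - s)) \<longlongrightarrow> (\<sigma> / (\<sigma> - 0)) powr a * \<Lambda> + B * m * (t - 0)) (at_right 0)"
    using tr t0 \<delta> unfolding G_def \<sigma>_def by (intro tendsto_intros) auto
  then have "g t \<le> (\<sigma> / (\<sigma> - 0)) powr a * \<Lambda> + B * m * (t - 0)"
    by (rule tendsto_lowerbound) (use t0 le in \<open>auto intro!: eventually_at_rightI[of 0 t]\<close>)
  moreover have "\<sigma> \<noteq> 0" "\<sigma> - t = \<delta>" using t0 \<delta> by (auto simp: \<sigma>_def)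
  ultimately show ?thesis by (simp add: g_def \<psi>_def k_def backward_kernel_def)
qed

text \<open>On a cube of side \<open>h\<close> with corner \<open>x\<close> the kernel at time \<open>\<delta> = h\<^sup>2\<close> is at least a constant times
  \<open>h\<^bsup>-N\<^esup>\<close>. So \<open>Y\<close> bounds, up to that constant, the averages of \<open>u t\<close> over small cubes, and these converge to
  \<open>u t x\<close> for almost every \<open>x\<close>.\<close>
lemma pointwise_bound:
  assumes \<nu>: "0 < \<nu>" and t: "t \<in> open_time T"
    and \<phi>: "continuous_on UNIV \<phi>" "\<And>y. 0 \<le> \<phi> y" and K: "compact K" "K \<subseteq> \<Omega>"
    and A: "A \<subseteq> K" "\<And>y. y \<in> A \<Longrightarrow> \<phi> y = 1"
    and Y: "\<And>x \<delta>. x \<in> A \<Longrightarrow> 0 < \<delta> \<Longrightarrow> \<delta> \<le> 1 \<Longrightarrow> (LINT y:K|lebesgue. u t y * (\<phi> y * heat_kernel \<nu> \<delta> (y - x))) \<le> Y"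
  shows "AE x in lebesgue. x \<in> A \<longrightarrow> u t x \<le> exp (real DIM('a) / (4 * \<nu>)) * Y"
proof -
  define n where "n = real DIM('a)"
  define f where "f y = indicator K y *\<^sub>R (u t y * \<phi> y)" for y
  have \<phi>K: "continuous_on K \<phi>" using \<phi>(1) continuous_on_subset by blast
  have fi: "integrable lebesgue f"
    using set_integrable_mult_continuous[OF u_integrable[OF t K] K(1) \<phi>K] by (simp add: f_def[abs_def] set_integrable_def)
  have fS: "set_integrable lebesgue (cbox a b) f" for a b
    using fi unfolding set_integrable_def by (intro integrable_mult_indicator) auto
  have "f integrable_on cbox a b" for a b by (rule set_lebesgue_integral_eq_integral(1)[OF fS])
  then obtain N where N: "negligible N" "\<And>x e. x \<notin> N \<Longrightarrow> 0 < e \<Longrightarrow>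
      \<exists>d>0. \<forall>h. 0 < h \<and> h < d \<longrightarrow> norm (integral (cbox x (x + h *\<^sub>R One)) f /\<^sub>R h ^ DIM('a) - f x) < e"
    using integrable_ccontinuous_explicit[of f] by blast
  have "u t x \<le> exp (n / (4 * \<nu>)) * Y" if x: "x \<in> A" "x \<notin> N" for x
  proof (rule field_le_epsilon)
    fix e :: real assume "0 < e"
    from N(2)[OF x(2) this] obtain d where d0: "d > 0 \<and> (\<forall>h. 0 < h \<and> h < d \<longrightarrow>
        norm (integral (cbox x (x + h *\<^sub>R One)) f /\<^sub>R h ^ DIM('a) - f x) < e)" ..
    then have d: "d > 0" "\<And>h. 0 < h \<Longrightarrow> h < d \<Longrightarrow>
        \<bar>integral (cbox x (x + h *\<^sub>R One)) f /\<^sub>R h ^ DIM('a) - f x\<bar> < e"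
      by auto
    define h where "h = min (d / 2) 1"
    have h: "0 < h" "h < d" "h \<le> 1" using d(1) by (auto simp: h_def)
    define c where "c = h ^ DIM('a) * exp (n / (4 * \<nu>))"
    have c: "0 < c" using h by (simp add: c_def)
    have low: "1 \<le> c * heat_kernel \<nu> (h\<^sup>2) (y - x)" if "y \<in> cbox x (x + h *\<^sub>R One)" for y
    proof -
      have "(norm (y - x))\<^sup>2 = (\<Sum>b\<in>Basis. ((y - x) \<bullet> b)\<^sup>2)"
        unfolding power2_norm_eq_inner euclidean_inner[of "y - x" "y - x"] by (simp add: power2_eq_square)
      also have "\<dots> \<le> (\<Sum>b\<in>(Basis :: 'a set). h\<^sup>2)"
      proof (rule sum_mono)
        fix b :: 'a assume b: "b \<in> Basis"
        then have "0 \<le> (y - x) \<bullet> b" "(y - x) \<bullet> b \<le> h"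
          using that by (auto simp: mem_box inner_diff_left inner_add_left dest!: bspec[OF _ b])
        then show "((y - x) \<bullet> b)\<^sup>2 \<le> h\<^sup>2" by (rule power_mono[rotated])
      qed
      finally have "(norm (y - x))\<^sup>2 \<le> n * h\<^sup>2" by (simp add: n_def)
      then have "(norm (y - x))\<^sup>2 / (4 * \<nu> * h\<^sup>2) \<le> n * h\<^sup>2 / (4 * \<nu> * h\<^sup>2)"
        using \<nu> h by (intro divide_right_mono) auto
      also have "\<dots> = n / (4 * \<nu>)" using h by simp
      finally have "1 \<le> exp (n / (4 * \<nu>)) * exp (- (norm (y - x))\<^sup>2 / (4 * \<nu> * h\<^sup>2))"
        by (simp add: exp_add[symmetric])
      also have "\<dots> = c * heat_kernel \<nu> (h\<^sup>2) (y - x)"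
      proof -
        have "(h\<^sup>2) powr (- (n / 2)) = (h powr 2) powr (- (n / 2))" using h by simp
        also have "\<dots> = h powr (- n)" by (simp only: powr_powr) simp
        also have "\<dots> = inverse (h ^ DIM('a))"
          using h by (simp add: powr_minus n_def powr_realpow)
        finally show ?thesis using h by (simp add: c_def heat_kernel_def n_def)
      qed
      finally show ?thesis .
    qed
    have hkc: "continuous_on K (\<lambda>y. \<phi> y * heat_kernel \<nu> (h\<^sup>2) (y - x))"
      unfolding heat_kernel_def using \<nu> h by (intro continuous_intros \<phi>K) auto
    have "integral (cbox x (x + h *\<^sub>R One)) f = (LINT y:cbox x (x + h *\<^sub>R One)|lebesgue. f y)"
      by (rule set_lebesgue_integral_eq_integral(2)[OF fS, symmetric])
    also have "\<dots> \<le> (LINT y:K|lebesgue. c * (u t y * (\<phi> y * heat_kernel \<nu> (h\<^sup>2) (y - x))))"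
      unfolding set_lebesgue_integral_def
    proof (rule integral_mono_AE)
      show "AE y in lebesgue. indicat_real (cbox x (x + h *\<^sub>R One)) y *\<^sub>R f y
          \<le> indicat_real K y *\<^sub>R (c * (u t y * (\<phi> y * heat_kernel \<nu> (h\<^sup>2) (y - x))))"
        using u_nonneg_slice[OF t K]
      proof eventually_elim
        case (elim y)
        show ?case
        proof (cases "y \<in> K")
          case True
          then have "0 \<le> u t y * \<phi> y" using elim \<phi>(2)[of y] by simp
          then have "indicat_real (cbox x (x + h *\<^sub>R One)) y * (u t y * \<phi> y)
              \<le> c * heat_kernel \<nu> (h\<^sup>2) (y - x) * (u t y * \<phi> y)"
            using low[of y] c heat_kernel_nonneg[of \<nu> "h\<^sup>2" "y - x"]
            by (intro mult_right_mono) (auto simp: indicator_def)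
          then show ?thesis using True by (simp add: f_def mult_ac)
        qed (simp add: f_def)
      qed
      show "integrable lebesgue (\<lambda>y. indicat_real K y *\<^sub>R (c * (u t y * (\<phi> y * heat_kernel \<nu> (h\<^sup>2) (y - x)))))"
        using set_integrable_mult_right[OF set_integrable_mult_continuous[OF u_integrable[OF t K] K(1) hkc]]
        by (simp add: set_integrable_def)
    qed (use fS in \<open>simp add: set_integrable_def\<close>)
    also have "\<dots> = c * (LINT y:K|lebesgue. u t y * (\<phi> y * heat_kernel \<nu> (h\<^sup>2) (y - x)))" by simp
    also have "\<dots> \<le> c * Y"
      using c h by (intro mult_left_mono Y x(1)) (auto simp: power_le_one)
    finally have "integral (cbox x (x + h *\<^sub>R One)) f / h ^ DIM('a) \<le> exp (n / (4 * \<nu>)) * Y"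
      using h by (simp add: c_def field_simps)
    moreover have "f x = u t x" using x(1) A by (auto simp: f_def)
    ultimately show "u t x \<le> exp (n / (4 * \<nu>)) * Y + e"
      using d(2)[OF h(1,2)] unfolding real_scaleR_def divide_inverse_commute[symmetric] by linarith
  qed
  moreover have "AE x in lebesgue. x \<notin> N"
    using N(1) by (auto simp: negligible_iff_null_sets intro: AE_not_in)
  ultimately show ?thesis by (auto simp: n_def elim!: eventually_mono)
qed

end

section \<open>Integrability bounds for the initial trace\<close>

text \<open>The kernel is a product of one-dimensional normal densities of variance \<open>2 \<nu> r\<close>, up to a factor
  \<open>sqrt (4 \<pi> \<nu>)\<close> for each coordinate.\<close>
lemma heat_kernel_integral:
  fixes x :: "'a::euclidean_space"
  assumes \<nu>: "0 < \<nu>" and r: "0 < r"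
  shows "integrable lebesgue (\<lambda>y. heat_kernel \<nu> r (y - x))"
    "(LINT y|lebesgue. heat_kernel \<nu> r (y - x)) = sqrt (4 * pi * \<nu>) ^ DIM('a)"
proof -
  define s where "s = sqrt (2 * \<nu> * r)"
  have s: "s > 0" "s\<^sup>2 = 2 * \<nu> * r" using \<nu> r by (auto simp: s_def)
  have "heat_kernel \<nu> r (y - x) = (\<Prod>b\<in>Basis. sqrt (4 * pi * \<nu>) * normal_density (x \<bullet> b) s (y \<bullet> b))" for y
  proof -
    have one: "sqrt (4 * pi * \<nu>) * normal_density (x \<bullet> b) s (y \<bullet> b)
        = r powr (- (1 / 2)) * exp (- ((y - x) \<bullet> b)\<^sup>2 / (4 * \<nu> * r))" for b
    proof -
      have "sqrt (2 * pi * s\<^sup>2) = sqrt (4 * pi * \<nu>) * sqrt r"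
        unfolding s(2) by (simp add: real_sqrt_mult[symmetric] mult_ac)
      moreover have "sqrt (4 * pi * \<nu>) \<noteq> 0" using \<nu> by simp
      moreover have "r powr (- (1 / 2)) = 1 / sqrt r"
        using r by (simp add: powr_minus_divide powr_half_sqrt)
      ultimately show ?thesis
        by (simp add: normal_density_def s(2) inner_diff_left)
    qed
    have "(\<Prod>b\<in>Basis. r powr (- (1 / 2)) * exp (- ((y - x) \<bullet> b)\<^sup>2 / (4 * \<nu> * r)))
        = (r powr (- (1 / 2))) ^ DIM('a) * exp (\<Sum>b\<in>Basis. - ((y - x) \<bullet> b)\<^sup>2 / (4 * \<nu> * r))"
      by (simp add: prod.distrib exp_sum)
    also have "(r powr (- (1 / 2))) ^ DIM('a) = r powr (- (real DIM('a) / 2))"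
      using r by (simp add: powr_power mult.commute)
    also have "(\<Sum>b\<in>Basis. - ((y - x) \<bullet> b)\<^sup>2 / (4 * \<nu> * r)) = - (norm (y - x))\<^sup>2 / (4 * \<nu> * r)"
      unfolding power2_norm_eq_inner euclidean_inner[of "y - x" "y - x"]
      by (simp add: sum_negf sum_divide_distrib power2_eq_square)
    finally show ?thesis unfolding one by (simp add: heat_kernel_def)
  qed
  note prod = this
  have "(\<integral>\<^sup>+y. ennreal (heat_kernel \<nu> r (y - x)) \<partial>lborel)
      = (\<integral>\<^sup>+y. (\<Prod>b\<in>Basis. ennreal (sqrt (4 * pi * \<nu>) * normal_density (x \<bullet> b) s (y \<bullet> b))) \<partial>lborel)"
    using \<nu> by (simp add: prod prod_ennreal)
  also have "\<dots> = (\<Prod>b\<in>Basis. (\<integral>\<^sup>+y. ennreal (sqrt (4 * pi * \<nu>) * normal_density (x \<bullet> b) s y) \<partial>lborel))"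
    by (rule nn_integral_lborel_prod) auto
  also have "\<dots> = (\<Prod>b\<in>(Basis :: 'a set). ennreal (sqrt (4 * pi * \<nu>)))"
  proof (rule prod.cong[OF refl])
    fix b :: 'a
    have "(\<integral>\<^sup>+y. ennreal (sqrt (4 * pi * \<nu>) * normal_density (x \<bullet> b) s y) \<partial>lborel)
        = ennreal (LINT y|lborel. sqrt (4 * pi * \<nu>) * normal_density (x \<bullet> b) s y)"
      using s \<nu> by (intro nn_integral_eq_integral) auto
    then show "(\<integral>\<^sup>+y. ennreal (sqrt (4 * pi * \<nu>) * normal_density (x \<bullet> b) s y) \<partial>lborel) = ennreal (sqrt (4 * pi * \<nu>))"
      using s by simp
  qed
  also have "\<dots> = ennreal (sqrt (4 * pi * \<nu>) ^ DIM('a))" using \<nu> by (simp add: ennreal_power)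
  finally have nn: "(\<integral>\<^sup>+y. ennreal (heat_kernel \<nu> r (y - x)) \<partial>lborel) = ennreal (sqrt (4 * pi * \<nu>) ^ DIM('a))" .
  have m: "(\<lambda>y. heat_kernel \<nu> r (y - x)) \<in> borel_measurable lborel"
    unfolding heat_kernel_def by measurable
  have i: "integrable lborel (\<lambda>y. heat_kernel \<nu> r (y - x))"
    using nn by (intro integrableI_nonneg m) (auto simp: heat_kernel_nonneg)
  then show "integrable lebesgue (\<lambda>y. heat_kernel \<nu> r (y - x))"
    using integrable_completion[OF m] by simp
  show "(LINT y|lebesgue. heat_kernel \<nu> r (y - x)) = sqrt (4 * pi * \<nu>) ^ DIM('a)"
    unfolding integral_completion[OF m]
    using nn nn_integral_eq_integral[OF i AE_I2[OF heat_kernel_nonneg]] \<nu>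
    by (simp add: ennreal_inj integral_nonneg_AE heat_kernel_nonneg)
qed

lemma heat_kernel_le: "0 < \<nu> \<Longrightarrow> 0 < t \<Longrightarrow> t \<le> r \<Longrightarrow> heat_kernel \<nu> r (z :: 'a::euclidean_space) \<le> t powr (- (real DIM('a) / 2))"
proof -
  assume a: "0 < \<nu>" "0 < t" "t \<le> r"
  have "heat_kernel \<nu> r z \<le> r powr (- (real DIM('a) / 2)) * 1"
    unfolding heat_kernel_def using a by (intro mult_left_mono) auto
  also have "\<dots> \<le> t powr (- (real DIM('a) / 2))" using a by (simp add: powr_mono2')
  finally show ?thesis .
qed

text \<open>Hoelder's inequality for a weight with prescribed supremum and integral, up to a factor \<open>2\<close>. For
  \<open>c > 0\<close> one has \<open>a \<le> c + c\<^bsup>1-R\<^esup> a\<^sup>R\<close>; multiply by the weight, integrate and optimize in \<open>c\<close>.\<close>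
lemma weighted_integral_le_Lp_norm:
  fixes f w :: "'a::euclidean_space \<Rightarrow> real"
  assumes R: "1 \<le> R" and I: "0 < I" and S: "0 < S"
    and w: "integrable lebesgue w" "\<And>y. 0 \<le> w y" "\<And>y. w y \<le> S" "(LINT y|lebesgue. w y) \<le> I"
    and f: "set_integrable lebesgue A (\<lambda>y. norm (f y) powr R)"
  shows "(LINT y:A|lebesgue. f y * w y) \<le> 2 * I powr (1 - 1 / R) * S powr (1 / R) * Lp_norm R A f"
proof (cases "set_integrable lebesgue A (\<lambda>y. f y * w y)")
  case False
  then have "(LINT y:A|lebesgue. f y * w y) = 0"
    unfolding set_lebesgue_integral_def set_integrable_def by (rule not_integrable_integral_eq)
  then show ?thesis by (simp add: Lp_norm_def)
next
  case fw: True
  define X where "X = (LINT y:A|lebesgue. norm (f y) powr R)"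
  have X: "0 \<le> X"
    unfolding X_def set_lebesgue_integral_def by (intro Bochner_Integration.integral_nonneg) simp
  have young: "a * b \<le> c * b + c powr (1 - R) * S * \<bar>a\<bar> powr R" if c: "0 < c" and b: "0 \<le> b" "b \<le> S" for a b c :: real
  proof -
    have "\<bar>a\<bar> \<le> c + c powr (1 - R) * \<bar>a\<bar> powr R"
    proof (cases "\<bar>a\<bar> \<le> c")
      case False
      then have "c powr (1 - R) \<ge> \<bar>a\<bar> powr (1 - R)" using c R by (intro powr_mono2') auto
      then have "c powr (1 - R) * \<bar>a\<bar> powr R \<ge> \<bar>a\<bar> powr (1 - R) * \<bar>a\<bar> powr R" by (rule mult_right_mono) simp
      also have "\<bar>a\<bar> powr (1 - R) * \<bar>a\<bar> powr R = \<bar>a\<bar>" using False c by (simp add: powr_add[symmetric])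
      finally show ?thesis using c by simp
    qed (simp add: add_increasing2)
    then have "\<bar>a\<bar> * b \<le> (c + c powr (1 - R) * \<bar>a\<bar> powr R) * b" using b by (intro mult_right_mono)
    also have "\<dots> \<le> c * b + c powr (1 - R) * S * \<bar>a\<bar> powr R"
      using mult_left_mono[OF b(2), of "c powr (1 - R) * \<bar>a\<bar> powr R"] by (simp add: algebra_simps)
    finally show ?thesis using mult_right_mono[OF abs_ge_self b(1), of a] by simp
  qed
  have bound: "(LINT y:A|lebesgue. f y * w y) \<le> c * I + c powr (1 - R) * S * X" if c: "0 < c" for c
  proof -
    have i2: "integrable lebesgue (\<lambda>y. c * w y + c powr (1 - R) * S * (indicator A y *\<^sub>R norm (f y) powr R))"
      using f w(1) unfolding set_integrable_def by simp
    have "(LINT y:A|lebesgue. f y * w y) \<le> (LINT y|lebesgue. c * w y + c powr (1 - R) * S * (indicator A y *\<^sub>R norm (f y) powr R))"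
      unfolding set_lebesgue_integral_def
    proof (rule integral_mono[OF _ i2])
      show "integrable lebesgue (\<lambda>y. indicat_real A y *\<^sub>R (f y * w y))" using fw by (simp add: set_integrable_def)
      show "indicat_real A y *\<^sub>R (f y * w y) \<le> c * w y + c powr (1 - R) * S * (indicator A y *\<^sub>R norm (f y) powr R)" for y
        using young[OF c w(2,3), of "f y" y] c w(2)[of y] by (auto simp: indicator_def)
    qed
    also have "\<dots> = c * (LINT y|lebesgue. w y) + c powr (1 - R) * S * X"
      using f w(1) unfolding X_def set_lebesgue_integral_def set_integrable_def by simp
    also have "\<dots> \<le> c * I + c powr (1 - R) * S * X" using w(4) c by simp
    finally show ?thesis .
  qed
  show ?thesis
  proof (cases "X = 0")
    case True
    have "(LINT y:A|lebesgue. f y * w y) \<le> 0"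
    proof (rule field_le_epsilon)
      fix e :: real assume "0 < e"
      then show "(LINT y:A|lebesgue. f y * w y) \<le> 0 + e" using bound[of "e / I"] I True by simp
    qed
    then show ?thesis using True by (simp add: Lp_norm_def X_def)
  next
    case False
    then have X: "0 < X" using X by simp
    \<comment> \<open>The value of \<open>c\<close> for which both terms of the bound are equal.\<close>
    define c where "c = (S * X / I) powr (1 / R)"
    have c: "0 < c" using S X I by (simp add: c_def)
    have "c powr R = S * X / I" using R S X I by (simp add: c_def powr_powr)
    then have "c powr (1 - R) * S * X = c * I"
      using c S X I by (simp add: powr_diff field_simps)
    then have "(LINT y:A|lebesgue. f y * w y) \<le> 2 * (c * I)" using bound[OF c] by linarith
    also have "c * I = I powr (1 - 1 / R) * S powr (1 / R) * X powr (1 / R)"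
      using S X I by (simp add: c_def powr_mult powr_divide powr_diff)
    finally show ?thesis by (simp add: Lp_norm_def X_def mult.assoc)
  qed
qed

lemma integral_measure_of_density:
  fixes \<Omega> :: "'a::euclidean_space set"
  assumes \<Omega>: "open \<Omega>" and f: "Lp_loc R \<Omega> f" "AE x in lebesgue. x \<in> \<Omega> \<longrightarrow> 0 \<le> f x"
    and \<psi>: "continuous_on UNIV \<psi>"
  shows "(LINT x:\<Omega>|measure_of_density \<Omega> f. \<psi> x) = (LINT x:\<Omega>|lebesgue. f x * \<psi> x)"
proof -
  have s: "\<Omega> \<in> sets lebesgue" using \<Omega> by simp
  have fm: "f \<in> borel_measurable (lebesgue_on \<Omega>)"
    using f(1) s unfolding Lp_loc_def set_borel_measurable_def
    by (subst borel_measurable_restrict_space_iff) auto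
  have \<psi>m: "(\<lambda>x. indicator \<Omega> x *\<^sub>R \<psi> x) \<in> borel_measurable (lebesgue_on \<Omega>)"
  proof -
    have "(\<lambda>x. indicator \<Omega> x *\<^sub>R \<psi> x) \<in> borel_measurable borel"
      using \<Omega> \<psi> by (intro borel_measurable_continuous_on_indicator) (auto intro: continuous_on_subset)
    then show ?thesis by (intro measurable_restrict_space1) (simp add: measurable_completion)
  qed
  have "AE x in lebesgue_on \<Omega>. 0 \<le> f x" using f(2) s by (simp add: AE_restrict_space_iff)
  from integral_density[OF \<psi>m fm this]
  have "(LINT x:\<Omega>|measure_of_density \<Omega> f. \<psi> x) = (LINT x|lebesgue_on \<Omega>. f x * (indicator \<Omega> x * \<psi> x))"
    by (simp add: measure_of_density_def set_lebesgue_integral_def)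
  also have "\<dots> = (LINT x:\<Omega>|lebesgue. f x * \<psi> x)"
    using s by (subst integral_restrict_space) (auto simp: set_lebesgue_integral_def indicator_def intro!: Bochner_Integration.integral_cong)
  finally show ?thesis .
qed

lemma measure_lebesgue_cball:
  fixes x :: "'a::euclidean_space"
  assumes "0 \<le> r"
  shows "measure lebesgue (cball x r) = unit_ball_vol (real DIM('a)) * r ^ DIM('a)"
  using emeasure_cball[OF assms, of x] assms by (simp add: measure_def)

lemma continuous_on_heat_kernel:
  "0 < \<nu> \<Longrightarrow> 0 < r \<Longrightarrow> continuous_on X (\<lambda>y. heat_kernel \<nu> r (y - x))"
  unfolding heat_kernel_def by (intro continuous_intros) auto

section \<open>The local regularizing effect\<close>

text \<open>Three radii are involved. The point \<open>x\<close> ranges over the ball of radius \<open>\<rho>0\<close>; \<open>\<phi>\<close> is supported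
  in radius \<open>\<rho>1\<close>; \<open>\<xi>\<close> equals \<open>1\<close> there, so that it sees all of the mass met by the commutator terms,
  and is supported in radius \<open>\<rho>2\<close>. The cutoffs are centred at the origin and translated in the
  proof, which keeps the constants independent of \<open>x\<^sub>0\<close>.\<close>
lemma (in weak_solution) local_estimate:
  fixes \<phi> \<xi> :: "'a \<Rightarrow> real"
  assumes q: "1 < q" and \<nu>: "0 < \<nu>" and \<rho>: "0 \<le> \<rho>0" "\<rho>1 < \<rho>2"
    and \<xi>: "smooth_on UNIV \<xi>" "\<And>y. 0 \<le> \<xi> y" "\<And>y. norm y \<le> \<rho>1 \<Longrightarrow> \<xi> y = 1" "\<And>y. \<rho>2 \<le> norm y \<Longrightarrow> \<xi> y = 0"
    and L: "0 \<le> L" "\<And>y v. \<bar>dir_deriv v \<xi> y\<bar> \<le> L * norm v * \<xi> y powr (1 / q)"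
    and \<phi>: "smooth_on UNIV \<phi>" "\<And>y. 0 \<le> \<phi> y" "\<And>y. norm y \<le> \<rho>0 \<Longrightarrow> \<phi> y = 1" "\<And>y. \<rho>1 \<le> norm y \<Longrightarrow> \<phi> y = 0"
    and B: "0 \<le> B" "\<And>x y r. norm x \<le> \<rho>0 \<Longrightarrow> 0 < r \<Longrightarrow> \<bar>heat_kernel \<nu> r (y - x) *
      (\<nu> * (\<Sum>b\<in>Basis. dir_deriv b (dir_deriv b \<phi>) y) - dir_deriv (y - x) \<phi> y / r)\<bar> \<le> B"
    and M: "M = (\<nu> * L) powr (q / (q - 1)) * (unit_ball_vol (real DIM('a)) * \<rho>2 ^ DIM('a))"
    and K: "cball x\<^sub>0 \<rho>2 \<subseteq> \<Omega>"
    and tr: "\<And>\<psi>. \<psi> \<in> Cc \<Omega> \<Longrightarrow> ((\<lambda>t. LINT x:\<Omega>|lebesgue. u t x * \<psi> x) \<longlongrightarrow> \<Lambda> \<psi>) (at_right 0)"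
    and t: "t \<in> open_time T"
    and m: "0 \<le> m" "\<Lambda> (\<lambda>y. \<xi> (y - x\<^sub>0)) \<le> m"
    and Y: "\<And>x r. norm (x - x\<^sub>0) \<le> \<rho>0 \<Longrightarrow> t < r \<Longrightarrow> \<Lambda> (\<lambda>y. \<phi> (y - x\<^sub>0) * heat_kernel \<nu> r (y - x)) \<le> Y"
  shows "AE x in lebesgue. x \<in> cball x\<^sub>0 \<rho>0 \<longrightarrow>
    u t x \<le> exp (real DIM('a) / (4 * \<nu>)) * (Y + B * (m + 2 * M * t) * t)"
proof -
  define K where "K = cball x\<^sub>0 \<rho>2"
  define \<phi>' where "\<phi>' y = \<phi> (y - x\<^sub>0)" for y
  define \<xi>' where "\<xi>' y = \<xi> (y - x\<^sub>0)" for y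
  have K: "compact K" "K \<subseteq> \<Omega>" using K by (auto simp: K_def)
  have t0: "0 < t" using t by (simp add: open_time_def)
  have "\<not> norm (0 :: 'a) \<ge> \<rho>1" using \<phi>(3,4)[of 0] \<rho> by force
  then have \<rho>1: "0 < \<rho>1" by simp
  have \<phi>0: "\<phi> y = 1 \<Longrightarrow> norm y < \<rho>1" for y using \<phi>(4)[of y] by force
  have \<rho>01: "\<rho>0 < \<rho>1"
  proof -
    obtain b :: 'a where b: "norm b = 1" using norm_Basis nonempty_Basis by blast
    have "norm (\<rho>0 *\<^sub>R b) = \<rho>0" using \<rho> b by simp
    then show ?thesis using \<phi>(3)[of "\<rho>0 *\<^sub>R b"] \<phi>0[of "\<rho>0 *\<^sub>R b"] by simp
  qed
  have M0: "0 \<le> M" using \<rho> \<rho>1 by (simp add: M)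
  have s\<phi>': "smooth_on UNIV \<phi>'" and s\<xi>': "smooth_on UNIV \<xi>'"
    unfolding \<phi>'_def \<xi>'_def by (intro smooth_on_translate \<phi> \<xi>)+
  have d\<phi>': "dir_deriv v \<phi>' = (\<lambda>y. dir_deriv v \<phi> (y - x\<^sub>0))" for v
    unfolding \<phi>'_def by (rule ext) (rule dir_deriv_translate[OF \<phi>(1)])
  have dd\<phi>': "dir_deriv v (dir_deriv v \<phi>') y = dir_deriv v (dir_deriv v \<phi>) (y - x\<^sub>0)" for v y
    unfolding d\<phi>' by (rule dir_deriv_translate[OF smooth_on_dir_deriv[OF open_UNIV \<phi>(1)]])
  have d\<xi>': "\<bar>dir_deriv v \<xi>' y\<bar> \<le> L * norm v * \<xi>' y powr (1 / q)" for v y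
    unfolding \<xi>'_def dir_deriv_translate[OF \<xi>(1)] by (rule L(2))
  have \<xi>K: "\<xi>' y = 0" if "y \<notin> K" for y
    using that unfolding \<xi>'_def K_def by (intro \<xi>(4)) (simp add: dist_norm norm_minus_commute)
  have \<phi>K: "\<phi>' y = 0" if "y \<notin> K" for y
    using that \<rho> unfolding \<phi>'_def K_def by (intro \<phi>(4)) (simp add: dist_norm norm_minus_commute)
  have mass: "(LINT y:K|lebesgue. u s y * \<xi>' y) \<le> m + 2 * M * t" if s: "s \<in> open_time T" "s < 2 * t" for s
  proof -
    have "((\<lambda>t. LINT x:\<Omega>|lebesgue. u t x * \<xi>' x) \<longlongrightarrow> \<Lambda> \<xi>') (at_right 0)"
      by (rule tr[OF CcI[OF smooth_on_continuous[OF s\<xi>'] K \<xi>K]])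
    note lim = this
    have "measure lebesgue K = unit_ball_vol (real DIM('a)) * \<rho>2 ^ DIM('a)"
      unfolding K_def using \<rho> \<rho>1 by (intro measure_lebesgue_cball) simp
    then have M': "M = (\<nu> * L) powr (q / (q - 1)) * measure lebesgue K" by (simp only: M)
    have "(LINT y:K|lebesgue. u s y * \<xi>' y) \<le> \<Lambda> \<xi>' + M * s"
      unfolding M' by (rule local_mass_bound[OF q \<nu> s\<xi>' _ L(1) d\<xi>' K \<xi>K lim s(1)]) (simp add: \<xi>'_def \<xi>(2))
    also have "\<dots> \<le> m + M * (2 * t)"
      using m(2) mult_left_mono[OF less_imp_le[OF s(2)] M0] by (simp add: \<xi>'_def[abs_def])
    finally show ?thesis by simp
  qed
  show ?thesis
  proof (rule pointwise_bound[OF \<nu> t smooth_on_continuous[OF s\<phi>'] _ K])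
    show "0 \<le> \<phi>' y" for y by (simp add: \<phi>'_def \<phi>(2))
    show "cball x\<^sub>0 \<rho>0 \<subseteq> K" using \<rho> \<rho>01 by (auto simp: K_def)
    show "\<phi>' y = 1" if "y \<in> cball x\<^sub>0 \<rho>0" for y
      using that unfolding \<phi>'_def by (intro \<phi>(3)) (simp add: dist_norm norm_minus_commute)
    fix x \<delta> assume x: "x \<in> cball x\<^sub>0 \<rho>0" and \<delta>: "0 < (\<delta> :: real)" "\<delta> \<le> 1"
    have x': "norm (x - x\<^sub>0) \<le> \<rho>0" using x by (simp add: dist_norm norm_minus_commute)
    have "(LINT y:K|lebesgue. u t y * (\<phi>' y * heat_kernel \<nu> \<delta> (y - x)))
        \<le> \<Lambda> (\<lambda>y. \<phi>' y * heat_kernel \<nu> (t + \<delta>) (y - x)) + B * (m + 2 * M * t) * t"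
    proof (rule kernel_bound[OF \<nu> \<delta>(1) t s\<phi>' _ K \<phi>K B(1) smooth_on_continuous[OF s\<xi>'] _ mass])
      show "0 \<le> m + 2 * M * t" using m(1) M0 t0 by simp
      show "0 \<le> \<phi>' y" for y by (simp add: \<phi>'_def \<phi>(2))
      show "((\<lambda>s. LINT y:\<Omega>|lebesgue. u s y * (\<phi>' y * heat_kernel \<nu> (t + \<delta>) (y - x)))
          \<longlongrightarrow> \<Lambda> (\<lambda>y. \<phi>' y * heat_kernel \<nu> (t + \<delta>) (y - x))) (at_right 0)"
      proof (rule tr, rule CcI[OF _ K])
        show "continuous_on UNIV (\<lambda>y. \<phi>' y * heat_kernel \<nu> (t + \<delta>) (y - x))"
          using \<nu> t0 \<delta> by (intro continuous_on_mult smooth_on_continuous[OF s\<phi>'] continuous_on_heat_kernel) auto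
      qed (simp add: \<phi>K)
      fix y and r :: real assume r: "0 < r"
      show "\<bar>heat_kernel \<nu> r (y - x) * (\<nu> * (\<Sum>b\<in>Basis. dir_deriv b (dir_deriv b \<phi>') y) - dir_deriv (y - x) \<phi>' y / r)\<bar> \<le> B * \<xi>' y"
      proof (cases "norm (y - x\<^sub>0) \<le> \<rho>1")
        case True
        have "dir_deriv (y - x) \<phi>' y = dir_deriv ((y - x\<^sub>0) - (x - x\<^sub>0)) \<phi> (y - x\<^sub>0)" by (simp add: d\<phi>')
        then show ?thesis
          using B(2)[OF x' r, of "y - x\<^sub>0"] \<xi>(3)[OF True] by (simp add: dd\<phi>' \<xi>'_def)
      next
        case False
        define V where "V = {y. \<rho>1 < norm (y - x\<^sub>0)}"
        have V: "open V" "y \<in> V"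
          using False unfolding V_def by (auto intro!: open_Collect_less continuous_intros)
        have z: "dir_deriv v \<phi>' y = 0" if "y \<in> V" for v y
          by (rule dir_deriv_zero_on_open[OF V(1) _ that]) (auto simp: V_def \<phi>'_def \<phi>(4))
        then have "dir_deriv v (dir_deriv v \<phi>') y = 0" for v
          by (intro dir_deriv_zero_on_open[OF V(1) _ V(2)]) simp
        then show ?thesis using z[OF V(2)] B(1) \<xi>(2) by (simp add: \<xi>'_def)
      qed
    qed
    also have "\<Lambda> (\<lambda>y. \<phi>' y * heat_kernel \<nu> (t + \<delta>) (y - x)) \<le> Y"
      using Y[OF x', of "t + \<delta>"] \<delta> by (simp add: \<phi>'_def)
    finally show "(LINT y:K|lebesgue. u t y * (\<phi>' y * heat_kernel \<nu> \<delta> (y - x))) \<le> Y + B * (m + 2 * M * t) * t" by simp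
  qed
qed

lemma nonneg_weak_solution_imp_locale:
  assumes "nonneg_weak_solution \<nu> q \<Omega> T u"
  obtains Du where "weak_solution \<nu> q \<Omega> T u Du"
  using assms unfolding nonneg_weak_solution_def weak_solution_def L1_loc_W11_loc_def by blast

lemma sup_on_le:
  assumes A: "open A" "A \<subseteq> \<Omega>" and f: "Lp_loc p \<Omega> f" and le: "AE x in lebesgue. x \<in> A \<longrightarrow> f x \<le> c"
  shows "sup_on A f \<le> ereal c"
  unfolding sup_on_def
proof (rule esssup_I)
  have s: "A \<in> sets lebesgue" using A by simp
  have "set_borel_measurable lebesgue A f"
    using f A s set_borel_measurable_subset[of lebesgue \<Omega> f A] by (simp add: Lp_loc_def)
  then have "f \<in> borel_measurable (lebesgue_on A)"
    using s unfolding set_borel_measurable_def by (subst borel_measurable_restrict_space_iff) auto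
  then show "(\<lambda>x. ereal (f x)) \<in> borel_measurable (lebesgue_on A)" by simp
  show "AE x in lebesgue_on A. ereal (f x) \<le> ereal c" using le s by (simp add: AE_restrict_space_iff)
qed

text \<open>The trace is represented by the functional \<open>\<Lambda>\<close> of its integrals, and its size on the ball by a number
  \<open>X\<close> that controls \<open>\<Lambda> \<psi>\<close> through the supremum and the integral of \<open>\<psi>\<close>. This covers the \<open>L\<^sup>R\<close> norm of a
  density and, for \<open>R = 1\<close>, the mass of a measure, and it makes the constant the same for both.\<close>
lemma local_regularizing_effect:
  fixes q \<nu> R \<eta> \<tau> :: real
  assumes q: "1 < q" and \<nu>: "0 < \<nu>" and R: "1 \<le> R" and \<eta>: "0 < \<eta>" and \<tau>: "0 < \<tau>"
  shows "\<exists>C>0. \<forall>(\<Omega> :: 'a::euclidean_space set) T u x\<^sub>0 \<Lambda> X t.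
    nonneg_weak_solution \<nu> q \<Omega> T u \<longrightarrow> ereal \<tau> < T \<longrightarrow> cball x\<^sub>0 \<eta> \<subseteq> \<Omega> \<longrightarrow>
    (\<forall>\<psi>\<in>Cc \<Omega>. ((\<lambda>t. LINT x:\<Omega>|lebesgue. u t x * \<psi> x) \<longlongrightarrow> \<Lambda> \<psi>) (at_right 0)) \<longrightarrow>
    (\<forall>\<psi>\<in>Cc \<Omega>. \<forall>I S. 0 < I \<longrightarrow> 0 < S \<longrightarrow> (\<forall>y. 0 \<le> \<psi> y \<and> \<psi> y \<le> S) \<longrightarrow> (\<forall>y. y \<notin> ball x\<^sub>0 \<eta> \<longrightarrow> \<psi> y = 0) \<longrightarrow>
      integrable lebesgue \<psi> \<longrightarrow> (LINT y|lebesgue. \<psi> y) \<le> I \<longrightarrow> \<Lambda> \<psi> \<le> 2 * I powr (1 - 1 / R) * S powr (1 / R) * X) \<longrightarrow>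
    0 \<le> X \<longrightarrow> 0 < t \<longrightarrow> t \<le> \<tau> \<longrightarrow>
    sup_on (ball x\<^sub>0 (\<eta> / 2)) (u t) \<le> ereal (C * t powr (- (real DIM('a) / (2 * R))) * (t + X))"
proof -
  define \<rho>0 \<rho>1 \<rho>2 where "\<rho>0 = \<eta> / 2" and "\<rho>1 = 3 * \<eta> / 4" and "\<rho>2 = 7 * \<eta> / 8"
  have \<rho>: "0 < \<rho>0" "0 \<le> \<rho>0" "\<rho>0 < 5 * \<eta> / 8" "0 < 5 * \<eta> / 8" "5 * \<eta> / 8 < \<rho>1" "0 < \<rho>1" "\<rho>1 < \<rho>2" "0 < \<rho>2" "\<rho>2 < \<eta>"
    using \<eta> by (auto simp: \<rho>0_def \<rho>1_def \<rho>2_def)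
  obtain \<xi> :: "'a \<Rightarrow> real" and L where "smooth_on UNIV \<xi> \<and> (\<forall>y. 0 \<le> \<xi> y \<and> \<xi> y \<le> 1) \<and>
    (\<forall>y. norm y \<le> \<rho>1 \<longrightarrow> \<xi> y = 1) \<and> (\<forall>y. \<rho>2 \<le> norm y \<longrightarrow> \<xi> y = 0) \<and>
    0 \<le> L \<and> (\<forall>y v. \<bar>dir_deriv v \<xi> y\<bar> \<le> L * norm v * \<xi> y powr (1 / q))"
    using cutoff_gradient_absorption[OF q \<rho>(6,7)] by blast
  then have \<xi>: "smooth_on UNIV \<xi>" "\<And>y. 0 \<le> \<xi> y" "\<And>y. norm y \<le> \<rho>1 \<Longrightarrow> \<xi> y = 1" "\<And>y. \<rho>2 \<le> norm y \<Longrightarrow> \<xi> y = 0"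
    and \<xi>1: "\<And>y. \<xi> y \<le> 1" and L: "0 \<le> L" "\<And>y v. \<bar>dir_deriv v \<xi> y\<bar> \<le> L * norm v * \<xi> y powr (1 / q)" by auto
  obtain \<phi> :: "'a \<Rightarrow> real" where "smooth_on UNIV \<phi> \<and> (\<forall>y. 0 \<le> \<phi> y \<and> \<phi> y \<le> 1) \<and>
    (\<forall>y. norm y \<le> 5 * \<eta> / 8 \<longrightarrow> \<phi> y = 1) \<and> (\<forall>y. \<rho>1 \<le> norm y \<longrightarrow> \<phi> y = 0)"
    using smooth_cutoff_exists[OF \<rho>(4,5)] ..
  then have \<phi>: "smooth_on UNIV \<phi>" "\<And>y. 0 \<le> \<phi> y" "\<And>y. norm y \<le> 5 * \<eta> / 8 \<Longrightarrow> \<phi> y = 1" "\<And>y. \<rho>1 \<le> norm y \<Longrightarrow> \<phi> y = 0"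
    and \<phi>1: "\<And>y. \<phi> y \<le> 1" by auto
  obtain B where "0 \<le> B \<and> (\<forall>x y r. norm x \<le> \<rho>0 \<longrightarrow> 0 < r \<longrightarrow> \<bar>heat_kernel \<nu> r (y - x) *
      (\<nu> * (\<Sum>b\<in>Basis. dir_deriv b (dir_deriv b \<phi>) y) - dir_deriv (y - x) \<phi> y / r)\<bar> \<le> B)"
    using heat_kernel_flux_bound[OF \<nu> \<rho>(3,5) \<phi>(1,3,4)] by blast
  then have B: "0 \<le> B" "\<And>x y r. norm x \<le> \<rho>0 \<Longrightarrow> 0 < r \<Longrightarrow> \<bar>heat_kernel \<nu> r (y - x) *
      (\<nu> * (\<Sum>b\<in>Basis. dir_deriv b (dir_deriv b \<phi>) y) - dir_deriv (y - x) \<phi> y / r)\<bar> \<le> B" by auto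
  have \<phi>one: "\<phi> y = 1" if "norm y \<le> \<rho>0" for y using that \<rho>(3) by (intro \<phi>(3)) simp
  define a where "a = real DIM('a) / (2 * R)"
  define V where "V = unit_ball_vol (real DIM('a)) * \<rho>2 ^ DIM('a)"
  define Z where "Z = sqrt (4 * pi * \<nu>) ^ DIM('a)"
  define M where "M = (\<nu> * L) powr (q / (q - 1)) * V"
  define E where "E = exp (real DIM('a) / (4 * \<nu>))"
  define c1 where "c1 = 2 * Z powr (1 - 1 / R)"
  define c2 where "c2 = 2 * V powr (1 - 1 / R)"
  have V: "0 < V" and Z: "0 < Z" using \<rho> \<nu> by (auto simp: V_def Z_def unit_ball_vol_pos)
  have M: "0 \<le> M" using V by (simp add: M_def)
  define D where "D = B * (c2 + 2 * M) * \<tau> * \<tau> powr a"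
  define C where "C = E * (c1 + D)"
  have D: "0 \<le> D" using B M \<tau> by (simp add: D_def c2_def)
  have C: "0 < C" using D Z by (simp add: C_def E_def c1_def add_pos_nonneg)
  have main: "sup_on (ball x\<^sub>0 (\<eta> / 2)) (u t) \<le> ereal (C * t powr (- a) * (t + X))"
    if sol: "nonneg_weak_solution \<nu> q \<Omega> T u" and T: "ereal \<tau> < T" and ball: "cball x\<^sub>0 \<eta> \<subseteq> \<Omega>"
      and tr: "\<And>\<psi>. \<psi> \<in> Cc \<Omega> \<Longrightarrow> ((\<lambda>t. LINT x:\<Omega>|lebesgue. u t x * \<psi> x) \<longlongrightarrow> \<Lambda> \<psi>) (at_right 0)"
      and \<Lambda>: "\<And>\<psi> I S. \<psi> \<in> Cc \<Omega> \<Longrightarrow> 0 < I \<Longrightarrow> 0 < S \<Longrightarrow> (\<And>y. 0 \<le> \<psi> y) \<Longrightarrow> (\<And>y. \<psi> y \<le> S) \<Longrightarrow>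
        (\<And>y. y \<notin> ball x\<^sub>0 \<eta> \<Longrightarrow> \<psi> y = 0) \<Longrightarrow> integrable lebesgue \<psi> \<Longrightarrow> (LINT y|lebesgue. \<psi> y) \<le> I \<Longrightarrow>
        \<Lambda> \<psi> \<le> 2 * I powr (1 - 1 / R) * S powr (1 / R) * X"
      and X: "0 \<le> X" and t: "0 < t" "t \<le> \<tau>"
    for \<Omega> :: "'a set" and T u x\<^sub>0 \<Lambda> X t
  proof -
    obtain Du where "weak_solution \<nu> q \<Omega> T u Du" using nonneg_weak_solution_imp_locale[OF sol] .
    then interpret weak_solution \<nu> q \<Omega> T u Du .
    have tT: "t \<in> open_time T" using t le_less_trans[of "ereal t" "ereal \<tau>" T] T by (simp add: open_time_def)
    define K where "K = cball x\<^sub>0 \<rho>2"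
    have K: "compact K" "K \<subseteq> ball x\<^sub>0 \<eta>" "K \<subseteq> \<Omega>" using \<rho>(9) ball by (auto simp: K_def)
    have \<xi>K: "\<xi> (y - x\<^sub>0) = 0" and \<phi>K: "\<phi> (y - x\<^sub>0) = 0" if "y \<notin> K" for y
      using that \<rho>(7) unfolding K_def by (auto intro!: \<xi>(4) \<phi>(4) simp: dist_norm norm_minus_commute)
    have \<xi>c: "continuous_on UNIV (\<lambda>y. \<xi> (y - x\<^sub>0))" and \<phi>c: "continuous_on UNIV (\<lambda>y. \<phi> (y - x\<^sub>0))"
      by (rule smooth_on_continuous[OF smooth_on_translate[OF \<xi>(1)]], rule smooth_on_continuous[OF smooth_on_translate[OF \<phi>(1)]])
    have int: "integrable lebesgue f" if "continuous_on UNIV f" "\<And>y. y \<notin> K \<Longrightarrow> f y = 0" for f :: "'a \<Rightarrow> real"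
    proof -
      have "set_integrable lebesgue K f"
        by (rule set_integrable_continuous_compact[OF K(1) continuous_on_subset[OF that(1) subset_UNIV]])
      moreover have "(\<lambda>y. indicator K y *\<^sub>R f y) = f" using that(2) by (auto simp: indicator_def fun_eq_iff)
      ultimately show ?thesis by (simp only: set_integrable_def)
    qed
    have mass0: "\<Lambda> (\<lambda>y. \<xi> (y - x\<^sub>0)) \<le> c2 * X"
    proof -
      have i: "integrable lebesgue (\<lambda>y. \<xi> (y - x\<^sub>0))" by (rule int[OF \<xi>c \<xi>K])
      have "(LINT y|lebesgue. \<xi> (y - x\<^sub>0)) \<le> (LINT y|lebesgue. indicator K y)"
      proof (rule integral_mono[OF i])
        show "integrable lebesgue (indicat_real K)"
          using set_integrable_continuous_compact[OF K(1), of "\<lambda>_. 1"] by (simp add: set_integrable_def)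
        show "\<xi> (y - x\<^sub>0) \<le> indicator K y" for y using \<xi>1 \<xi>K[of y] by (auto simp: indicator_def)
      qed
      also have "\<dots> = measure lebesgue K" by simp
      also have "\<dots> = V" unfolding K_def V_def using \<rho> by (intro measure_lebesgue_cball) simp
      finally have "\<Lambda> (\<lambda>y. \<xi> (y - x\<^sub>0)) \<le> 2 * V powr (1 - 1 / R) * 1 powr (1 / R) * X"
        using K by (intro \<Lambda>[OF CcI[OF \<xi>c K(1,3) \<xi>K] V] i) (auto simp: \<xi>(2) \<xi>1 intro: \<xi>K)
      then show ?thesis by (simp add: c2_def)
    qed
    have kern0: "\<Lambda> (\<lambda>y. \<phi> (y - x\<^sub>0) * heat_kernel \<nu> r (y - x)) \<le> c1 * t powr (- a) * X" if r: "t < r" for x r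
    proof -
      have hc: "continuous_on UNIV (\<lambda>y. \<phi> (y - x\<^sub>0) * heat_kernel \<nu> r (y - x))"
        using \<nu> t r by (intro continuous_on_mult \<phi>c continuous_on_heat_kernel) auto
      have z: "\<phi> (y - x\<^sub>0) * heat_kernel \<nu> r (y - x) = 0" if "y \<notin> K" for y using \<phi>K[OF that] by simp
      have le: "\<phi> (y - x\<^sub>0) * heat_kernel \<nu> r (y - x) \<le> heat_kernel \<nu> r (y - x)" for y
        using mult_right_mono[OF \<phi>1[of "y - x\<^sub>0"] heat_kernel_nonneg[of \<nu> r "y - x"]] by simp
      have i: "integrable lebesgue (\<lambda>y. \<phi> (y - x\<^sub>0) * heat_kernel \<nu> r (y - x))" by (rule int[OF hc z])
      have "(LINT y|lebesgue. \<phi> (y - x\<^sub>0) * heat_kernel \<nu> r (y - x)) \<le> (LINT y|lebesgue. heat_kernel \<nu> r (y - x))"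
        using \<nu> t r by (intro integral_mono i heat_kernel_integral(1) le) auto
      also have "\<dots> = Z" unfolding Z_def using \<nu> t r by (intro heat_kernel_integral(2)) auto
      finally have "\<Lambda> (\<lambda>y. \<phi> (y - x\<^sub>0) * heat_kernel \<nu> r (y - x))
          \<le> 2 * Z powr (1 - 1 / R) * (t powr (- (real DIM('a) / 2))) powr (1 / R) * X"
      proof (intro \<Lambda>[OF CcI[OF hc K(1,3) z] Z] i)
        show "\<phi> (y - x\<^sub>0) * heat_kernel \<nu> r (y - x) \<le> t powr (- (real DIM('a) / 2))" for y
          using le[of y] heat_kernel_le[OF \<nu> t(1) less_imp_le[OF r], of "y - x"] by simp
        show "0 \<le> \<phi> (y - x\<^sub>0) * heat_kernel \<nu> r (y - x)" for y by (simp add: \<phi>(2) heat_kernel_nonneg)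
        show "\<phi> (y - x\<^sub>0) * heat_kernel \<nu> r (y - x) = 0" if "y \<notin> ball x\<^sub>0 \<eta>" for y using that K(2) by (intro z) auto
      qed (use t in auto)
      \<comment> \<open>The supremum of the kernel enters with exponent \<open>1 / R\<close>, which produces the rate.\<close>
      also have "(t powr (- (real DIM('a) / 2))) powr (1 / R) = t powr (- a)"
        by (simp add: powr_powr a_def)
      finally show ?thesis by (simp add: c1_def)
    qed
    have est: "AE x in lebesgue. x \<in> cball x\<^sub>0 \<rho>0 \<longrightarrow> u t x \<le> E * (c1 * t powr (- a) * X + B * (c2 * X + 2 * M * t) * t)"
      unfolding E_def
      by (rule local_estimate[OF q \<nu> \<rho>(2,7) \<xi> L \<phi>(1,2) \<phi>one \<phi>(4) B M_def[unfolded V_def] K(3)[unfolded K_def] tr tT _ mass0 kern0])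
        (use X c2_def in auto)
    have "E * (c1 * t powr (- a) * X + B * (c2 * X + 2 * M * t) * t) \<le> C * t powr (- a) * (t + X)"
    proof -
      \<comment> \<open>The terms without the singular factor are absorbed into it because time is bounded by \<open>\<tau>\<close>.\<close>
      have one: "1 \<le> \<tau> powr a * t powr (- a)"
      proof -
        have "\<tau> powr a * t powr (- a) = (\<tau> / t) powr a" using t \<tau> by (simp add: powr_divide powr_minus_divide)
        also have "\<dots> \<ge> 1" using t \<tau> R by (intro ge_one_powr_ge_zero) (auto simp: a_def)
        finally show ?thesis .
      qed
      have "B * (c2 * X + 2 * M * t) * t \<le> B * ((c2 + 2 * M) * (t + X)) * \<tau>"
        using B M X t by (intro mult_mono mult_left_mono) (auto simp: c2_def algebra_simps)
      also have "\<dots> \<le> B * ((c2 + 2 * M) * (t + X)) * \<tau> * (\<tau> powr a * t powr (- a))"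
      proof -
        have "0 \<le> B * ((c2 + 2 * M) * (t + X)) * \<tau>" using B M X t \<tau> by (simp add: c2_def)
        from mult_left_mono[OF one this] show ?thesis by simp
      qed
      also have "\<dots> = D * t powr (- a) * (t + X)" by (simp add: D_def algebra_simps)
      finally have "c1 * t powr (- a) * X + B * (c2 * X + 2 * M * t) * t \<le> c1 * t powr (- a) * (t + X) + D * t powr (- a) * (t + X)"
        using X t by (intro add_mono mult_left_mono) (auto simp: c1_def)
      then have "E * (c1 * t powr (- a) * X + B * (c2 * X + 2 * M * t) * t) \<le> E * (c1 * t powr (- a) * (t + X) + D * t powr (- a) * (t + X))"
        by (intro mult_left_mono) (auto simp: E_def)
      then show ?thesis by (simp add: C_def algebra_simps)
    qed
    note const = this
    have ae: "AE x in lebesgue. x \<in> ball x\<^sub>0 (\<eta> / 2) \<longrightarrow> u t x \<le> C * t powr (- a) * (t + X)"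
      using est by eventually_elim (auto simp: \<rho>0_def intro: order_trans[OF _ const])
    have "Lp_loc 1 \<Omega> (u t)" using u_cont tT unfolding C_Lp_loc_def by blast
    moreover have "ball x\<^sub>0 (\<eta> / 2) \<subseteq> \<Omega>" using ball \<eta> by auto
    ultimately show ?thesis using sup_on_le[OF open_ball _ _ ae] by blast
  qed
  show ?thesis
    by (rule exI[of _ C], intro conjI C allI impI, unfold a_def[symmetric], rule main) auto
qed

lemma cball_subset_of_compactly_contained:
  fixes x :: "'a::euclidean_space"
  assumes "compactly_contained (ball x (2 * \<eta>)) \<Omega>" "0 < \<eta>"
  shows "cball x \<eta> \<subseteq> \<Omega>"
proof -
  have "cball x \<eta> \<subseteq> ball x (2 * \<eta>)" using assms(2) by auto
  then show ?thesis using assms(1) closure_subset[of "ball x (2 * \<eta>)"] by (auto simp: compactly_contained_def)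
qed

lemma integral_le_measure_ball:
  fixes \<psi> :: "'a::euclidean_space \<Rightarrow> real"
  assumes \<mu>: "nonneg_radon_measure \<Omega> \<mu>" and ball: "cball x \<eta> \<subseteq> \<Omega>" "open \<Omega>"
    and \<psi>: "\<And>y. 0 \<le> \<psi> y" "\<And>y. \<psi> y \<le> S" "\<And>y. y \<notin> ball x \<eta> \<Longrightarrow> \<psi> y = 0" and S: "0 \<le> S"
  shows "(LINT y:\<Omega>|\<mu>. \<psi> y) \<le> S * measure \<mu> (ball x \<eta>)"
proof -
  have sets: "sets \<mu> = sets (restrict_space borel \<Omega>)" using \<mu> by (simp add: nonneg_radon_measure_def)
  have in_sets: "A \<in> sets \<mu>" if "A \<in> sets borel" "A \<subseteq> \<Omega>" for A
    unfolding sets using that ball(2) by (auto simp: sets_restrict_space_iff)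
  have c: "cball x \<eta> \<in> sets \<mu>" and b: "ball x \<eta> \<in> sets \<mu>"
    using ball ball_subset_cball[of x \<eta>] by (auto intro!: in_sets)
  have "emeasure \<mu> (ball x \<eta>) \<le> emeasure \<mu> (cball x \<eta>)" by (intro emeasure_mono c) auto
  also have "\<dots> < \<infinity>" using \<mu> ball by (simp add: nonneg_radon_measure_def)
  finally have i: "integrable \<mu> (\<lambda>y. S * indicator (ball x \<eta>) y)" using b by simp
  have le: "indicator \<Omega> y *\<^sub>R \<psi> y \<le> S * indicator (ball x \<eta>) y" for y
    using \<psi>[of y] S by (auto simp: indicator_def)
  have "(LINT y:\<Omega>|\<mu>. \<psi> y) \<le> (LINT y|\<mu>. S * indicator (ball x \<eta>) y)"
    unfolding set_lebesgue_integral_def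
  proof (rule integral_mono'[OF i le])
    show "0 \<le> S * indicator (ball x \<eta>) y" for y using S by (simp add: indicator_def)
  qed
  also have "\<dots> = S * measure \<mu> (ball x \<eta>)" using b sets.sets_into_space[OF b] by (simp add: Int_absorb2)
  finally show ?thesis .
qed

theorem theorem1p1:
  fixes q \<nu> R \<eta> \<tau> :: real
  assumes "1 < q" and "0 < \<nu>" and "\<nu> \<le> 1" and "1 \<le> R" and "0 < \<eta>" and "0 < \<tau>"
  shows "\<exists>C::real. 0 < C \<and>
    (\<forall>(\<Omega> :: (real ^ 'n) set) (T :: ereal) (u :: real \<Rightarrow> real ^ 'n \<Rightarrow> real) x\<^sub>0 u\<^sub>0.
       open \<Omega> \<and> connected \<Omega> \<and> 0 < T \<and> ereal \<tau> < T \<and>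
       nonneg_weak_solution \<nu> q \<Omega> T u \<and>
       compactly_contained (ball x\<^sub>0 (2 * \<eta>)) \<Omega> \<and>
       Lp_loc R \<Omega> u\<^sub>0 \<and> (AE x in lebesgue. x \<in> \<Omega> \<longrightarrow> 0 \<le> u\<^sub>0 x) \<and>
       has_trace \<Omega> u (measure_of_density \<Omega> u\<^sub>0) \<and>
       C_Lp_loc (half_open_time T) R \<Omega> (u(0 := u\<^sub>0)) \<longrightarrow>
       (\<forall>t. 0 < t \<and> t \<le> \<tau> \<longrightarrow>
          sup_on (ball x\<^sub>0 (\<eta> / 2)) (u t)
            \<le> ereal (C * t powr (- (real CARD('n) / (2 * R))) * (t + Lp_norm R (ball x\<^sub>0 \<eta>) u\<^sub>0)))) \<and>
    (R = 1 \<longrightarrow>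
      (\<forall>(\<Omega> :: (real ^ 'n) set) (T :: ereal) (u :: real \<Rightarrow> real ^ 'n \<Rightarrow> real) x\<^sub>0 u\<^sub>0.
         open \<Omega> \<and> connected \<Omega> \<and> 0 < T \<and> ereal \<tau> < T \<and>
         nonneg_weak_solution \<nu> q \<Omega> T u \<and>
         compactly_contained (ball x\<^sub>0 (2 * \<eta>)) \<Omega> \<and>
         nonneg_radon_measure \<Omega> u\<^sub>0 \<and> has_trace \<Omega> u u\<^sub>0 \<longrightarrow>
         (\<forall>t. 0 < t \<and> t \<le> \<tau> \<longrightarrow>
            sup_on (ball x\<^sub>0 (\<eta> / 2)) (u t)
              \<le> ereal (C * t powr (- (real CARD('n) / (2 * R))) * (t + measure u\<^sub>0 (ball x\<^sub>0 \<eta>))))))"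
proof -
  have dim: "real CARD('n) = real DIM(real ^ 'n)" by simp
  obtain C where C: "0 < C" and main: "\<And>(\<Omega> :: (real ^ 'n) set) T u x\<^sub>0 \<Lambda> X t.
    nonneg_weak_solution \<nu> q \<Omega> T u \<Longrightarrow> ereal \<tau> < T \<Longrightarrow> cball x\<^sub>0 \<eta> \<subseteq> \<Omega> \<Longrightarrow>
    (\<forall>\<psi>\<in>Cc \<Omega>. ((\<lambda>t. LINT x:\<Omega>|lebesgue. u t x * \<psi> x) \<longlongrightarrow> \<Lambda> \<psi>) (at_right 0)) \<Longrightarrow>
    (\<forall>\<psi>\<in>Cc \<Omega>. \<forall>I S. 0 < I \<longrightarrow> 0 < S \<longrightarrow> (\<forall>y. 0 \<le> \<psi> y \<and> \<psi> y \<le> S) \<longrightarrow> (\<forall>y. y \<notin> ball x\<^sub>0 \<eta> \<longrightarrow> \<psi> y = 0) \<longrightarrow>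
      integrable lebesgue \<psi> \<longrightarrow> (LINT y|lebesgue. \<psi> y) \<le> I \<longrightarrow> \<Lambda> \<psi> \<le> 2 * I powr (1 - 1 / R) * S powr (1 / R) * X) \<Longrightarrow>
    0 \<le> X \<Longrightarrow> 0 < t \<Longrightarrow> t \<le> \<tau> \<Longrightarrow>
    sup_on (ball x\<^sub>0 (\<eta> / 2)) (u t) \<le> ereal (C * t powr (- (real CARD('n) / (2 * R))) * (t + X))"
    using local_regularizing_effect[OF assms(1,2,4,5,6), where 'a = "real ^ 'n"] unfolding dim by (elim exE conjE) (simp only: mp)
  show ?thesis
  proof (intro exI[of _ C] conjI allI impI C; elim conjE)
    fix \<Omega> :: "(real ^ 'n) set" and T u x\<^sub>0 u\<^sub>0 and t :: real
    assume \<Omega>: "open \<Omega>" and T: "ereal \<tau> < T" and sol: "nonneg_weak_solution \<nu> q \<Omega> T u"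
      and cc: "compactly_contained (ball x\<^sub>0 (2 * \<eta>)) \<Omega>"
      and u\<^sub>0: "Lp_loc R \<Omega> u\<^sub>0" "AE x in lebesgue. x \<in> \<Omega> \<longrightarrow> 0 \<le> u\<^sub>0 x"
      and tr: "has_trace \<Omega> u (measure_of_density \<Omega> u\<^sub>0)" and t: "0 < t" "t \<le> \<tau>"
    have ball: "cball x\<^sub>0 \<eta> \<subseteq> \<Omega>" by (rule cball_subset_of_compactly_contained[OF cc assms(5)])
    show "sup_on (ball x\<^sub>0 (\<eta> / 2)) (u t)
            \<le> ereal (C * t powr (- (real CARD('n) / (2 * R))) * (t + Lp_norm R (ball x\<^sub>0 \<eta>) u\<^sub>0))"
    proof (rule main[OF sol T ball tr[unfolded has_trace_def] _ _ t], intro ballI allI impI)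
      fix \<psi> and I S :: real
      assume \<psi>: "\<psi> \<in> Cc \<Omega>" and IS: "0 < I" "0 < S" and \<psi>S: "\<forall>y. 0 \<le> \<psi> y \<and> \<psi> y \<le> S"
        and z: "\<forall>y. y \<notin> ball x\<^sub>0 \<eta> \<longrightarrow> \<psi> y = 0" and i: "integrable lebesgue \<psi>" "(LINT y|lebesgue. \<psi> y) \<le> I"
      have "(LINT x:\<Omega>|measure_of_density \<Omega> u\<^sub>0. \<psi> x) = (LINT x:\<Omega>|lebesgue. u\<^sub>0 x * \<psi> x)"
        using \<psi> by (intro integral_measure_of_density[OF \<Omega> u\<^sub>0]) (simp add: Cc_def)
      also have "\<dots> = (LINT x:ball x\<^sub>0 \<eta>|lebesgue. u\<^sub>0 x * \<psi> x)"
        using ball ball_subset_cball[of x\<^sub>0 \<eta>] z by (intro set_integral_support(1)) auto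
      also have "\<dots> \<le> 2 * I powr (1 - 1 / R) * S powr (1 / R) * Lp_norm R (ball x\<^sub>0 \<eta>) u\<^sub>0"
      proof (rule weighted_integral_le_Lp_norm[OF assms(4) IS i(1) _ _ i(2)])
        have "set_integrable lebesgue (cball x\<^sub>0 \<eta>) (\<lambda>y. norm (u\<^sub>0 y) powr R)"
          using u\<^sub>0(1) ball by (simp add: Lp_loc_def)
        then show "set_integrable lebesgue (ball x\<^sub>0 \<eta>) (\<lambda>y. norm (u\<^sub>0 y) powr R)"
          by (rule set_integrable_subset) auto
      qed (use \<psi>S in auto)
      finally show "(LINT x:\<Omega>|measure_of_density \<Omega> u\<^sub>0. \<psi> x)
          \<le> 2 * I powr (1 - 1 / R) * S powr (1 / R) * Lp_norm R (ball x\<^sub>0 \<eta>) u\<^sub>0" .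
    qed (simp add: Lp_norm_def)
  next
    fix \<Omega> :: "(real ^ 'n) set" and T u x\<^sub>0 and u\<^sub>0 :: "(real ^ 'n) measure" and t :: real
    assume R: "R = 1" and \<Omega>: "open \<Omega>" and T: "ereal \<tau> < T" and sol: "nonneg_weak_solution \<nu> q \<Omega> T u"
      and cc: "compactly_contained (ball x\<^sub>0 (2 * \<eta>)) \<Omega>"
      and u\<^sub>0: "nonneg_radon_measure \<Omega> u\<^sub>0" and tr: "has_trace \<Omega> u u\<^sub>0" and t: "0 < t" "t \<le> \<tau>"
    have ball: "cball x\<^sub>0 \<eta> \<subseteq> \<Omega>" by (rule cball_subset_of_compactly_contained[OF cc assms(5)])
    show "sup_on (ball x\<^sub>0 (\<eta> / 2)) (u t)
            \<le> ereal (C * t powr (- (real CARD('n) / (2 * R))) * (t + measure u\<^sub>0 (ball x\<^sub>0 \<eta>)))"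
    proof (rule main[OF sol T ball tr[unfolded has_trace_def] _ _ t], intro ballI allI impI)
      fix \<psi> and I S :: real
      assume IS: "0 < I" "0 < S" and \<psi>S: "\<forall>y. 0 \<le> \<psi> y \<and> \<psi> y \<le> S" and z: "\<forall>y. y \<notin> ball x\<^sub>0 \<eta> \<longrightarrow> \<psi> y = 0"
      have "(LINT x:\<Omega>|u\<^sub>0. \<psi> x) \<le> S * measure u\<^sub>0 (ball x\<^sub>0 \<eta>)"
        using \<psi>S z IS by (intro integral_le_measure_ball[OF u\<^sub>0 ball \<Omega>]) auto
      also have "\<dots> \<le> 2 * (S * measure u\<^sub>0 (ball x\<^sub>0 \<eta>))" using IS by simp
      finally show "(LINT x:\<Omega>|u\<^sub>0. \<psi> x) \<le> 2 * I powr (1 - 1 / R) * S powr (1 / R) * measure u\<^sub>0 (ball x\<^sub>0 \<eta>)"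
        using R IS by simp
    qed simp
  qed
qed

end
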